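(* Let $n\ge2$. The only ancient, weakly convex, embedded solutions $M_t$ of the mean curvature flow of hypersurfaces in the unit sphere $\mathbb{S}^{n+1}$ are equators (stationary in time) and shrinking geodesic spheres.
   Context: $\mathbb{S}^{n+1}$ is the unit sphere with its round metric $\langle\cdot,\cdot\rangle$ of constant sectional curvature $1$, and $D$ is its Levi-Civita connection. $M^n$ is a smooth connected closed (compact, without boundary) $n$-manifold. An embedded solution of the mean curvature flow is a smooth family of smooth embeddings $F(\cdot,t):M^n\to\mathbb{S}^{n+1}$ with $\partial_tF(p,t)=-H(p,t)\nu(p,t)$, where $\nu(p,t)$ is the outer unit normal of $M_t=F(M^n,t)$ at $F(p,t)$. The second fundamental form is $A(X,Y)=\langle D_X\nu,Y\rangle$ for $X,Y$ tangent to $M_t$ (so small geodesic spheres with outer normal have positive definite $A$), and $H$ is its trace with respect to the induced metric. The solution is weakly convex if $A\ge0$ on $M_t$ for all $t$ in the time interval. It is ancient if it is defined on a time interval of the form $(-\infty,T)$. An equator is a totally geodesic great hypersphere $\{x\in\mathbb{S}^{n+1}:\langle x,e\rangle=0\}$, $e$ a unit vector in $\mathbb{R}^{n+2}$; it is a stationary solution. A family of shrinking geodesic spheres is an ancient solution for which every $M_t$ is a geodesic sphere $\{x\in\mathbb{S}^{n+1}: d(x,p_0)=\rho(t)\}$ about a fixed center $p_0\in\mathbb{S}^{n+1}$, where $d$ is the spherical distance, with radius $\rho(t)\in(0,\pi/2)$ strictly decreasing in $t$. *)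

theory Defs
  imports "HOL-Analysis.Analysis"
begin

section \<open>Smooth functions\<close>

(* Recursing on all directional derivatives of the Frechet derivative keeps the type of the
   function fixed. Only used on open sets S. *)
primrec higher_differentiable_on ::
  "'a::real_normed_vector set \<Rightarrow> ('a \<Rightarrow> 'b::real_normed_vector) \<Rightarrow> nat \<Rightarrow> bool" where
  "higher_differentiable_on S f 0 \<longleftrightarrow> continuous_on S f"
| "higher_differentiable_on S f (Suc k) \<longleftrightarrow>
     (\<forall>x\<in>S. f differentiable (at x)) \<and>
     (\<forall>v. higher_differentiable_on S (\<lambda>x. frechet_derivative f (at x) v) k)"

definition smooth_on :: "'a::real_normed_vector set \<Rightarrow> ('a \<Rightarrow> 'b::real_normed_vector) \<Rightarrow> bool" where
  "smooth_on S f \<longleftrightarrow> (\<forall>k. higher_differentiable_on S f k)"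


section \<open>Closed smooth manifolds\<close>

(* A chart is a pair of its domain and its coordinate map; values of the coordinate map
   outside the domain are irrelevant. *)
type_synonym ('p, 'n) chart = "'p set \<times> ('p \<Rightarrow> real ^ 'n)"

definition chart_inv :: "('p, 'n) chart \<Rightarrow> real ^ 'n \<Rightarrow> 'p" where
  "chart_inv c = inv_into (fst c) (snd c)"

definition is_chart :: "'p topology \<Rightarrow> ('p, 'n::finite) chart \<Rightarrow> bool" where
  "is_chart M c \<longleftrightarrow>
     openin M (fst c) \<and> open (snd c ` fst c) \<and>
     homeomorphic_map (subtopology M (fst c)) (top_of_set (snd c ` fst c)) (snd c)"

definition smooth_atlas :: "'p topology \<Rightarrow> ('p, 'n::finite) chart set \<Rightarrow> bool" where
  "smooth_atlas M \<A> \<longleftrightarrow>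
     (\<forall>c\<in>\<A>. is_chart M c) \<and>
     (\<Union>c\<in>\<A>. fst c) = topspace M \<and>
     (\<forall>c\<in>\<A>. \<forall>d\<in>\<A>. smooth_on (snd c ` (fst c \<inter> fst d)) (snd d \<circ> chart_inv c))"

definition closed_connected_manifold :: "'p topology \<Rightarrow> ('p, 'n::finite) chart set \<Rightarrow> bool" where
  "closed_connected_manifold M \<A> \<longleftrightarrow>
     Hausdorff_space M \<and> second_countable M \<and> smooth_atlas M \<A> \<and>
     compact_space M \<and> connected_space M \<and> topspace M \<noteq> {}"


section \<open>Hypersurfaces of the unit sphere\<close>

(* df_p(v), where v is a coordinate vector in the chart c around p. *)
definition chart_deriv ::
  "('p, 'n::finite) chart \<Rightarrow> ('p \<Rightarrow> 'e::real_normed_vector) \<Rightarrow> 'p \<Rightarrow> real ^ 'n \<Rightarrow> 'e" where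
  "chart_deriv c f p v = frechet_derivative (f \<circ> chart_inv c) (at (snd c p)) v"

(* Maps into the sphere are regarded as maps into Euclidean space; this is the usual smoothness
   because the sphere is an embedded submanifold. *)
definition smooth_embedding_into_sphere ::
  "'p topology \<Rightarrow> ('p, 'n::finite) chart set \<Rightarrow> ('p \<Rightarrow> 'e::euclidean_space) \<Rightarrow> bool" where
  "smooth_embedding_into_sphere M \<A> f \<longleftrightarrow>
     f ` topspace M \<subseteq> sphere 0 1 \<and>
     embedding_map M euclidean f \<and>
     (\<forall>c\<in>\<A>. smooth_on (snd c ` fst c) (f \<circ> chart_inv c) \<and>
             (\<forall>p\<in>fst c. inj (chart_deriv c f p)))"

(* On the sphere both complementary components of a closed hypersurface are bounded by it, so
   "outer" is relative to the choice of one of them, \<Omega>, as the enclosed region. The normal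
   geodesics s \<mapsto> cos s f(p) + sin s \<nu>(p) leave \<Omega> as s increases through 0. *)
definition outer_unit_normal ::
  "'p topology \<Rightarrow> ('p, 'n::finite) chart set \<Rightarrow> ('p \<Rightarrow> 'e::euclidean_space) \<Rightarrow> ('p \<Rightarrow> 'e) \<Rightarrow> bool" where
  "outer_unit_normal M \<A> f \<nu> \<longleftrightarrow>
     (\<forall>c\<in>\<A>. \<forall>p\<in>fst c. norm (\<nu> p) = 1 \<and> \<nu> p \<bullet> f p = 0 \<and> (\<forall>v. \<nu> p \<bullet> chart_deriv c f p v = 0)) \<and>
     (\<exists>\<Omega>\<in>components (sphere 0 1 - f ` topspace M). \<forall>p\<in>topspace M.
        \<forall>\<^sub>F s in at_right 0.
          cos s *\<^sub>R f p - sin s *\<^sub>R \<nu> p \<in> \<Omega> \<and> cos s *\<^sub>R f p + sin s *\<^sub>R \<nu> p \<notin> \<Omega>)"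

(* The Levi-Civita connection of the round sphere is the tangential part of the Euclidean
   derivative; this is D_X \<nu> for X = df_p(v). *)
definition sphere_cov_deriv ::
  "('p, 'n::finite) chart \<Rightarrow> ('p \<Rightarrow> 'e::euclidean_space) \<Rightarrow> ('p \<Rightarrow> 'e) \<Rightarrow> 'p \<Rightarrow> real ^ 'n \<Rightarrow> 'e" where
  "sphere_cov_deriv c f \<nu> p v =
     chart_deriv c \<nu> p v - (chart_deriv c \<nu> p v \<bullet> f p) *\<^sub>R f p"

definition second_fundamental_form ::
  "('p, 'n::finite) chart \<Rightarrow> ('p \<Rightarrow> 'e::euclidean_space) \<Rightarrow> ('p \<Rightarrow> 'e) \<Rightarrow> 'p \<Rightarrow> real ^ 'n \<Rightarrow> real ^ 'n \<Rightarrow> real" where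
  "second_fundamental_form c f \<nu> p v w = sphere_cov_deriv c f \<nu> p v \<bullet> chart_deriv c f p w"

definition induced_metric ::
  "('p, 'n::finite) chart \<Rightarrow> ('p \<Rightarrow> 'e::euclidean_space) \<Rightarrow> 'p \<Rightarrow> real ^ 'n \<Rightarrow> real ^ 'n \<Rightarrow> real" where
  "induced_metric c f p v w = chart_deriv c f p v \<bullet> chart_deriv c f p w"

definition form_matrix :: "(real ^ 'n \<Rightarrow> real ^ 'n \<Rightarrow> real) \<Rightarrow> real ^ 'n ^ 'n" where
  "form_matrix b = (\<chi> i j. b (axis i 1) (axis j 1))"

definition mean_curvature ::
  "('p, 'n::finite) chart \<Rightarrow> ('p \<Rightarrow> 'e::euclidean_space) \<Rightarrow> ('p \<Rightarrow> 'e) \<Rightarrow> 'p \<Rightarrow> real" where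
  "mean_curvature c f \<nu> p =
     trace (matrix_inv (form_matrix (induced_metric c f p)) **
            form_matrix (second_fundamental_form c f \<nu> p))"


section \<open>Ancient solutions of the mean curvature flow\<close>

(* T = \<infinity> is allowed. *)
definition ancient_interval :: "ereal \<Rightarrow> real set" where
  "ancient_interval T = {t. ereal t < T}"

definition smooth_family ::
  "('p, 'n::finite) chart set \<Rightarrow> real set \<Rightarrow> ('p \<Rightarrow> real \<Rightarrow> 'e::euclidean_space) \<Rightarrow> bool" where
  "smooth_family \<A> I F \<longleftrightarrow>
     (\<forall>c\<in>\<A>. smooth_on ((snd c ` fst c) \<times> I) (\<lambda>(x, t). F (chart_inv c x) t))"

(* Smoothness of \<nu> in (p, t) means that the enclosed side is chosen coherently in time. *)
definition ancient_embedded_mcf ::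
  "'p topology \<Rightarrow> ('p, 'n::finite) chart set \<Rightarrow> ereal \<Rightarrow>
   ('p \<Rightarrow> real \<Rightarrow> 'e::euclidean_space) \<Rightarrow> ('p \<Rightarrow> real \<Rightarrow> 'e) \<Rightarrow> bool" where
  "ancient_embedded_mcf M \<A> T F \<nu> \<longleftrightarrow>
     smooth_family \<A> (ancient_interval T) F \<and>
     smooth_family \<A> (ancient_interval T) \<nu> \<and>
     (\<forall>t\<in>ancient_interval T.
        smooth_embedding_into_sphere M \<A> (\<lambda>p. F p t) \<and>
        outer_unit_normal M \<A> (\<lambda>p. F p t) (\<lambda>p. \<nu> p t) \<and>
        (\<forall>c\<in>\<A>. \<forall>p\<in>fst c.
           ((\<lambda>s. F p s) has_vector_derivative
              - (mean_curvature c (\<lambda>q. F q t) (\<lambda>q. \<nu> q t) p *\<^sub>R \<nu> p t)) (at t)))"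

definition weakly_convex ::
  "('p, 'n::finite) chart set \<Rightarrow> ereal \<Rightarrow>
   ('p \<Rightarrow> real \<Rightarrow> 'e::euclidean_space) \<Rightarrow> ('p \<Rightarrow> real \<Rightarrow> 'e) \<Rightarrow> bool" where
  "weakly_convex \<A> T F \<nu> \<longleftrightarrow>
     (\<forall>t\<in>ancient_interval T. \<forall>c\<in>\<A>. \<forall>p\<in>fst c. \<forall>v.
        second_fundamental_form c (\<lambda>q. F q t) (\<lambda>q. \<nu> q t) p v v \<ge> 0)"

definition ancient_weakly_convex_embedded_solution ::
  "'p topology \<Rightarrow> ('p, 'n::finite) chart set \<Rightarrow> ereal \<Rightarrow> ('p \<Rightarrow> real \<Rightarrow> 'e::euclidean_space) \<Rightarrow> bool" where
  "ancient_weakly_convex_embedded_solution M \<A> T F \<longleftrightarrow>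
     (\<exists>\<nu>. ancient_embedded_mcf M \<A> T F \<nu> \<and> weakly_convex \<A> T F \<nu>)"


section \<open>Equators and shrinking geodesic spheres\<close>

definition equator :: "'e::euclidean_space \<Rightarrow> 'e set" where
  "equator e = {x \<in> sphere 0 1. x \<bullet> e = 0}"

definition stationary_equator_solution ::
  "'p topology \<Rightarrow> ('p, 'n::finite) chart set \<Rightarrow> ereal \<Rightarrow> ('p \<Rightarrow> real \<Rightarrow> 'e::euclidean_space) \<Rightarrow> bool" where
  "stationary_equator_solution M \<A> T F \<longleftrightarrow>
     (\<exists>\<nu>. ancient_embedded_mcf M \<A> T F \<nu>) \<and>
     (\<exists>e. norm e = 1 \<and> (\<forall>t\<in>ancient_interval T. (\<lambda>p. F p t) ` topspace M = equator e))"

definition spherical_dist :: "'e::euclidean_space \<Rightarrow> 'e \<Rightarrow> real" where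
  "spherical_dist x y = arccos (x \<bullet> y)"

definition geodesic_sphere :: "'e::euclidean_space \<Rightarrow> real \<Rightarrow> 'e set" where
  "geodesic_sphere p\<^sub>0 r = {x \<in> sphere 0 1. spherical_dist x p\<^sub>0 = r}"

definition shrinking_geodesic_spheres ::
  "'p topology \<Rightarrow> ('p, 'n::finite) chart set \<Rightarrow> ereal \<Rightarrow> ('p \<Rightarrow> real \<Rightarrow> 'e::euclidean_space) \<Rightarrow> bool" where
  "shrinking_geodesic_spheres M \<A> T F \<longleftrightarrow>
     (\<exists>\<nu>. ancient_embedded_mcf M \<A> T F \<nu>) \<and>
     (\<exists>p\<^sub>0\<in>sphere 0 1. \<exists>\<rho>::real \<Rightarrow> real.
        monotone_on (ancient_interval T) (<) (>) \<rho> \<and>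
        (\<forall>t\<in>ancient_interval T.
           0 < \<rho> t \<and> \<rho> t < pi / 2 \<and>
           (\<lambda>p. F p t) ` topspace M = geodesic_sphere p\<^sub>0 (\<rho> t)))"

end

theory Submission
  imports Defs
begin

text \<open>
  The second fundamental form \<open>h\<close> satisfies a pinching estimate that becomes an identity in the
  ancient limit. With \<open>\<eta>(t) = (1 - exp (-2n(t - t0))) / n\<close>, that is \<open>\<eta>' = 2 - 2 n \<eta>\<close> and
  \<open>\<eta>(t0) = 0\<close>, the tensor \<open>h - \<eta> H g\<close> solves a linear reaction-diffusion equation: the curvature of
  the ambient sphere contributes exactly the inhomogeneous term \<open>2 H g\<close>, which \<open>\<eta>'\<close> absorbs. By weak
  convexity it is nonnegative at \<open>t0\<close>, hence, by the maximum principle, at all later times. Letting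
  \<open>t0\<close> tend to \<open>-\<infinity>\<close> gives \<open>h \<ge> (H / n) g\<close>, and taking traces shows that every \<open>M_t\<close> is umbilic.

  For umbilic slices with principal curvature \<open>\<kappa>\<close>, the Codazzi equation makes \<open>\<kappa>\<close> constant in space,
  and the unit vector \<open>(\<nu> - \<kappa> F) / sqrt (1 + \<kappa>^2)\<close> is constant in space and time. So \<open>M_t\<close> lies on
  a geodesic sphere about minus this vector, whose radius \<open>\<rho>\<close> satisfies \<open>cos \<rho> = C exp (n t)\<close> with
  \<open>C \<ge> 0\<close>; the equators are the case \<open>C = 0\<close>.

  Conversely, the outer normal of a sphere may point to either side, because either complementary
  component may serve as the enclosed region; if \<open>h\<close> has the wrong sign, the opposite normal is used.
\<close>

section \<open>Calculus of smooth functions\<close>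

text \<open>The obstacle is that the maximum principle is needed for a tensor, whose smallest
  eigenvalue is not a smooth function. At a first contact point with null direction
  \<open>v\<close>, coordinates are therefore chosen in which \<open>v\<close> is a coordinate
  vector and, at that single point, the metric is the identity and the Christoffel symbols vanish.
  The scalar entry \<open>h m m - (a H - b) g m m\<close> then serves as a test function, and
  derivative tests for real functions suffice. No connection is introduced: \<open>F\<close> and
  \<nu> are vector-valued, all derivatives are flat, and the position vector \<open>F\<close> acts
  as a second normal whose components yield the curvature terms of the sphere. The constant
  \<open>2 n\<close> arises because the sphere contributes \<open>- n h + 2 H g\<close> to the
  equation of \<open>h\<close> and \<open>n H\<close> to that of \<open>H\<close>; inserting
  \<open>h = \<eta> H g\<close> leaves \<open>(2 - 2 n \<eta> - \<eta>') H\<close>. The other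
  zeroth-order coefficient, \<open>|h|^2 - n\<close>, has no sign. It is bounded above because
  convexity gives \<open>|h|^2 \<le> H^2\<close> and \<open>H\<close> is bounded on a compact time
  interval, and an exponential weight in time absorbs the bound.\<close>

text \<open>The direction comes first and the point last, so that \<open>dd v (dd w f)\<close>
  iterates as in the recursion of \<open>higher_differentiable_on\<close>.\<close>

definition dd :: "'a::real_normed_vector \<Rightarrow> ('a \<Rightarrow> 'b::real_normed_vector) \<Rightarrow> 'a \<Rightarrow> 'b" where
  "dd v f z = frechet_derivative f (at z) v"

lemma dd_eqI: "(f has_derivative D) (at z) \<Longrightarrow> dd v f z = D v"
  unfolding dd_def using frechet_derivative_at by metis

text \<open>\<open>frechet_derivative\<close> is a choice among the derivatives at \<open>z\<close>,
  and locally equal functions have the same ones; this covers points without a derivative as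
  well.\<close>

lemma frechet_derivative_cong_open:
  assumes "open S" "z \<in> S" "\<And>x. x \<in> S \<Longrightarrow> f x = g x"
  shows "frechet_derivative f (at z) = frechet_derivative g (at z)"
proof -
  have "(f has_derivative D) (at z) \<longleftrightarrow> (g has_derivative D) (at z)" for D
    using assms by (metis has_derivative_transform_within_open)
  then show ?thesis unfolding frechet_derivative_def by simp
qed

lemma dd_cong_open:
  assumes "open S" "z \<in> S" "\<And>x. x \<in> S \<Longrightarrow> f x = g x"
  shows "dd v f z = dd v g z"
  unfolding dd_def using frechet_derivative_cong_open[OF assms] by simp

lemma differentiable_cong_open:
  assumes "open S" "z \<in> S" "\<And>x. x \<in> S \<Longrightarrow> f x = g x" "f differentiable at z"
  shows "g differentiable at z"
  using assms unfolding differentiable_def by (metis has_derivative_transform_within_open)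

abbreviation "Ck_on \<equiv> higher_differentiable_on"

lemma Ck_on_cong:
  assumes "open S" "\<And>x. x \<in> S \<Longrightarrow> f x = g x" "Ck_on S f k"
  shows "Ck_on S g k"
  using assms(2,3)
proof (induction k arbitrary: f g)
  case 0
  then show ?case by (auto cong: continuous_on_cong)
next
  case (Suc k)
  have "g differentiable at x" if "x \<in> S" for x
    using differentiable_cong_open[OF assms(1) that Suc.prems(1)] Suc.prems(2) that by auto
  moreover have "Ck_on S (\<lambda>x. frechet_derivative g (at x) v) k" for v
    using Suc.IH[of "\<lambda>x. frechet_derivative f (at x) v"] Suc.prems
      frechet_derivative_cong_open[OF assms(1) _ Suc.prems(1)] by auto
  ultimately show ?case by simp
qed

lemma Ck_on_Suc_dd:
  "Ck_on S f (Suc k) \<longleftrightarrow>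
    (\<forall>x\<in>S. f differentiable at x) \<and> (\<forall>v. Ck_on S (dd v f) k)"
  by (simp add: dd_def[abs_def])

lemma Ck_on_SucD:
  "Ck_on S f (Suc k) \<Longrightarrow> Ck_on S f k"
proof (induction k arbitrary: f)
  case 0
  then show ?case
    by (auto intro!: continuous_at_imp_continuous_on differentiable_imp_continuous_within)
next
  case (Suc k)
  then show ?case by (subst (asm) Ck_on_Suc_dd, subst Ck_on_Suc_dd) blast
qed

lemma Ck_on_const: "Ck_on S (\<lambda>x. c) k"
  by (induction k arbitrary: c) (auto simp: frechet_derivative_const)

lemma dd_bounded_linear:
  assumes "bounded_linear L" "f differentiable at z"
  shows "dd v (\<lambda>x. L (f x)) z = L (dd v f z)"
proof -
  have "(f has_derivative frechet_derivative f (at z)) (at z)"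
    using assms frechet_derivative_works by blast
  from dd_eqI[OF bounded_linear.has_derivative[OF assms(1) this]] show ?thesis
    by (simp add: dd_def)
qed

lemma differentiable_bounded_linear:
  "bounded_linear L \<Longrightarrow> f differentiable at z \<Longrightarrow> (\<lambda>x. L (f x)) differentiable at z"
  unfolding differentiable_def using bounded_linear.has_derivative by blast

lemma Ck_on_linear:
  assumes "open S" "bounded_linear L"
  shows "Ck_on S f k \<Longrightarrow> Ck_on S (\<lambda>x. L (f x)) k"
proof (induction k arbitrary: f)
  case 0
  then show ?case using assms(2)
    by (auto intro: bounded_linear.continuous_on)
next
  case (Suc k)
  then have d: "\<And>x. x \<in> S \<Longrightarrow> f differentiable at x" by simp
  have "Ck_on S (dd v (\<lambda>x. L (f x))) k" for v
  proof (rule Ck_on_cong[OF assms(1)])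
    show "Ck_on S (\<lambda>x. L (dd v f x)) k"
      using Suc.IH Suc.prems Ck_on_Suc_dd by blast
  qed (simp add: dd_bounded_linear[OF assms(2) d])
  then show ?case
    using differentiable_bounded_linear[OF assms(2) d] Ck_on_Suc_dd by blast
qed

lemma dd_add:
  assumes "f differentiable at z" "g differentiable at z"
  shows "dd v (\<lambda>x. f x + g x) z = dd v f z + dd v g z"
  using dd_eqI[OF has_derivative_add[OF assms[unfolded frechet_derivative_works]]]
  by (simp add: dd_def)

lemma Ck_on_add:
  assumes "open S"
  shows "Ck_on S f k \<Longrightarrow> Ck_on S g k \<Longrightarrow>
    Ck_on S (\<lambda>x. f x + g x) k"
proof (induction k arbitrary: f g)
  case 0
  then show ?case by (auto intro: continuous_on_add)
next
  case (Suc k)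
  have "Ck_on S (dd v (\<lambda>x. f x + g x)) k" for v
  proof (rule Ck_on_cong[OF assms(1)])
    show "Ck_on S (\<lambda>x. dd v f x + dd v g x) k"
      using Suc.IH Suc.prems Ck_on_Suc_dd by blast
  qed (use Suc.prems in \<open>simp add: dd_add\<close>)
  then show ?case
    using Suc.prems by (simp add: dd_def[abs_def])
qed

lemma dd_bilinear:
  assumes "bounded_bilinear B" "f differentiable at z" "g differentiable at z"
  shows "dd v (\<lambda>x. B (f x) (g x)) z = B (f z) (dd v g z) + B (dd v f z) (g z)"
  using dd_eqI[OF bounded_bilinear.FDERIV[OF assms(1) assms(2,3)[unfolded frechet_derivative_works]]]
  by (simp add: dd_def)

lemma Ck_on_bilinear:
  assumes "open S" "bounded_bilinear B"
  shows "Ck_on S f k \<Longrightarrow> Ck_on S g k \<Longrightarrow>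
    Ck_on S (\<lambda>x. B (f x) (g x)) k"
proof (induction k arbitrary: f g)
  case 0
  then show ?case using assms(2) by (auto intro: bounded_bilinear.continuous_on)
next
  case (Suc k)
  note lower = Suc.prems[THEN Ck_on_SucD]
  have d: "f differentiable at x" "g differentiable at x" if "x \<in> S" for x
    using Suc.prems that by auto
  have "Ck_on S (\<lambda>x. B (f x) (dd v g x) + B (dd v f x) (g x)) k" for v
    by (intro Ck_on_add[OF assms(1)] Suc.IH lower)
      (use Suc.prems in \<open>auto simp: dd_def[abs_def]\<close>)
  then have "Ck_on S (dd v (\<lambda>x. B (f x) (g x))) k" for v
    by (rule Ck_on_cong[OF assms(1), rotated]) (simp add: dd_bilinear[OF assms(2) d])
  moreover have "(\<lambda>x. B (f x) (g x)) differentiable at x" if "x \<in> S" for x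
    using bounded_bilinear.FDERIV[OF assms(2) d[OF that, unfolded frechet_derivative_works]]
    by (auto simp: differentiable_def)
  ultimately show ?case by (simp add: dd_def[abs_def])
qed

lemma Ck_on_sum:
  assumes "open S" "\<And>i. i \<in> I \<Longrightarrow> Ck_on S (f i) k"
  shows "Ck_on S (\<lambda>x. \<Sum>i\<in>I. f i x) k"
  using assms(2)
  by (induction I rule: infinite_finite_induct)
    (auto intro!: Ck_on_const Ck_on_add[OF assms(1)])

text \<open>The chain rule is expanded in a basis: the derivative becomes a finite sum of products,
  to which an induction on the order of differentiability applies.\<close>

lemma dd_compose:
  fixes f :: "'b::euclidean_space \<Rightarrow> 'c::real_normed_vector"
  assumes "g differentiable at z" "f differentiable at (g z)"
  shows "dd v (\<lambda>x. f (g x)) z = (\<Sum>b\<in>Basis. (dd v g z \<bullet> b) *\<^sub>R dd b f (g z))"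
proof -
  have *: "(f has_derivative frechet_derivative f (at (g z))) (at (g z))"
    using assms frechet_derivative_works by blast
  interpret bounded_linear "frechet_derivative f (at (g z))"
    using * has_derivative_bounded_linear by blast
  have "dd v (\<lambda>x. f (g x)) z = frechet_derivative f (at (g z)) (dd v g z)"
    using dd_eqI[OF has_derivative_compose[OF assms(1)[unfolded frechet_derivative_works] *]]
    by (simp add: dd_def)
  also have "\<dots> = frechet_derivative f (at (g z)) (\<Sum>b\<in>Basis. (dd v g z \<bullet> b) *\<^sub>R b)"
    by (simp add: euclidean_representation)
  finally show ?thesis by (simp add: sum scaleR dd_def)
qed

lemma Ck_on_compose:
  fixes f :: "'b::euclidean_space \<Rightarrow> 'c::real_normed_vector"
  assumes "open S" "open U" "\<And>x. x \<in> S \<Longrightarrow> g x \<in> U"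
  shows "Ck_on U f k \<Longrightarrow> Ck_on S g k \<Longrightarrow>
    Ck_on S (\<lambda>x. f (g x)) k"
proof (induction k arbitrary: f)
  case 0
  then show ?case using assms(3) by (auto intro: continuous_on_compose2[of U f S g])
next
  case (Suc k)
  have d: "g differentiable at x" "f differentiable at (g x)" if "x \<in> S" for x
    using Suc.prems that assms(3) by auto
  have "Ck_on S (\<lambda>x. \<Sum>b\<in>Basis. (dd v g x \<bullet> b) *\<^sub>R dd b f (g x)) k" for v
  proof (intro Ck_on_sum assms(1)
      Ck_on_bilinear[OF assms(1) bounded_bilinear_scaleR])
    fix b :: 'b
    show "Ck_on S (\<lambda>x. dd v g x \<bullet> b) k"
      using Suc.prems(2) Ck_on_Suc_dd
        Ck_on_linear[OF assms(1) bounded_linear_inner_left] by blast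
    show "Ck_on S (\<lambda>x. dd b f (g x)) k"
      using Suc.IH Ck_on_SucD[OF Suc.prems(2)] Suc.prems(1)
        Ck_on_Suc_dd by blast
  qed
  then have "Ck_on S (dd v (\<lambda>x. f (g x))) k" for v
    by (rule Ck_on_cong[OF assms(1), rotated]) (simp add: dd_compose[OF d])
  moreover have "(\<lambda>x. f (g x)) differentiable at x" if "x \<in> S" for x
    using has_derivative_compose[OF d[OF that, unfolded frechet_derivative_works]]
    by (auto simp: differentiable_def)
  ultimately show ?case by (simp add: dd_def[abs_def])
qed

text \<open>Written with products of \<open>inverse (f z)\<close> alone, so that the induction in
  \<open>Ck_on_inverse\<close> closes.\<close>

lemma dd_inverse:
  fixes f :: "'a::real_normed_vector \<Rightarrow> real"
  assumes "f differentiable at z" "f z \<noteq> 0"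
  shows "dd v (\<lambda>x. inverse (f x)) z = (- dd v f z) * (inverse (f z) * inverse (f z))"
proof -
  have "((\<lambda>x. inverse (f x)) has_derivative
     (\<lambda>h. - (inverse (f z) * frechet_derivative f (at z) h * inverse (f z)))) (at z)"
    using has_derivative_inverse[where f=f and x=z and S=UNIV and f'="frechet_derivative f (at z)"] assms
    by (simp add: frechet_derivative_works)
  from dd_eqI[OF this] show ?thesis by (simp add: dd_def)
qed

lemma Ck_on_inverse:
  fixes f :: "'a::real_normed_vector \<Rightarrow> real"
  assumes "open S" "\<And>x. x \<in> S \<Longrightarrow> f x \<noteq> 0"
  shows "Ck_on S f k \<Longrightarrow> Ck_on S (\<lambda>x. inverse (f x)) k"
proof (induction k)
  case 0
  then show ?case using assms by (auto intro: continuous_on_inverse)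
next
  case (Suc k)
  note IH = Suc.IH[OF Ck_on_SucD[OF Suc.prems]]
  have d: "f differentiable at x" if "x \<in> S" for x using Suc.prems that by auto
  have "Ck_on S (\<lambda>x. (- dd v f x) * (inverse (f x) * inverse (f x))) k" for v
  proof (intro Ck_on_bilinear[OF assms(1) bounded_bilinear_mult] IH)
    show "Ck_on S (\<lambda>x. - dd v f x) k"
      using Suc.prems Ck_on_Suc_dd
        Ck_on_linear[OF assms(1) bounded_linear_minus[OF bounded_linear_ident]] by blast
  qed
  then have "Ck_on S (dd v (\<lambda>x. inverse (f x))) k" for v
    by (rule Ck_on_cong[OF assms(1), rotated]) (use d assms(2) in \<open>simp add: dd_inverse\<close>)
  moreover have "(\<lambda>x. inverse (f x)) differentiable at x" if "x \<in> S" for x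
    using assms(2) that d by (intro differentiable_inverse) auto
  ultimately show ?case by (simp add: dd_def[abs_def])
qed

lemma smooth_differentiable: "smooth_on S f \<Longrightarrow> z \<in> S \<Longrightarrow> f differentiable at z"
  unfolding smooth_on_def by (metis higher_differentiable_on.simps(2))

lemma smooth_on_has_derivative:
  "smooth_on S f \<Longrightarrow> z \<in> S \<Longrightarrow> (f has_derivative (\<lambda>v. dd v f z)) (at z)"
  using smooth_differentiable[of S f z] frechet_derivative_works[of f "at z"]
  by (simp add: dd_def[abs_def])

lemma smooth_on_continuous: "smooth_on S f \<Longrightarrow> continuous_on S f"
  unfolding smooth_on_def by (metis higher_differentiable_on.simps(1))

lemma smooth_on_dd: "smooth_on S f \<Longrightarrow> smooth_on S (dd v f)"
  unfolding smooth_on_def by (metis Ck_on_Suc_dd)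

lemma smooth_on_cong:
  "open S \<Longrightarrow> (\<And>x. x \<in> S \<Longrightarrow> f x = g x) \<Longrightarrow> smooth_on S f \<Longrightarrow> smooth_on S g"
  unfolding smooth_on_def using Ck_on_cong by blast

lemma smooth_on_const: "smooth_on S (\<lambda>x. c)"
  unfolding smooth_on_def using Ck_on_const by blast

lemma smooth_on_ident: "open S \<Longrightarrow> smooth_on S (\<lambda>x. x)"
  unfolding smooth_on_def
proof
  fix k assume "open S"
  have "dd v (\<lambda>x. x) = (\<lambda>x. v)" for v :: 'a
    using dd_eqI[OF has_derivative_ident] by blast
  then show "Ck_on S (\<lambda>x. x) k"
    by (cases k) (auto simp: dd_def[abs_def] Ck_on_const)
qed

lemma smooth_on_linear:
  "open S \<Longrightarrow> bounded_linear L \<Longrightarrow> smooth_on S f \<Longrightarrow> smooth_on S (\<lambda>x. L (f x))"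
  unfolding smooth_on_def using Ck_on_linear by blast

lemma smooth_on_add: "open S \<Longrightarrow> smooth_on S f \<Longrightarrow> smooth_on S g \<Longrightarrow> smooth_on S (\<lambda>x. f x + g x)"
  unfolding smooth_on_def using Ck_on_add by blast

lemma smooth_on_minus: "open S \<Longrightarrow> smooth_on S f \<Longrightarrow> smooth_on S (\<lambda>x. - f x)"
  by (rule smooth_on_linear[OF _ bounded_linear_minus[OF bounded_linear_ident]])

lemma smooth_on_diff: "open S \<Longrightarrow> smooth_on S f \<Longrightarrow> smooth_on S g \<Longrightarrow> smooth_on S (\<lambda>x. f x - g x)"
  using smooth_on_add[OF _ _ smooth_on_minus, of S f g] by simp

lemma smooth_on_bilinear:
  "open S \<Longrightarrow> bounded_bilinear B \<Longrightarrow> smooth_on S f \<Longrightarrow> smooth_on S g \<Longrightarrow>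
    smooth_on S (\<lambda>x. B (f x) (g x))"
  unfolding smooth_on_def using Ck_on_bilinear by blast

lemmas smooth_on_inner = smooth_on_bilinear[OF _ bounded_bilinear_inner]
lemmas smooth_on_scaleR = smooth_on_bilinear[OF _ bounded_bilinear_scaleR]
lemmas smooth_on_mult = smooth_on_bilinear[OF _ bounded_bilinear_mult[where 'a=real]]

lemma smooth_on_sum:
  "open S \<Longrightarrow> (\<And>i. i \<in> I \<Longrightarrow> smooth_on S (f i)) \<Longrightarrow> smooth_on S (\<lambda>x. \<Sum>i\<in>I. f i x)"
  unfolding smooth_on_def by (intro allI Ck_on_sum) auto

lemma smooth_on_prod:
  fixes f :: "'i \<Rightarrow> 'a::real_normed_vector \<Rightarrow> real"
  assumes "open S" "\<And>i. i \<in> I \<Longrightarrow> smooth_on S (f i)"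
  shows "smooth_on S (\<lambda>x. \<Prod>i\<in>I. f i x)"
  using assms(2)
  by (induction I rule: infinite_finite_induct)
    (auto intro!: smooth_on_const smooth_on_mult[OF assms(1)])

lemma smooth_on_inverse:
  fixes f :: "'a::real_normed_vector \<Rightarrow> real"
  shows "open S \<Longrightarrow> (\<And>x. x \<in> S \<Longrightarrow> f x \<noteq> 0) \<Longrightarrow> smooth_on S f \<Longrightarrow> smooth_on S (\<lambda>x. inverse (f x))"
  unfolding smooth_on_def using Ck_on_inverse by blast

lemma smooth_on_compose:
  fixes f :: "'b::euclidean_space \<Rightarrow> 'c::real_normed_vector"
  shows "open S \<Longrightarrow> open U \<Longrightarrow> (\<And>x. x \<in> S \<Longrightarrow> g x \<in> U) \<Longrightarrow> smooth_on U f \<Longrightarrow> smooth_on S g \<Longrightarrow>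
    smooth_on S (\<lambda>x. f (g x))"
  unfolding smooth_on_def by (rule allI, rule Ck_on_compose[of S U]) auto

lemma smooth_on_det:
  fixes M :: "'a::real_normed_vector \<Rightarrow> real^'n^'n"
  assumes "open S" "\<And>i j. smooth_on S (\<lambda>x. M x $ i $ j)"
  shows "smooth_on S (\<lambda>x. det (M x))"
  unfolding det_def by (intro smooth_on_sum smooth_on_mult smooth_on_const smooth_on_prod assms)

lemma dd_line:
  assumes "f differentiable at (z + s *\<^sub>R v)"
  shows "((\<lambda>s. f (z + s *\<^sub>R v)) has_vector_derivative dd v f (z + s *\<^sub>R v)) (at s)"
proof -
  have *: "(f has_derivative frechet_derivative f (at (z + s *\<^sub>R v))) (at (z + s *\<^sub>R v))"
    using assms frechet_derivative_works by blast
  interpret bounded_linear "frechet_derivative f (at (z + s *\<^sub>R v))"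
    using * has_derivative_bounded_linear by blast
  have "((\<lambda>s. z + s *\<^sub>R v) has_derivative (\<lambda>h. h *\<^sub>R v)) (at s)"
    by (auto intro!: derivative_eq_intros)
  from has_derivative_compose[OF this *] show ?thesis
    by (simp add: has_vector_derivative_def dd_def scaleR)
qed

text \<open>The mean value theorem is used twice: in direction \<open>v\<close> for the increment of
  \<open>f\<close> along \<open>h *\<^sub>R w\<close>, then in direction \<open>w\<close> for
  \<open>dd v f\<close>.\<close>

lemma second_difference:
  fixes f :: "'a::real_normed_vector \<Rightarrow> real"
  assumes "h > 0"
    and diff: "\<And>s r. 0 \<le> s \<Longrightarrow> s \<le> h \<Longrightarrow> 0 \<le> r \<Longrightarrow> r \<le> h \<Longrightarrow>
      f differentiable at (z + s *\<^sub>R v + r *\<^sub>R w) \<and> dd v f differentiable at (z + s *\<^sub>R v + r *\<^sub>R w)"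
  shows "\<exists>s r. 0 \<le> s \<and> s \<le> h \<and> 0 \<le> r \<and> r \<le> h \<and>
    f (z + h *\<^sub>R v + h *\<^sub>R w) - f (z + h *\<^sub>R v) - f (z + h *\<^sub>R w) + f z
      = h * h * dd w (dd v f) (z + s *\<^sub>R v + r *\<^sub>R w)"
proof -
  define \<phi> where "\<phi> s = f (z + h *\<^sub>R w + s *\<^sub>R v) - f (z + s *\<^sub>R v)" for s
  have "DERIV \<phi> s :> dd v f (z + h *\<^sub>R w + s *\<^sub>R v) - dd v f (z + s *\<^sub>R v)" if "0 \<le> s" "s \<le> h" for s
    unfolding \<phi>_def has_real_derivative_iff_has_vector_derivative
    by (intro has_vector_derivative_diff dd_line)
      (use diff[of s h] diff[of s 0] that \<open>h > 0\<close> in \<open>auto simp: add.commute add.left_commute\<close>)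
  then obtain s where s: "0 < s" "s < h" and
    e: "\<phi> h - \<phi> 0 = (h - 0) * (dd v f (z + h *\<^sub>R w + s *\<^sub>R v) - dd v f (z + s *\<^sub>R v))"
    using MVT2[OF \<open>h > 0\<close>, of \<phi> "\<lambda>s. dd v f (z + h *\<^sub>R w + s *\<^sub>R v) - dd v f (z + s *\<^sub>R v)"] by blast
  have "DERIV (\<lambda>r. dd v f (z + s *\<^sub>R v + r *\<^sub>R w)) r :> dd w (dd v f) (z + s *\<^sub>R v + r *\<^sub>R w)"
    if "0 \<le> r" "r \<le> h" for r
    unfolding has_real_derivative_iff_has_vector_derivative
    by (intro dd_line) (use diff[of s r] that s in auto)
  then obtain r where r: "0 < r" "r < h" and
    "dd v f (z + s *\<^sub>R v + h *\<^sub>R w) - dd v f (z + s *\<^sub>R v + 0 *\<^sub>R w)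
      = (h - 0) * dd w (dd v f) (z + s *\<^sub>R v + r *\<^sub>R w)"
    using MVT2[OF \<open>h > 0\<close>, of "\<lambda>r. dd v f (z + s *\<^sub>R v + r *\<^sub>R w)"
        "\<lambda>r. dd w (dd v f) (z + s *\<^sub>R v + r *\<^sub>R w)"] by blast
  with e s r show ?thesis
    by (intro exI[of _ s] exI[of _ r]) (auto simp: \<phi>_def algebra_simps)
qed

text \<open>The second difference is symmetric in \<open>v\<close> and \<open>w\<close>, so both
  mixed derivatives take a common value at points arbitrarily close to \<open>z\<close>; continuity
  does the rest.\<close>

lemma dd_commute_real:
  fixes f :: "'a::real_normed_vector \<Rightarrow> real"
  assumes S: "open S" "smooth_on S f" "z \<in> S"
  shows "dd v (dd w f) z = dd w (dd v f) z"
proof (rule ccontr)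
  assume ne: "dd v (dd w f) z \<noteq> dd w (dd v f) z"
  define e where "e = \<bar>dd v (dd w f) z - dd w (dd v f) z\<bar> / 2"
  have "e > 0" using ne by (simp add: e_def)
  have "continuous (at z) (dd v (dd w f))" "continuous (at z) (dd w (dd v f))"
    using smooth_on_continuous[OF smooth_on_dd[OF smooth_on_dd[OF S(2)]]] S
    by (auto simp: continuous_on_eq_continuous_at)
  then obtain d1 d2 where d: "d1 > 0" "d2 > 0"
    "\<And>x. dist x z < d1 \<Longrightarrow> dist (dd v (dd w f) x) (dd v (dd w f) z) < e"
    "\<And>x. dist x z < d2 \<Longrightarrow> dist (dd w (dd v f) x) (dd w (dd v f) z) < e"
    using \<open>e > 0\<close> unfolding continuous_at_eps_delta by metis
  obtain d3 where d3: "d3 > 0" "ball z d3 \<subseteq> S" using S open_contains_ball by blast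
  define m where "m = min (min d1 d2) d3"
  \<comment> \<open>Keeps the whole parallelogram spanned by \<open>h *\<^sub>R v\<close> and
    \<open>h *\<^sub>R w\<close> within distance \<open>m / 2\<close>; the summand 1 keeps the
    denominator positive.\<close>
  define h where "h = (m / 2) / (norm v + norm w + 1)"
  have "m > 0" using d d3 by (auto simp: m_def)
  have N: "norm v + norm w + 1 > 0" by (smt (verit) norm_ge_zero)
  then have h: "h > 0" using \<open>m > 0\<close> by (simp add: h_def)
  have near: "dist (z + s *\<^sub>R v + r *\<^sub>R w) z < m" if "0 \<le> s" "s \<le> h" "0 \<le> r" "r \<le> h" for s r
  proof -
    have "dist (z + s *\<^sub>R v + r *\<^sub>R w) z \<le> s * norm v + r * norm w"
      using norm_triangle_ineq[of "s *\<^sub>R v" "r *\<^sub>R w"] that by (simp add: dist_norm)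
    also have "\<dots> \<le> h * norm v + h * norm w" by (intro add_mono mult_right_mono that) auto
    also have "\<dots> \<le> h * (norm v + norm w + 1)" using h by (simp add: algebra_simps)
    also have "\<dots> = m / 2" by (metis N h_def less_irrefl nonzero_eq_divide_eq)
    finally show ?thesis using \<open>m > 0\<close> by simp
  qed
  have inS: "z + s *\<^sub>R v + r *\<^sub>R w \<in> S" if "0 \<le> s" "s \<le> h" "0 \<le> r" "r \<le> h" for s r
    using near[OF that] d3 by (auto simp: m_def dist_commute subset_iff)
  have inS': "z + s *\<^sub>R w + r *\<^sub>R v \<in> S" if "0 \<le> s" "s \<le> h" "0 \<le> r" "r \<le> h" for s r
    using inS[OF that(3,4,1,2)] by (simp add: add.commute add.left_commute)
  note df = smooth_differentiable[OF S(2)] smooth_differentiable[OF smooth_on_dd[OF S(2)]]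
  obtain s r where 1: "0 \<le> s" "s \<le> h" "0 \<le> r" "r \<le> h"
    "f (z + h *\<^sub>R v + h *\<^sub>R w) - f (z + h *\<^sub>R v) - f (z + h *\<^sub>R w) + f z
      = h * h * dd w (dd v f) (z + s *\<^sub>R v + r *\<^sub>R w)"
    using second_difference[OF h, of f z v w] df inS by blast
  obtain s' r' where 2: "0 \<le> s'" "s' \<le> h" "0 \<le> r'" "r' \<le> h"
    "f (z + h *\<^sub>R w + h *\<^sub>R v) - f (z + h *\<^sub>R w) - f (z + h *\<^sub>R v) + f z
      = h * h * dd v (dd w f) (z + s' *\<^sub>R w + r' *\<^sub>R v)"
    using second_difference[OF h, of f z w v] df inS' by blast
  have "h * h * dd w (dd v f) (z + s *\<^sub>R v + r *\<^sub>R w) = h * h * dd v (dd w f) (z + r' *\<^sub>R v + s' *\<^sub>R w)"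
    using 1(5) 2(5) by (simp add: algebra_simps)
  then have "dd w (dd v f) (z + s *\<^sub>R v + r *\<^sub>R w) = dd v (dd w f) (z + r' *\<^sub>R v + s' *\<^sub>R w)"
    using h by simp
  moreover have "dist (dd w (dd v f) (z + s *\<^sub>R v + r *\<^sub>R w)) (dd w (dd v f) z) < e"
    using d(4) near[OF 1(1-4)] by (simp add: m_def)
  moreover have "dist (dd v (dd w f) (z + r' *\<^sub>R v + s' *\<^sub>R w)) (dd v (dd w f) z) < e"
    using d(3) near[OF 2(3,4,1,2)] by (simp add: m_def)
  ultimately have "dist (dd v (dd w f) z) (dd w (dd v f) z) < e + e"
    by (metis (no_types) dist_commute dist_triangle_less_add)
  then show False by (simp add: e_def dist_real_def)
qed

lemma dd_commute:
  fixes f :: "'a::real_normed_vector \<Rightarrow> 'b::euclidean_space"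
  assumes S: "open S" "smooth_on S f" "z \<in> S"
  shows "dd v (dd w f) z = dd w (dd v f) z"
proof (rule euclidean_eqI)
  fix b :: 'b assume "b \<in> Basis"
  have c1: "dd v (\<lambda>x. g x \<bullet> b) z = dd v g z \<bullet> b" if "smooth_on S g" "z \<in> S" for v g z
    by (rule dd_bounded_linear[OF bounded_linear_inner_left smooth_differentiable[OF that]])
  have "dd v (dd w (\<lambda>x. f x \<bullet> b)) z = dd v (dd w f) z \<bullet> b" for v w
    using dd_cong_open[OF S(1,3), of "dd w (\<lambda>x. f x \<bullet> b)" "\<lambda>x. dd w f x \<bullet> b" v]
      c1[OF S(2)] c1[OF smooth_on_dd[OF S(2)] S(3)] by simp
  then show "dd v (dd w f) z \<bullet> b = dd w (dd v f) z \<bullet> b"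
    using dd_commute_real[OF S(1) smooth_on_linear[OF S(1) bounded_linear_inner_left S(2)] S(3)] by metis
qed

lemma dd_inner:
  assumes "smooth_on S f" "smooth_on S g" "z \<in> S"
  shows "dd v (\<lambda>x. f x \<bullet> g x) z = f z \<bullet> dd v g z + dd v f z \<bullet> g z"
  by (rule dd_bilinear[OF bounded_bilinear_inner]) (use assms smooth_differentiable in blast)+

lemma dd_mult:
  fixes f g :: "'a::real_normed_vector \<Rightarrow> real"
  assumes "smooth_on S f" "smooth_on S g" "z \<in> S"
  shows "dd v (\<lambda>x. f x * g x) z = f z * dd v g z + dd v f z * g z"
  by (rule dd_bilinear[OF bounded_bilinear_mult]) (use assms smooth_differentiable in blast)+

lemma dd_scaleR:
  assumes "smooth_on S f" "smooth_on S g" "z \<in> S"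
  shows "dd v (\<lambda>x. f x *\<^sub>R g x) z = f z *\<^sub>R dd v g z + dd v f z *\<^sub>R g z"
  by (rule dd_bilinear[OF bounded_bilinear_scaleR]) (use assms smooth_differentiable in blast)+

lemma dd_minus:
  assumes "smooth_on S f" "z \<in> S"
  shows "dd v (\<lambda>x. - f x) z = - dd v f z"
  by (rule dd_bounded_linear[OF bounded_linear_minus[OF bounded_linear_ident]])
    (use assms smooth_differentiable in blast)

lemma dd_plus:
  assumes "smooth_on S f" "smooth_on S g" "z \<in> S"
  shows "dd v (\<lambda>x. f x + g x) z = dd v f z + dd v g z"
  by (rule dd_add) (use assms smooth_differentiable in blast)+

lemma dd_diff:
  assumes "smooth_on S f" "smooth_on S g" "z \<in> S"
  shows "dd v (\<lambda>x. f x - g x) z = dd v f z - dd v g z"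
proof -
  have "((\<lambda>x. f x - g x) has_derivative (\<lambda>v. dd v f z - dd v g z)) (at z)"
    by (intro has_derivative_diff smooth_on_has_derivative[OF _ assms(3)] assms)
  from dd_eqI[OF this] show ?thesis .
qed

lemma dd_const: "dd v (\<lambda>x. c) z = 0"
  by (simp add: dd_def frechet_derivative_const)

lemma dd_sum:
  assumes "open S" "\<And>i. i \<in> I \<Longrightarrow> smooth_on S (f i)" "z \<in> S"
  shows "dd v (\<lambda>x. \<Sum>i\<in>I. f i x) z = (\<Sum>i\<in>I. dd v (f i) z)"
  using assms(2)
proof (induction I rule: infinite_finite_induct)
  case (insert i I)
  have "dd v (\<lambda>x. f i x + (\<Sum>i\<in>I. f i x)) z = dd v (f i) z + dd v (\<lambda>x. \<Sum>i\<in>I. f i x) z"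
    by (rule dd_plus[OF _ smooth_on_sum[OF assms(1)] assms(3)]) (use insert in auto)
  then show ?case using insert by simp
qed (simp_all add: dd_const)

text \<open>The structure equations of the hypersurface come from this product rule, applied to the
  constant inner products among \<open>F\<close>, \<nu> and their derivatives.\<close>

lemma dd_inner_const:
  assumes "open S" "smooth_on S f" "smooth_on S g" "z \<in> S" "\<And>x. x \<in> S \<Longrightarrow> f x \<bullet> g x = c"
  shows "dd v f z \<bullet> g z = - (f z \<bullet> dd v g z)"
proof -
  have "dd v (\<lambda>x. f x \<bullet> g x) z = dd v (\<lambda>x. c) z"
    by (rule dd_cong_open[OF assms(1,4)]) (use assms(5) in simp)
  then show ?thesis by (simp add: dd_inner[OF assms(2-4)] dd_const)
qed

lemma dd_inner2:
  assumes "open S" "smooth_on S f" "smooth_on S g" "z \<in> S"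
  shows "dd w (dd v (\<lambda>x. f x \<bullet> g x)) z =
    f z \<bullet> dd w (dd v g) z + dd w f z \<bullet> dd v g z + dd v f z \<bullet> dd w g z + dd w (dd v f) z \<bullet> g z"
proof -
  note sm = assms(2,3) smooth_on_dd[OF assms(2)] smooth_on_dd[OF assms(3)]
  have "dd w (dd v (\<lambda>x. f x \<bullet> g x)) z = dd w (\<lambda>x. f x \<bullet> dd v g x + dd v f x \<bullet> g x) z"
    by (rule dd_cong_open[OF assms(1,4)]) (simp add: dd_inner[OF sm(1,2)])
  also have "\<dots> = dd w (\<lambda>x. f x \<bullet> dd v g x) z + dd w (\<lambda>x. dd v f x \<bullet> g x) z"
    by (rule dd_plus[OF _ _ assms(4)]) (intro smooth_on_inner assms(1) sm)+
  also have "\<dots> = f z \<bullet> dd w (dd v g) z + dd w f z \<bullet> dd v g z + dd v f z \<bullet> dd w g z + dd w (dd v f) z \<bullet> g z"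
    by (simp add: dd_inner[OF sm(1,4) assms(4)] dd_inner[OF sm(3,2) assms(4)])
  finally show ?thesis .
qed

lemma dd_mult2:
  fixes f g :: "'a::real_normed_vector \<Rightarrow> real"
  assumes "open S" "smooth_on S f" "smooth_on S g" "z \<in> S"
  shows "dd w (dd v (\<lambda>x. f x * g x)) z =
    f z * dd w (dd v g) z + dd w f z * dd v g z + dd v f z * dd w g z + dd w (dd v f) z * g z"
  using dd_inner2[OF assms] by (simp add: inner_real_def)

section \<open>Mean curvature flow of hypersurfaces in coordinates\<close>

abbreviation xdir :: "'n::finite \<Rightarrow> (real^'n) \<times> real" where "xdir i \<equiv> (axis i 1, 0)"
abbreviation pd where "pd i \<equiv> dd (xdir i)"
abbreviation tdir :: "(real^'n::finite) \<times> real" where "tdir \<equiv> (0, 1)"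

text \<open>A piece of the flow in space-time coordinates. The Weingarten matrix is only asked to
  exist pointwise, which makes the assumptions easy to transport under \<open>reparametrize\<close>;
  its smoothness is recovered in \<open>weingarten_smooth\<close>.\<close>

locale coordinate_flow =
  fixes S :: "((real^'n::finite) \<times> real) set"
    and F \<nu> :: "(real^'n) \<times> real \<Rightarrow> 'e::euclidean_space"
    and H :: "(real^'n) \<times> real \<Rightarrow> real"
  assumes S: "open S"
    and smF: "smooth_on S F" and sm\<nu>: "smooth_on S \<nu>"
    and FF: "z \<in> S \<Longrightarrow> F z \<bullet> F z = 1"
    and \<nu>\<nu>: "z \<in> S \<Longrightarrow> \<nu> z \<bullet> \<nu> z = 1"
    and \<nu>F: "z \<in> S \<Longrightarrow> \<nu> z \<bullet> F z = 0"
    and \<nu>dF: "z \<in> S \<Longrightarrow> \<nu> z \<bullet> pd i F z = 0"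
    and Ft: "z \<in> S \<Longrightarrow> dd tdir F z = - (H z *\<^sub>R \<nu> z)"
    and gram: "z \<in> S \<Longrightarrow> det (\<chi> i j. pd i F z \<bullet> pd j F z) \<noteq> 0"
    and weingarten: "z \<in> S \<Longrightarrow> \<exists>A::real^'n^'n.
      (\<forall>i. pd i \<nu> z = (\<Sum>j\<in>UNIV. A $ i $ j *\<^sub>R pd j F z)) \<and> H z = trace A"
    and dim: "DIM('e) = CARD('n) + 2"
begin

definition g where "g i j z = pd i F z \<bullet> pd j F z"
definition h where "h i j z = pd i \<nu> z \<bullet> pd j F z"

lemmas smD = smooth_on_dd[OF smF] smooth_on_dd[OF sm\<nu>]
  smooth_on_dd[OF smooth_on_dd[OF smF]] smooth_on_dd[OF smooth_on_dd[OF sm\<nu>]]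
  smooth_on_dd[OF smooth_on_dd[OF smooth_on_dd[OF smF]]]

lemma cong: "z \<in> S \<Longrightarrow> (\<And>x. x \<in> S \<Longrightarrow> f x = f' x) \<Longrightarrow> dd v f z = dd v f' z"
  by (rule dd_cong_open[OF S])

text \<open>Reading \<open>H\<close> off the velocity is what gives its smoothness.\<close>

lemma H_eq: "z \<in> S \<Longrightarrow> H z = - (dd tdir F z \<bullet> \<nu> z)"
  by (simp add: Ft \<nu>\<nu>)

lemma smH: "smooth_on S H"
  by (rule smooth_on_cong[OF S _ smooth_on_minus[OF S smooth_on_inner[OF S smD(1) sm\<nu>]]])
    (simp add: H_eq)

lemma smg: "smooth_on S (g i j)"
  unfolding g_def[abs_def] by (intro smooth_on_inner S smD)

lemma smh: "smooth_on S (h i j)"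
  unfolding h_def[abs_def] by (intro smooth_on_inner S smD)

lemma F_dF: "z \<in> S \<Longrightarrow> F z \<bullet> dd v F z = 0"
  using dd_inner_const[OF S smF smF _ FF, of z v] by (simp add: inner_commute)

lemma \<nu>_d\<nu>: "z \<in> S \<Longrightarrow> \<nu> z \<bullet> dd v \<nu> z = 0"
  using dd_inner_const[OF S sm\<nu> sm\<nu> _ \<nu>\<nu>, of z v] by (simp add: inner_commute)

lemma F_d\<nu>: "z \<in> S \<Longrightarrow> dd v \<nu> z \<bullet> F z = - (\<nu> z \<bullet> dd v F z)"
  by (rule dd_inner_const[OF S sm\<nu> smF _ \<nu>F])

lemma F_d\<nu>x: "z \<in> S \<Longrightarrow> pd i \<nu> z \<bullet> F z = 0" by (simp add: F_d\<nu> \<nu>dF)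
lemma F_d\<nu>t: "z \<in> S \<Longrightarrow> dd tdir \<nu> z \<bullet> F z = H z" by (simp add: F_d\<nu> Ft \<nu>\<nu>)

lemma h_eq: "z \<in> S \<Longrightarrow> h i j z = - (\<nu> z \<bullet> pd i (pd j F) z)"
  unfolding h_def by (rule dd_inner_const[OF S sm\<nu> smD(1) _ \<nu>dF])

lemma h_sym: "z \<in> S \<Longrightarrow> h i j z = h j i z"
  by (simp add: h_eq dd_commute[OF S smF])

lemma g_sym: "g i j z = g j i z"
  by (simp add: g_def inner_commute)

lemma F_xt: assumes "z \<in> S"
  shows "dd tdir (pd j F) z = - (H z *\<^sub>R pd j \<nu> z) - pd j H z *\<^sub>R \<nu> z"
proof -
  have "dd tdir (pd j F) z = pd j (dd tdir F) z" by (rule dd_commute[OF S smF assms])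
  also have "\<dots> = pd j (\<lambda>x. - (H x *\<^sub>R \<nu> x)) z" by (rule cong[OF assms]) (simp add: Ft)
  also have "\<dots> = - pd j (\<lambda>x. H x *\<^sub>R \<nu> x) z"
    by (rule dd_minus[OF smooth_on_scaleR[OF S smH sm\<nu>] assms])
  finally show ?thesis by (simp add: dd_scaleR[OF smH sm\<nu> assms])
qed

lemma \<nu>t_dF: "z \<in> S \<Longrightarrow> dd tdir \<nu> z \<bullet> pd j F z = pd j H z"
  by (subst dd_inner_const[OF S sm\<nu> smD(1) _ \<nu>dF]) (simp_all add: F_xt inner_diff_right \<nu>_d\<nu> \<nu>\<nu>)

lemma g_t: assumes "z \<in> S" shows "dd tdir (g i j) z = - 2 * H z * h i j z"
proof -
  have "pd i F z \<bullet> dd tdir (pd j F) z = - (H z * h j i z)" for i j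
    using \<nu>dF[OF assms, of i] by (simp add: F_xt[OF assms] inner_diff_right h_def inner_commute)
  then show ?thesis
    unfolding g_def[abs_def] dd_inner[OF smD(1) smD(1) assms]
    by (simp add: inner_commute[of "dd tdir (pd i F) z"] h_sym[OF assms, of j i])
qed

text \<open>Each row of the Weingarten matrix solves a linear system with matrix \<open>g\<close>
  and right-hand side a row of \<open>h\<close>. Cramer's rule expresses it by determinants of
  smooth functions, with denominator the Gram determinant.\<close>

lemma weingarten_smooth:
  "\<exists>A. (\<forall>i j. smooth_on S (A i j)) \<and>
    (\<forall>z\<in>S. \<forall>i j. h i j z = (\<Sum>l\<in>UNIV. A i l z * g l j z)) \<and>
    (\<forall>z\<in>S. H z = (\<Sum>i\<in>UNIV. A i i z))"
proof -
  have "\<forall>z\<in>S. \<exists>A::real^'n^'n.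
      (\<forall>i. pd i \<nu> z = (\<Sum>j\<in>UNIV. A $ i $ j *\<^sub>R pd j F z)) \<and> H z = trace A"
    using weingarten by blast
  from bchoice[OF this] obtain B :: "(real^'n) \<times> real \<Rightarrow> real^'n^'n" where
    B: "\<And>z i. z \<in> S \<Longrightarrow> pd i \<nu> z = (\<Sum>j\<in>UNIV. B z $ i $ j *\<^sub>R pd j F z)"
      "\<And>z. z \<in> S \<Longrightarrow> H z = trace (B z)"
    by blast
  define G where "G z = (\<chi> i j. g i j z)" for z
  have h: "h i j z = (\<Sum>l\<in>UNIV. B z $ i $ l * g l j z)" if "z \<in> S" for i j z
    by (simp add: h_def B(1)[OF that] inner_sum_left g_def)
  have dG: "det (G z) \<noteq> 0" if "z \<in> S" for z
    using gram[OF that] by (simp add: G_def g_def)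
  have "smooth_on S (\<lambda>z. B z $ i $ j)" for i j
  proof -
    let ?M = "\<lambda>z. \<chi> k l. if l = j then h i k z else G z $ k $ l"
    have "B z $ i $ j = det (?M z) * inverse (det (G z))" if "z \<in> S" for z
    proof -
      have "G z *v (B z $ i) = (\<chi> k. h i k z)"
        by (simp add: vec_eq_iff matrix_vector_mult_def h[OF that] G_def mult.commute g_sym)
      then have "B z $ i = (\<chi> k. det (\<chi> l m. if m = k then (\<chi> k. h i k z) $ l else G z $ l $ m) / det (G z))"
        using cramer[OF dG[OF that]] by blast
      then show ?thesis by (simp add: vec_eq_iff divide_inverse cong: if_cong)
    qed
    moreover have "smooth_on S (\<lambda>z. ?M z $ k $ l)" for k l
      by (cases "l = j") (simp_all add: smh smg G_def)
    then have "smooth_on S (\<lambda>z. det (?M z) * inverse (det (G z)))"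
      by (intro smooth_on_mult smooth_on_inverse smooth_on_det S dG) (simp_all add: G_def smg)
    ultimately show ?thesis by (intro smooth_on_cong[OF S, of _ "\<lambda>z. B z $ i $ j"]) simp_all
  qed
  then show ?thesis
    by (intro exI[of _ "\<lambda>i j z. B z $ i $ j"]) (auto simp: h B trace_def)
qed

end

section \<open>Evolution equations at the centre of normal coordinates\<close>

text \<open>The normalization is imposed at the one space-time point \<open>z0\<close> only. By
  \<open>Chr\<close> the second derivatives of \<open>F\<close> have no tangential part there, so
  coordinate derivatives replace covariant ones.\<close>

locale normal_coordinate_flow = coordinate_flow S F \<nu> H
  for S :: "((real^'n::finite) \<times> real) set"
    and F \<nu> :: "(real^'n) \<times> real \<Rightarrow> 'e::euclidean_space"
    and H :: "(real^'n) \<times> real \<Rightarrow> real" +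
  fixes z0
  assumes z0: "z0 \<in> S"
    and ON: "pd i F z0 \<bullet> pd j F z0 = (if i = j then 1 else 0)"
    and Chr: "pd i (pd j F) z0 \<bullet> pd k F z0 = 0"
begin

lemma g0: "g i j z0 = (if i = j then 1 else 0)"
  by (simp add: g_def ON)

text \<open>The tangent frame, \<nu> and \<open>F\<close> are \<open>n + 2\<close> orthonormal
  vectors at \<open>z0\<close>, hence a basis.\<close>

lemma parseval: "x \<bullet> y = (\<Sum>k\<in>UNIV. (x \<bullet> pd k F z0) * (y \<bullet> pd k F z0))
    + (x \<bullet> \<nu> z0) * (y \<bullet> \<nu> z0) + (x \<bullet> F z0) * (y \<bullet> F z0)"
proof -
  let ?f = "\<lambda>k. pd k F z0"
  define B where "B = insert (\<nu> z0) (insert (F z0) (range ?f))"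
  have inj: "inj ?f"
  proof (rule injI)
    fix i j assume "?f i = ?f j"
    then show "i = j" using ON[of i i] ON[of i j] by (auto split: if_splits)
  qed
  have ne: "F z0 \<notin> range ?f" "\<nu> z0 \<notin> insert (F z0) (range ?f)"
    using F_dF[OF z0] FF[OF z0] \<nu>F[OF z0] \<nu>dF[OF z0] ON by (auto simp: image_iff) (metis zero_neq_one)+
  have fin: "finite B" by (simp add: B_def)
  have "card B = DIM('e)"
    using ne inj by (simp add: B_def card_image dim)
  moreover have orth: "pairwise orthogonal B"
    using F_dF[OF z0] \<nu>F[OF z0] \<nu>dF[OF z0] ON
    by (auto simp: B_def pairwise_def orthogonal_def inner_commute)
  moreover have norm1: "b \<bullet> b = 1" if "b \<in> B" for b
    using that FF[OF z0] \<nu>\<nu>[OF z0] ON by (auto simp: B_def)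
  then have "0 \<notin> B" by force
  ultimately have "span B = UNIV"
    using pairwise_orthogonal_independent[OF orth] fin
    by (metis card_eq_dim dim_UNIV independent_card_le_dim span_UNIV top.extremum_unique UNIV_I subset_UNIV card_ge_dim_independent order_refl)
  define y' where "y' = (\<Sum>b\<in>B. (y \<bullet> b) *\<^sub>R b)"
  have "(y - y') \<bullet> b = 0" if "b \<in> B" for b
  proof -
    have "y' \<bullet> b = (\<Sum>c\<in>B. if c = b then y \<bullet> b else 0)"
      unfolding y'_def inner_sum_left
      by (rule sum.cong) (use orth norm1 that in \<open>auto simp: pairwise_def orthogonal_def\<close>)
    then show ?thesis using that fin by (simp add: inner_diff_left)
  qed
  then have "orthogonal (y - y') w" for w
    using orthogonal_to_span[of w B "y - y'"] \<open>span B = UNIV\<close> by (auto simp: orthogonal_def)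
  then have "y = y'" by (metis orthogonal_self right_minus_eq)
  then have "x \<bullet> y = x \<bullet> y'" by simp
  then have "x \<bullet> y = (\<Sum>b\<in>B. (x \<bullet> b) * (y \<bullet> b))"
    by (simp only: y'_def inner_sum_right inner_scaleR_right mult.commute)
  then show ?thesis
    using ne inj by (simp add: B_def sum.reindex)
qed

text \<open>The squared norm \<open>|h|^2\<close>; no inverse metric enters because \<open>g\<close>
  is the identity at \<open>z0\<close>.\<close>

definition A2 where "A2 = (\<Sum>k\<in>UNIV. \<Sum>l\<in>UNIV. (h k l z0)\<^sup>2)"

lemma d\<nu>_d\<nu>: "pd i \<nu> z0 \<bullet> pd j \<nu> z0 = (\<Sum>k\<in>UNIV. h i k z0 * h j k z0)"
  using parseval[of "pd i \<nu> z0" "pd j \<nu> z0"] \<nu>_d\<nu>[OF z0, of "xdir i"]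
  by (simp add: h_def F_d\<nu>x[OF z0] inner_commute[of _ "\<nu> z0"])

lemma ddF_\<nu>: "pd i (pd j F) z0 \<bullet> \<nu> z0 = - h i j z0"
  by (simp add: h_eq[OF z0] inner_commute)

lemma ddF_F: "pd i (pd j F) z0 \<bullet> F z0 = - g i j z0"
  using dd_inner_const[OF S smF smD(1) z0 F_dF, of "xdir i" "xdir j"] by (simp add: g_def inner_commute)

text \<open>The Gauss formula at \<open>z0\<close> for the codimension-two position: normal
  components \<open>- h\<close> along \<nu> and \<open>- g\<close> along \<open>F\<close>.\<close>

lemma inner_ddF: "x \<bullet> pd i (pd j F) z0 = - h i j z0 * (x \<bullet> \<nu> z0) - g i j z0 * (x \<bullet> F z0)"
  using parseval[of x "pd i (pd j F) z0"] by (simp add: Chr ddF_\<nu> ddF_F)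

text \<open>Obtained by differentiating \<open>\<nu>t_dF\<close> in space. The last term is
  curvature of the sphere: the time derivative of \<nu> has \<open>F\<close>-component
  \<open>H\<close>, and \<open>pd i (pd j F)\<close> has \<open>F\<close>-component
  \<open>- g i j\<close>.\<close>

lemma h_t: "dd tdir (h i j) z0 =
    pd i (pd j H) z0 - H z0 * (\<Sum>k\<in>UNIV. h i k z0 * h j k z0) + H z0 * g i j z0"
proof -
  have "pd i (\<lambda>z. dd tdir \<nu> z \<bullet> pd j F z) z0 = pd i (pd j H) z0"
    by (rule cong[OF z0]) (simp add: \<nu>t_dF)
  then have "pd i (dd tdir \<nu>) z0 \<bullet> pd j F z0 =
      pd i (pd j H) z0 - dd tdir \<nu> z0 \<bullet> pd i (pd j F) z0"
    by (simp add: dd_inner[OF smD(2) smD(1) z0])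
  also have "dd tdir \<nu> z0 \<bullet> pd i (pd j F) z0 = - g i j z0 * H z0"
    using \<nu>_d\<nu>[OF z0, of tdir] by (simp add: inner_ddF F_d\<nu>t[OF z0] inner_commute[of _ "\<nu> z0"])
  finally show ?thesis
    using \<nu>_d\<nu>[OF z0, of "xdir i"]
    by (simp add: h_def[abs_def] dd_inner[OF smD(2) smD(1) z0] dd_commute[OF S sm\<nu> z0, of tdir]
        F_xt[OF z0] inner_diff_right d\<nu>_d\<nu>[unfolded h_def] inner_commute[of _ "\<nu> z0"])
qed

lemma g_x: "pd k (g i j) z0 = 0"
  unfolding g_def[abs_def] by (simp add: dd_inner[OF smD(1) smD(1) z0] Chr inner_commute[of _ "pd k (pd j F) z0"])

lemma g_xx: "pd k (pd k (g i j)) z0 =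
    pd k (pd k (pd j F)) z0 \<bullet> pd i F z0
    + pd k (pd k (pd i F)) z0 \<bullet> pd j F z0
    + 2 * (h k i z0 * h k j z0 + g k i z0 * g k j z0)"
  unfolding g_def[of i j, abs_def]
  by (simp add: dd_inner2[OF S smD(1) smD(1) z0] inner_ddF ddF_\<nu> ddF_F inner_commute[of "pd i F z0"])

text \<open>Writing \<open>h a a\<close> as \<open>- (\<nu> \<bullet> pd a (pd a F))\<close> first
  confines the fourth derivatives of \<open>F\<close> to one term, which is symmetric in
  \<open>a\<close> and \<open>b\<close> by \<open>F_xxxx\<close> and so drops out of the commutator
  in \<open>simons\<close>.\<close>

lemma h_xx: "pd b (pd b (h a a)) z0 =
    - h a a z0 * (\<Sum>l\<in>UNIV. (h b l z0)\<^sup>2) - h b b z0 * g a a z0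
    - 2 * (\<Sum>l\<in>UNIV. h b l z0 * (pd b (pd a (pd a F)) z0 \<bullet> pd l F z0))
    - \<nu> z0 \<bullet> pd b (pd b (pd a (pd a F))) z0"
proof -
  let ?F = "pd a (pd a F)"
  have e: "pd b (pd b (h a a)) z0 = pd b (pd b (\<lambda>z. - (\<nu> z \<bullet> ?F z))) z0"
    by (intro cong z0) (simp_all add: h_eq)
  also have "\<dots> = pd b (\<lambda>z. - pd b (\<lambda>z. \<nu> z \<bullet> ?F z) z) z0"
    by (intro cong z0 dd_minus[of S] smooth_on_inner S sm\<nu> smD)
  also have "\<dots> = - pd b (pd b (\<lambda>z. \<nu> z \<bullet> ?F z)) z0"
    by (intro dd_minus[of S] smooth_on_dd smooth_on_inner S sm\<nu> smF z0)
  also have "\<dots> = - (\<nu> z0 \<bullet> pd b (pd b ?F) z0 + 2 * (pd b \<nu> z0 \<bullet> pd b ?F z0)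
      + pd b (pd b \<nu>) z0 \<bullet> ?F z0)"
    by (simp add: dd_inner2[OF S sm\<nu> smD(3) z0])
  also have "pd b \<nu> z0 \<bullet> pd b ?F z0 = (\<Sum>l\<in>UNIV. h b l z0 * (pd b ?F z0 \<bullet> pd l F z0))"
    using parseval[of "pd b \<nu> z0" "pd b ?F z0"] \<nu>_d\<nu>[OF z0, of "xdir b"]
    by (simp add: h_def F_d\<nu>x[OF z0] inner_commute[of _ "\<nu> z0"])
  also have "pd b (pd b \<nu>) z0 \<bullet> ?F z0 =
      h a a z0 * (\<Sum>l\<in>UNIV. (h b l z0)\<^sup>2) + h b b z0 * g a a z0"
  proof -
    have "pd b (\<lambda>z. \<nu> z \<bullet> pd b \<nu> z) z0 = pd b (\<lambda>z. 0) z0"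
      by (rule cong[OF z0]) (simp add: \<nu>_d\<nu>)
    then have 1: "pd b (pd b \<nu>) z0 \<bullet> \<nu> z0 = - (\<Sum>l\<in>UNIV. (h b l z0)\<^sup>2)"
      by (simp add: dd_inner[OF sm\<nu> smD(2) z0] dd_const d\<nu>_d\<nu> power2_eq_square inner_commute[of _ "\<nu> z0"])
    have "pd b (\<lambda>z. pd b \<nu> z \<bullet> F z) z0 = pd b (\<lambda>z. 0) z0"
      by (rule cong[OF z0]) (simp add: F_d\<nu>x)
    then have 2: "pd b (pd b \<nu>) z0 \<bullet> F z0 = - h b b z0"
      by (simp add: dd_inner[OF smD(2) smF z0] dd_const h_def)
    show ?thesis by (simp add: inner_ddF 1 2)
  qed
  finally show ?thesis by simp
qed

lemma F_xxxx: "pd b (pd b (pd a (pd a F))) z0 =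
  pd a (pd a (pd b (pd b F))) z0"
proof -
  let ?a = "xdir a" and ?b = "xdir b"
  have "dd ?b (dd ?b (dd ?a (dd ?a F))) z0 = dd ?b (dd ?a (dd ?b (dd ?a F))) z0"
    by (intro cong z0 dd_commute[OF S] smD)
  also have "\<dots> = dd ?a (dd ?b (dd ?b (dd ?a F))) z0"
    by (intro dd_commute[OF S] smD z0)
  also have "\<dots> = dd ?a (dd ?b (dd ?a (dd ?b F))) z0"
    by (intro cong z0 dd_commute[OF S] smF)
  also have "\<dots> = dd ?a (dd ?a (dd ?b (dd ?b F))) z0"
    by (intro cong z0 dd_commute[OF S] smD)
  finally show ?thesis .
qed

lemma F_xxx: "pd b (pd a (pd a F)) z0 =
  pd a (pd a (pd b F)) z0"
proof -
  let ?a = "xdir a" and ?b = "xdir b"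
  have "dd ?b (dd ?a (dd ?a F)) z0 = dd ?a (dd ?b (dd ?a F)) z0"
    by (intro dd_commute[OF S] smD z0)
  also have "\<dots> = dd ?a (dd ?a (dd ?b F)) z0"
    by (intro cong z0 dd_commute[OF S] smF)
  finally show ?thesis .
qed

lemma sum_mult_delta: "(\<Sum>l\<in>UNIV. f l * (if l = j then c else 0)) = f j * (c::real)" for j :: 'n
  by (simp add: if_distrib[of "\<lambda>x. _ * x"] cong: if_cong)

lemma trace_h: "H z0 = (\<Sum>k\<in>UNIV. h k k z0)"
proof -
  obtain A where A: "\<And>z i j. z \<in> S \<Longrightarrow> h i j z = (\<Sum>l\<in>UNIV. A i l z * g l j z)"
    "\<And>z. z \<in> S \<Longrightarrow> H z = (\<Sum>i\<in>UNIV. A i i z)"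
    using weingarten_smooth by blast
  show ?thesis by (simp add: A(1)[OF z0] A(2)[OF z0] g0 sum_mult_delta)
qed

text \<open>Differentiating the identity \<open>h = A g\<close> of \<open>weingarten_smooth\<close>
  gives the derivatives of \<open>A\<close>, and of its trace \<open>H\<close>, without
  differentiating an inverse matrix. The spatial first derivatives of \<open>g\<close> vanish at
  \<open>z0\<close>.\<close>

lemma trace_deriv:
  shows H_t: "dd tdir H z0 = (\<Sum>i\<in>UNIV. pd i (pd i H) z0) + (A2 + CARD('n)) * H z0"
    and H_xx: "pd m (pd m H) z0 =
      (\<Sum>k\<in>UNIV. pd m (pd m (h k k)) z0
        - (\<Sum>l\<in>UNIV. h k l z0 * pd m (pd m (g l k)) z0))"
proof -
  obtain A where smA: "\<And>i j. smooth_on S (A i j)" and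
    A: "\<And>z i j. z \<in> S \<Longrightarrow> h i j z = (\<Sum>l\<in>UNIV. A i l z * g l j z)"
    "\<And>z. z \<in> S \<Longrightarrow> H z = (\<Sum>i\<in>UNIV. A i i z)"
    using weingarten_smooth by blast
  have A0: "A i j z0 = h i j z0" for i j
    by (simp add: A(1)[OF z0] g0 sum_mult_delta)
  have smAg: "smooth_on S (\<lambda>z. A i l z * g l j z)" for i j l
    by (intro smooth_on_mult S smA smg)
  have d1: "dd v (h i j) z = (\<Sum>l\<in>UNIV. A i l z * dd v (g l j) z + dd v (A i l) z * g l j z)"
    if "z \<in> S" for v i j z
  proof -
    have "dd v (h i j) z = dd v (\<lambda>z. \<Sum>l\<in>UNIV. A i l z * g l j z) z"
      by (rule cong[OF that]) (simp add: A)
    then show ?thesis by (simp add: dd_sum[OF S smAg that] dd_mult[OF smA smg that])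
  qed
  have H1: "dd v H z = (\<Sum>i\<in>UNIV. dd v (A i i) z)" if "z \<in> S" for v z
  proof -
    have "dd v H z = dd v (\<lambda>z. \<Sum>i\<in>UNIV. A i i z) z" by (rule cong[OF that]) (simp add: A)
    then show ?thesis by (simp add: dd_sum[OF S smA that])
  qed
  \<comment> \<open>The shrinking of the metric contributes \<open>+ 2 H |h|^2\<close> to the trace,
    against \<open>- H |h|^2\<close> from \<open>h_t\<close>; hence the coefficient
    \<open>A2\<close> in \<open>H_t\<close>.\<close>
  have "dd tdir (A k k) z0 = dd tdir (h k k) z0 + 2 * H z0 * (\<Sum>l\<in>UNIV. (h k l z0)\<^sup>2)" for k
  proof -
    have "dd tdir (h k k) z0 = (\<Sum>l\<in>UNIV. - 2 * H z0 * (h k l z0)\<^sup>2) + dd tdir (A k k) z0"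
      by (simp add: d1[OF z0] A0 g_t[OF z0] g0 sum.distrib sum_subtractf h_sym[OF z0, of _ k] power2_eq_square
          mult.assoc mult.left_commute sum_mult_delta sum_negf)
    then show ?thesis by (simp add: sum_distrib_left sum_negf)
  qed
  then show "dd tdir H z0 = (\<Sum>i\<in>UNIV. pd i (pd i H) z0) + (A2 + CARD('n)) * H z0"
    by (simp add: H1[OF z0] h_t g0 sum.distrib sum_subtractf A2_def power2_eq_square
        sum_distrib_left[symmetric] algebra_simps)
  have "pd m (pd m (A k k)) z0 = pd m (pd m (h k k)) z0
      - (\<Sum>l\<in>UNIV. h k l z0 * pd m (pd m (g l k)) z0)" for k
  proof -
    have "pd m (pd m (h k k)) z0 =
        pd m (pd m (\<lambda>z. \<Sum>l\<in>UNIV. A k l z * g l k z)) z0"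
      by (intro cong z0) (simp_all add: A)
    also have "\<dots> = pd m (\<lambda>z. \<Sum>l\<in>UNIV. pd m (\<lambda>z. A k l z * g l k z) z) z0"
      by (intro cong z0) (simp add: dd_sum[OF S smAg])
    also have "\<dots> = (\<Sum>l\<in>UNIV. pd m (pd m (\<lambda>z. A k l z * g l k z)) z0)"
      by (simp add: dd_sum[OF S smooth_on_dd[OF smAg] z0])
    also have "\<dots> = (\<Sum>l\<in>UNIV. h k l z0 * pd m (pd m (g l k)) z0)
        + pd m (pd m (A k k)) z0"
      by (simp add: dd_mult2[OF S smA smg z0] g_x g0 A0 sum.distrib sum_mult_delta)
    finally show ?thesis by simp
  qed
  moreover have "pd m (pd m H) z0 = pd m (\<lambda>z. \<Sum>k\<in>UNIV. pd m (A k k) z) z0"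
    by (intro cong z0) (simp add: H1)
  ultimately show "pd m (pd m H) z0 =
      (\<Sum>k\<in>UNIV. pd m (pd m (h k k)) z0
        - (\<Sum>l\<in>UNIV. h k l z0 * pd m (pd m (g l k)) z0))"
    by (simp add: dd_sum[OF S smooth_on_dd[OF smA] z0])
qed

text \<open>The third-order tangential terms cancel because \<open>m\<close> is a principal direction.\<close>

lemma simons:
  fixes \<theta> :: real
  assumes m: "\<And>j. h m j z0 = (if j = m then \<theta> else 0)"
  shows "pd m (pd m H) z0 - (\<Sum>k\<in>UNIV. pd k (pd k (h m m)) z0)
      + \<theta> * (\<Sum>k\<in>UNIV. pd k (pd k (g m m)) z0)
    = - H z0 * \<theta>\<^sup>2 - CARD('n) * \<theta> + \<theta> * A2 + H z0"
proof -
  \<comment> \<open>Tangential components of third derivatives. Normal coordinates do not control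
    them, so they have to cancel.\<close>
  define T where "T a k l = pd a (pd a (pd k F)) z0 \<bullet> pd l F z0" for a k l
  have m': "h j m z0 = (if j = m then \<theta> else 0)" for j using m[of j] h_sym[OF z0, of j m] by simp
  have gxx: "pd k (pd k (g i j)) z0 =
      T k j i + T k i j + 2 * (h k i z0 * h k j z0 + g k i z0 * g k j z0)" for i j k
    unfolding T_def by (rule g_xx)
  have hxx: "pd b (pd b (h a a)) z0 =
    - h a a z0 * (\<Sum>l\<in>UNIV. (h b l z0)\<^sup>2) - h b b z0
    - 2 * (\<Sum>l\<in>UNIV. h b l z0 * T a b l)
    - \<nu> z0 \<bullet> pd b (pd b (pd a (pd a F))) z0" for a b
    unfolding T_def h_xx F_xxx by (simp add: g0)
  have sq: "(\<Sum>l\<in>UNIV. (h m l z0)\<^sup>2) = \<theta>\<^sup>2"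
    by (simp add: m if_distrib[of "\<lambda>x. x\<^sup>2"] cong: if_cong)
  have s1: "(\<Sum>l\<in>UNIV. h m l z0 * f l) = \<theta> * f m" for f :: "'n \<Rightarrow> real"
    by (simp add: m if_distrib[of "\<lambda>x. x * _"] cong: if_cong)
  have e1: "pd m (pd m (h k k)) z0 - pd k (pd k (h m m)) z0
      = - h k k z0 * \<theta>\<^sup>2 - \<theta> - 2 * \<theta> * T k m m + \<theta> * (\<Sum>l\<in>UNIV. (h k l z0)\<^sup>2) + h k k z0
        + 2 * (\<Sum>l\<in>UNIV. h k l z0 * T m k l)" for k
    unfolding hxx sq s1 F_xxxx[of m k] by (simp add: m algebra_simps)
  have e2: "(\<Sum>l\<in>UNIV. h k l z0 * pd m (pd m (g l k)) z0) =
      (\<Sum>l\<in>UNIV. h k l z0 * T m k l) + (\<Sum>l\<in>UNIV. h k l z0 * T m l k)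
      + 2 * (if k = m then \<theta> ^ 3 + \<theta> else 0)" for k
  proof -
    define X where "X l = h m l z0 * h m k z0 + g m l z0 * g m k z0" for l
    have "(\<Sum>l\<in>UNIV. h k l z0 * X l) = (if k = m then \<theta> ^ 3 + \<theta> else 0)"
      by (simp add: X_def m g0 if_distrib[of "\<lambda>x. x * _"] if_distrib[of "\<lambda>x. _ * x"] sum.If_cases power3_eq_cube
          distrib_left sum.distrib cong: if_cong)
    then show ?thesis unfolding gxx X_def[symmetric]
      by (simp only: distrib_left sum.distrib sum_distrib_left[symmetric] mult.left_commute[of _ 2])
  qed
  \<comment> \<open>By symmetry of \<open>h\<close> the two sums over \<open>h k l z0 * T\<close> in
    \<open>e2\<close> agree after summation over \<open>k\<close> and cancel the doubled sum in
    \<open>e1\<close>. The remaining \<open>T k m m\<close> is matched by the Laplacian of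
    \<open>g m m\<close> in \<open>e4\<close>.\<close>
  have e3: "(\<Sum>k\<in>UNIV. \<Sum>l\<in>UNIV. h k l z0 * T m l k) = (\<Sum>k\<in>UNIV. \<Sum>l\<in>UNIV. h k l z0 * T m k l)"
    by (subst sum.swap) (simp add: h_sym[OF z0])
  have e4: "(\<Sum>k\<in>UNIV. pd k (pd k (g m m)) z0) = 2 * (\<Sum>k\<in>UNIV. T k m m) + 2 * \<theta>\<^sup>2 + 2"
    unfolding gxx by (simp add: sum.distrib m' g0 if_distrib[of "\<lambda>x. x * _"] if_distrib[of "\<lambda>x. 2 * x"]
        sum_distrib_left power2_eq_square cong: if_cong)
  have "pd m (pd m H) z0 - (\<Sum>k\<in>UNIV. pd k (pd k (h m m)) z0)
      = (\<Sum>k\<in>UNIV. pd m (pd m (h k k)) z0 - pd k (pd k (h m m)) z0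
        - (\<Sum>l\<in>UNIV. h k l z0 * pd m (pd m (g l k)) z0))"
    by (simp add: H_xx[of m] sum_subtractf)
  also have "\<dots> = - H z0 * \<theta>\<^sup>2 - CARD('n) * \<theta> - 2 * \<theta> * (\<Sum>k\<in>UNIV. T k m m) + \<theta> * A2 + H z0
      - 2 * (\<theta> ^ 3 + \<theta>)"
  proof -
    have "(\<Sum>k\<in>UNIV. if k = m then \<theta> ^ 3 + \<theta> else 0) = \<theta> ^ 3 + \<theta>" by simp
    then show ?thesis
      unfolding e1 e2
      by (simp only: sum_subtractf sum.distrib sum_distrib_left[symmetric] sum_distrib_right[symmetric]
          sum_negf mult_minus_left e3 A2_def trace_h[symmetric]) simp
  qed
  finally show ?thesis unfolding e4 by (simp add: power2_eq_square power3_eq_cube algebra_simps)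
qed

text \<open>The terms \<open>H \<theta>^2\<close> from \<open>h_t\<close>, from the time derivative
  of \<open>g\<close> and from \<open>simons\<close> cancel. The \<open>2 * H z0\<close> collects
  one \<open>H\<close> from \<open>h_t\<close> and one from \<open>simons\<close>. For
  \<open>b = 0\<close> the right-hand side is \<open>(2 - 2 n a - a') H\<close>, which dictates the
  equation for \<eta>.\<close>

lemma evolution:
  assumes sm: "smooth_on S a" "smooth_on S b"
    and x: "\<And>z i. z \<in> S \<Longrightarrow> pd i a z = 0" "\<And>z i. z \<in> S \<Longrightarrow> pd i b z = 0"
    and m: "\<And>j. h m j z0 = (if j = m then \<theta> else 0)"
    and \<theta>: "\<theta> = a z0 * H z0 - b z0"
  defines "\<phi> \<equiv> \<lambda>z. h m m z - (a z * H z - b z) * g m m z"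
  shows "dd tdir \<phi> z0 - (\<Sum>k\<in>UNIV. pd k (pd k \<phi>) z0) =
    (A2 - CARD('n)) * \<theta> + 2 * H z0 - dd tdir a z0 * H z0 - a z0 * (A2 + CARD('n)) * H z0 + dd tdir b z0"
proof -
  define \<Theta> where "\<Theta> z = a z * H z - b z" for z
  have sm\<Theta>: "smooth_on S \<Theta>"
    unfolding \<Theta>_def[abs_def] by (intro smooth_on_diff smooth_on_mult S sm smH)
  have d\<Theta>: "dd v \<Theta> z = a z * dd v H z + dd v a z * H z - dd v b z" if "z \<in> S" for v z
    unfolding \<Theta>_def[abs_def]
    by (simp add: dd_diff[OF smooth_on_mult[OF S sm(1) smH] sm(2) that] dd_mult[OF sm(1) smH that])
  have \<Theta>xx: "pd k (pd k \<Theta>) z0 = a z0 * pd k (pd k H) z0" for k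
  proof -
    have "pd k (pd k \<Theta>) z0 = pd k (\<lambda>z. a z * pd k H z) z0"
      by (intro cong z0) (simp add: d\<Theta> x)
    then show ?thesis by (simp add: dd_mult[OF sm(1) smooth_on_dd[OF smH] z0] x z0)
  qed
  have \<phi>: "\<phi> = (\<lambda>z. h m m z - \<Theta> z * g m m z)" by (simp add: \<phi>_def \<Theta>_def)
  have sm\<Theta>g: "smooth_on S (\<lambda>z. \<Theta> z * g m m z)" by (intro smooth_on_mult S sm\<Theta> smg)
  have d\<phi>: "dd v \<phi> z = dd v (h m m) z - dd v (\<lambda>z. \<Theta> z * g m m z) z" if "z \<in> S" for v z
    unfolding \<phi> by (rule dd_diff[OF smh sm\<Theta>g that])
  have \<phi>xx: "pd k (pd k \<phi>) z0 = pd k (pd k (h m m)) z0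
      - (\<theta> * pd k (pd k (g m m)) z0 + a z0 * pd k (pd k H) z0)" for k
  proof -
    have "pd k (pd k \<phi>) z0 =
        pd k (\<lambda>z. pd k (h m m) z - pd k (\<lambda>z. \<Theta> z * g m m z) z) z0"
      by (intro cong z0 d\<phi>)
    also have "\<dots> = pd k (pd k (h m m)) z0 - pd k (pd k (\<lambda>z. \<Theta> z * g m m z)) z0"
      by (rule dd_diff[OF smooth_on_dd[OF smh] smooth_on_dd[OF sm\<Theta>g] z0])
    finally show ?thesis
      by (simp add: dd_mult2[OF S sm\<Theta> smg z0] g_x g0 \<Theta>xx) (simp add: \<Theta>_def \<theta>)
  qed
  have sq: "(\<Sum>k\<in>UNIV. h m k z0 * h m k z0) = \<theta>\<^sup>2"
    by (simp add: m if_distrib[of "\<lambda>x. x * _"] power2_eq_square cong: if_cong)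
  have "\<Theta> z0 = \<theta>" by (simp add: \<Theta>_def \<theta>)
  then have \<phi>t: "dd tdir \<phi> z0 = pd m (pd m H) z0 + H z0 * \<theta>\<^sup>2 + H z0
      - (a z0 * dd tdir H z0 + dd tdir a z0 * H z0 - dd tdir b z0)"
    by (simp add: d\<phi>[OF z0] h_t[of m m, unfolded sq] g0 dd_mult[OF sm\<Theta> smg z0] d\<Theta>[OF z0] g_t[OF z0] m power2_eq_square
        algebra_simps)
  have "(\<Sum>k\<in>UNIV. pd k (pd k \<phi>) z0) = (\<Sum>k\<in>UNIV. pd k (pd k (h m m)) z0)
      - \<theta> * (\<Sum>k\<in>UNIV. pd k (pd k (g m m)) z0)
      - a z0 * (\<Sum>k\<in>UNIV. pd k (pd k H) z0)"
    by (simp add: \<phi>xx sum_subtractf sum.distrib sum_distrib_left algebra_simps)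
  then show ?thesis
    using simons[OF m] unfolding \<phi>t H_t by (simp add: algebra_simps)
qed

end

section \<open>Chain rule, linearity in the direction, and derivative tests at a minimum\<close>

lemma dd_chain:
  assumes "g differentiable at z" "f differentiable at (g z)"
  shows "dd v (\<lambda>x. f (g x)) z = dd (dd v g z) f (g z)"
  using dd_eqI[OF has_derivative_compose[OF assms[unfolded frechet_derivative_works]]]
  by (simp add: dd_def)

lemma dd_dir_linear:
  assumes "f differentiable at z"
  shows "linear (\<lambda>v. dd v f z)"
  unfolding dd_def using assms frechet_derivative_works has_derivative_linear by blast

lemma dd_dir_linear_fst:
  assumes "f differentiable at z"
  shows "linear (\<lambda>v. dd (v, 0) f z)"
proof -
  have "linear (\<lambda>v. (v, 0))" by (auto intro!: linearI)
  from linear_compose[OF this dd_dir_linear[OF assms]] show ?thesis by (simp add: o_def)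
qed

text \<open>If \<open>c\<close> were negative, \<open>f'\<close> would decrease through its zero at
  0, and the mean value theorem would push \<open>f\<close> below \<open>f 0\<close>.\<close>

lemma second_derivative_test:
  fixes f f' :: "real \<Rightarrow> real"
  assumes "d > 0" "\<And>s. \<bar>s\<bar> < d \<Longrightarrow> DERIV f s :> f' s" "DERIV f' 0 :> c"
    and min: "\<And>s. \<bar>s\<bar> < d \<Longrightarrow> f 0 \<le> f s"
  shows "c \<ge> 0"
proof (rule ccontr)
  assume "\<not> c \<ge> 0"
  have "f' 0 = 0"
    by (rule DERIV_local_min[OF assms(2) assms(1)]) (use assms min in auto)
  moreover obtain e where e: "e > 0" "\<And>h. 0 < h \<Longrightarrow> h < e \<Longrightarrow> f' (0 + h) < f' 0"
    using has_real_derivative_neg_dec_right[OF assms(3)] \<open>\<not> c \<ge> 0\<close> by auto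
  moreover define h where "h = min d e / 2"
  have h: "0 < h" "h < d" "h < e" using e assms(1) by (auto simp: h_def)
  obtain y where y: "0 < y" "y < h" "f h - f 0 = (h - 0) * f' y"
    using MVT2[OF h(1), of f f'] assms(2) h by (metis abs_of_nonneg le_less_trans order_less_imp_le)
  ultimately have "f h - f 0 < 0"
    using h by (simp add: mult_pos_neg)
  then show False using min[of h] h by simp
qed

lemma dd_line_real:
  fixes f :: "'a::real_normed_vector \<Rightarrow> real"
  assumes "smooth_on S f" "z + s *\<^sub>R v \<in> S"
  shows "DERIV (\<lambda>s. f (z + s *\<^sub>R v)) s :> dd v f (z + s *\<^sub>R v)"
  using dd_line[OF smooth_differentiable[OF assms]]
  by (simp add: has_real_derivative_iff_has_vector_derivative)

lemma dd_second_derivative_test: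
  fixes f :: "'a::real_normed_vector \<Rightarrow> real"
  assumes "open S" "smooth_on S f" "z \<in> S"
    and min: "\<And>s. z + s *\<^sub>R v \<in> S \<Longrightarrow> f z \<le> f (z + s *\<^sub>R v)"
  shows "dd v (dd v f) z \<ge> 0"
proof -
  have "open ((\<lambda>s. z + s *\<^sub>R v) -` S)"
    by (intro open_vimage assms continuous_intros)
  moreover have "0 \<in> (\<lambda>s. z + s *\<^sub>R v) -` S" using assms(3) by simp
  ultimately obtain d where d: "d > 0" "ball 0 d \<subseteq> (\<lambda>s::real. z + s *\<^sub>R v) -` S"
    using open_contains_ball by blast
  then have inS: "z + s *\<^sub>R v \<in> S" if "\<bar>s\<bar> < d" for s
    using that by (auto simp: subset_iff)
  show ?thesis
  proof (rule second_derivative_test[OF d(1), of "\<lambda>s. f (z + s *\<^sub>R v)" "\<lambda>s. dd v f (z + s *\<^sub>R v)"])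
    show "DERIV (\<lambda>s. dd v f (z + s *\<^sub>R v)) 0 :> dd v (dd v f) z"
      using dd_line_real[OF smooth_on_dd[OF assms(2)], of z 0 v v] assms(3) by simp
  qed (use inS min dd_line_real[OF assms(2)] in auto)
qed

text \<open>One-sided, for use in the time direction: before a first contact only earlier times are
  controlled.\<close>

lemma dd_left_derivative_test:
  fixes f :: "'a::real_normed_vector \<Rightarrow> real"
  assumes "open S" "smooth_on S f" "z \<in> S" "d > 0"
    and min: "\<And>s. 0 < s \<Longrightarrow> s < d \<Longrightarrow> z - s *\<^sub>R v \<in> S \<Longrightarrow> f z \<le> f (z - s *\<^sub>R v)"
  shows "dd v f z \<le> 0"
proof (rule ccontr)
  assume *: "\<not> dd v f z \<le> 0"
  have "DERIV (\<lambda>s. f (z + s *\<^sub>R v)) 0 :> dd v f z"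
    using dd_line_real[OF assms(2), of z 0 v] assms(3) by simp
  then obtain e where e: "e > 0" "\<And>h. 0 < h \<Longrightarrow> h < e \<Longrightarrow> f (z + (0 - h) *\<^sub>R v) < f (z + 0 *\<^sub>R v)"
    using has_real_derivative_pos_inc_left[of "\<lambda>s. f (z + s *\<^sub>R v)" "dd v f z" 0 UNIV] * by auto
  have "open ((\<lambda>s. z + s *\<^sub>R v) -` S)"
    by (intro open_vimage assms continuous_intros)
  moreover have "0 \<in> (\<lambda>s. z + s *\<^sub>R v) -` S" using assms(3) by simp
  ultimately obtain d' where d': "d' > 0" "ball 0 d' \<subseteq> (\<lambda>s::real. z + s *\<^sub>R v) -` S"
    using open_contains_ball by blast
  define h where "h = min (min d e) d' / 2"
  have h: "0 < h" "h < d" "h < e" "h < d'" using e d' assms(4) by (auto simp: h_def)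
  have "z + (- h) *\<^sub>R v \<in> S" using d'(2) h by (auto simp: subset_iff dest!: spec[of _ "- h"])
  then show False using min[of h] e(2)[of h] h by simp
qed

lemma smooth_on_Pair:
  fixes f :: "'a::real_normed_vector \<Rightarrow> 'b::real_normed_vector" and g :: "'a \<Rightarrow> 'c::real_normed_vector"
  assumes "open S" "smooth_on S f" "smooth_on S g"
  shows "smooth_on S (\<lambda>z. (f z, g z))"
proof -
  have 1: "bounded_linear (\<lambda>x::'b. (x, 0::'c))" "bounded_linear (\<lambda>y::'c. (0::'b, y))"
    by (intro bounded_linear_Pair bounded_linear_ident bounded_linear_zero)+
  have "smooth_on S (\<lambda>z. (f z, 0) + (0, g z))"
    by (intro smooth_on_add assms smooth_on_linear[OF assms(1) 1(1)] smooth_on_linear[OF assms(1) 1(2)])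
  then show ?thesis by simp
qed

lemma smooth_on_snd: "open S \<Longrightarrow> smooth_on S (\<lambda>z. snd z)"
  by (rule smooth_on_linear[OF _ bounded_linear_snd smooth_on_ident])

lemma smooth_on_fst: "open S \<Longrightarrow> smooth_on S (\<lambda>z. fst z)"
  by (rule smooth_on_linear[OF _ bounded_linear_fst smooth_on_ident])

lemma linear_expand:
  fixes D :: "real^'n::finite \<Rightarrow> 'v::real_vector"
  assumes "linear D"
  shows "D w = (\<Sum>i\<in>UNIV. w $ i *\<^sub>R D (axis i 1))"
proof -
  have "w = (\<Sum>i\<in>UNIV. w $ i *\<^sub>R axis i 1)"
    by (metis basis_expansion vector_space_over_itself.scale_one scalar_mult_eq_scaleR)
  then show ?thesis using linear_sum[OF assms] linear_cmul[OF assms] by (metis (no_types, lifting) sum.cong)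
qed

section \<open>Changes of coordinates, orthonormal frames and normal coordinates\<close>

context coordinate_flow
begin

definition hh where "hh w z = dd (w, 0) \<nu> z \<bullet> dd (w, 0) F z"
definition gg where "gg w z = dd (w, 0) F z \<bullet> dd (w, 0) F z"

lemma dirF: "z \<in> S \<Longrightarrow> linear (\<lambda>w. dd (w, 0) F z)"
  and dir\<nu>: "z \<in> S \<Longrightarrow> linear (\<lambda>w. dd (w, 0) \<nu> z)"
  by (intro dd_dir_linear_fst smooth_differentiable[OF smF] smooth_differentiable[OF sm\<nu>]; assumption)+

lemma dirF_inj:
  assumes "z \<in> S" "dd (w, 0) F z = 0"
  shows "w = 0"
proof -
  let ?G = "\<chi> i j. g i j z"
  have "(?G *v w) $ i = pd i F z \<bullet> dd (w, 0) F z" for i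
    unfolding linear_expand[OF dirF[OF assms(1)], of w]
    by (simp add: matrix_vector_mult_def g_def inner_sum_right mult.commute)
  then have "?G *v w = 0" by (simp add: vec_eq_iff assms(2))
  moreover have "invertible ?G" using gram[OF assms(1)] by (simp add: invertible_det_nz g_def)
  ultimately show ?thesis
    by (metis matrix_left_invertible_ker invertible_def)
qed

text \<open>The new coordinates keep the time direction, so the velocity acquires no tangential
  part. The Weingarten matrix is conjugated by the spatial Jacobian \<open>P\<close>, which
  preserves its trace.\<close>

lemma reparametrize:
  assumes S': "open S'" "smooth_on S' \<Psi>" "\<And>z. z \<in> S' \<Longrightarrow> \<Psi> z \<in> S"
    and x: "\<And>z i. z \<in> S' \<Longrightarrow> pd i \<Psi> z = (P z $ i, 0)"
    and t: "\<And>z. z \<in> S' \<Longrightarrow> dd tdir \<Psi> z = tdir"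
    and P: "\<And>z. z \<in> S' \<Longrightarrow> det (P z) \<noteq> 0"
  shows "coordinate_flow S' (\<lambda>z. F (\<Psi> z)) (\<lambda>z. \<nu> (\<Psi> z)) (\<lambda>z. H (\<Psi> z))"
proof
  have ch: "dd v (\<lambda>x. f (\<Psi> x)) z = dd (dd v \<Psi> z) f (\<Psi> z)" if "smooth_on S f" "z \<in> S'"
    for f :: "(real^'n) \<times> real \<Rightarrow> 'e" and v z
    by (rule dd_chain[OF smooth_differentiable[OF S'(2) that(2)] smooth_differentiable[OF that(1) S'(3)[OF that(2)]]])
  have chF: "pd i (\<lambda>x. F (\<Psi> x)) z = (\<Sum>l\<in>UNIV. P z $ i $ l *\<^sub>R pd l F (\<Psi> z))" if "z \<in> S'" for i z
    unfolding ch[OF smF that] x[OF that] by (rule linear_expand[OF dirF[OF S'(3)[OF that]]])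
  have ch\<nu>: "pd i (\<lambda>x. \<nu> (\<Psi> x)) z = (\<Sum>l\<in>UNIV. P z $ i $ l *\<^sub>R pd l \<nu> (\<Psi> z))" if "z \<in> S'" for i z
    unfolding ch[OF sm\<nu> that] x[OF that] by (rule linear_expand[OF dir\<nu>[OF S'(3)[OF that]]])
  show "open S'" by fact
  show "smooth_on S' (\<lambda>z. F (\<Psi> z))" "smooth_on S' (\<lambda>z. \<nu> (\<Psi> z))"
    using smooth_on_compose[OF S'(1) S S'(3)] smF sm\<nu> S'(2) by auto
  show "DIM('e) = CARD('n) + 2" by (rule dim)
  fix z assume z: "z \<in> S'"
  note \<Psi>z = S'(3)[OF z]
  show "F (\<Psi> z) \<bullet> F (\<Psi> z) = 1" "\<nu> (\<Psi> z) \<bullet> \<nu> (\<Psi> z) = 1" "\<nu> (\<Psi> z) \<bullet> F (\<Psi> z) = 0"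
    using FF \<nu>\<nu> \<nu>F \<Psi>z by auto
  show "\<nu> (\<Psi> z) \<bullet> pd i (\<lambda>z. F (\<Psi> z)) z = 0" for i
    by (simp add: chF[OF z] inner_sum_right \<nu>dF[OF \<Psi>z])
  show "dd tdir (\<lambda>z. F (\<Psi> z)) z = - (H (\<Psi> z) *\<^sub>R \<nu> (\<Psi> z))"
    unfolding ch[OF smF z] t[OF z] by (rule Ft[OF \<Psi>z])
  let ?G = "\<chi> i j. pd i F (\<Psi> z) \<bullet> pd j F (\<Psi> z)"
  have "(\<chi> i j. pd i (\<lambda>z. F (\<Psi> z)) z \<bullet> pd j (\<lambda>z. F (\<Psi> z)) z) = P z ** ?G ** transpose (P z)"
    by (simp add: vec_eq_iff chF[OF z] matrix_matrix_mult_def transpose_def inner_sum_left inner_sum_right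
        sum_distrib_left sum_distrib_right mult_ac)
  then show "det (\<chi> i j. pd i (\<lambda>z. F (\<Psi> z)) z \<bullet> pd j (\<lambda>z. F (\<Psi> z)) z) \<noteq> 0"
    using P[OF z] gram[OF \<Psi>z] by (simp add: det_mul det_transpose)
  obtain A :: "real^'n^'n" where
    A: "\<And>i. pd i \<nu> (\<Psi> z) = (\<Sum>j\<in>UNIV. A $ i $ j *\<^sub>R pd j F (\<Psi> z))" "H (\<Psi> z) = trace A"
    using weingarten[OF \<Psi>z] by blast
  have "invertible (P z)" using P[OF z] by (simp add: invertible_det_nz)
  then obtain R where R: "R ** P z = mat 1" "P z ** R = mat 1" unfolding invertible_def by blast
  let ?B = "P z ** A ** R"
  have Rx: "pd l F (\<Psi> z) = (\<Sum>j\<in>UNIV. R $ l $ j *\<^sub>R pd j (\<lambda>z. F (\<Psi> z)) z)" for l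
  proof -
    have "(\<Sum>j\<in>UNIV. R $ l $ j *\<^sub>R pd j (\<lambda>z. F (\<Psi> z)) z) =
        (\<Sum>m\<in>UNIV. (R ** P z) $ l $ m *\<^sub>R pd m F (\<Psi> z))"
      unfolding chF[OF z] scaleR_sum_right
      by (subst sum.swap) (simp add: matrix_matrix_mult_def scaleR_sum_left)
    also have "\<dots> = pd l F (\<Psi> z)"
      by (simp add: R mat_def if_distrib[of "\<lambda>x. x *\<^sub>R _"] cong: if_cong)
    finally show ?thesis by simp
  qed
  have "pd i (\<lambda>z. \<nu> (\<Psi> z)) z = (\<Sum>j\<in>UNIV. ?B $ i $ j *\<^sub>R pd j (\<lambda>z. F (\<Psi> z)) z)" for i
  proof -
    have "pd i (\<lambda>z. \<nu> (\<Psi> z)) z = (\<Sum>l\<in>UNIV. (P z ** A) $ i $ l *\<^sub>R pd l F (\<Psi> z))"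
      unfolding ch\<nu>[OF z] A scaleR_sum_right
      by (subst sum.swap) (simp add: matrix_matrix_mult_def scaleR_sum_left)
    also have "\<dots> = (\<Sum>j\<in>UNIV. ?B $ i $ j *\<^sub>R pd j (\<lambda>z. F (\<Psi> z)) z)"
      unfolding Rx scaleR_sum_right
      by (subst sum.swap) (simp add: matrix_matrix_mult_def[of "P z ** A"] scaleR_sum_left)
    finally show ?thesis .
  qed
  moreover have "H (\<Psi> z) = trace ?B"
    by (metis A(2) R(1) matrix_mul_assoc matrix_mul_rid trace_mul_sym)
  ultimately show "\<exists>A::real^'n^'n. (\<forall>i. pd i (\<lambda>z. \<nu> (\<Psi> z)) z =
      (\<Sum>j\<in>UNIV. A $ i $ j *\<^sub>R pd j (\<lambda>z. F (\<Psi> z)) z)) \<and> H (\<Psi> z) = trace A"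
    by blast
qed

text \<open>The tangent space has dimension \<open>n\<close>, so there is a linear isometry
  \<open>f\<close> onto it from coordinate space. Preceding \<open>f\<close> by a rotation makes the
  \<open>m\<close>-th axis go to the image of \<open>v\<close>; pulling back by \<open>D\<close>
  gives the frame.\<close>

lemma orthonormal_frame:
  fixes m :: 'n
  assumes "z \<in> S" "gg v z = 1"
  shows "\<exists>L. L m = v \<and> (\<forall>i j. dd (L i, 0) F z \<bullet> dd (L j, 0) F z = (if i = j then 1 else 0))"
proof -
  define D where "D w = dd (w, 0) F z" for w
  have lin: "linear D" unfolding D_def[abs_def] by (rule dirF[OF assms(1)])
  have inj: "inj D"
    by (rule linear_injective_0[OF lin, THEN iffD2]) (use dirF_inj[OF assms(1)] in \<open>simp add: D_def\<close>)
  have dimD: "dim (UNIV :: (real^'n) set) = dim (range D)"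
    using dim_image_eq[OF lin, of UNIV] inj by simp
  have "\<exists>f :: real^'n \<Rightarrow> 'e. linear f \<and> range f = range D \<and> (\<forall>x. norm (f x) = norm x)"
  proof (rule isometry_subspaces[OF subspace_UNIV linear_subspace_image[OF lin subspace_UNIV] dimD])
    fix f :: "real^'n \<Rightarrow> 'e"
    assume "linear f" "range f = range D" "\<And>x. x \<in> UNIV \<Longrightarrow> norm (f x) = norm x"
    then show ?thesis by blast
  qed
  then obtain f :: "real^'n \<Rightarrow> 'e" where f: "linear f" "range f = range D" "\<And>x. norm (f x) = norm x"
    by blast
  obtain a where a: "f a = D v" using f(2) by (metis rangeE rangeI)
  have "norm (D v) = 1" using assms(2) by (simp add: gg_def D_def norm_eq_1)
  then have "norm a = 1" using f(3)[of a] a by simp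
  then have n: "norm (axis m (1::real)) = norm a" by (simp add: norm_axis_1)
  have "\<exists>k :: real^'n \<Rightarrow> real^'n. orthogonal_transformation k \<and> k (axis m 1) = a"
    by (rule orthogonal_transformation_exists[OF n]) blast
  then obtain k :: "real^'n \<Rightarrow> real^'n" where k: "orthogonal_transformation k" "k (axis m 1) = a" by blast
  have lfk: "linear (f \<circ> k)"
    using linear_compose[of k f] f(1) k(1) by (simp add: orthogonal_transformation_def)
  have nfk: "norm ((f \<circ> k) x) = norm x" for x
    using f(3) orthogonal_transformation_norm[OF k(1)] by simp
  have ifk: "(f \<circ> k) x \<bullet> (f \<circ> k) y = x \<bullet> y" for x y
    using nfk[of "x + y"] nfk[of x] nfk[of y] unfolding linear_add[OF lfk] by (simp add: dot_norm)
  define L where "L i = inv D ((f \<circ> k) (axis i 1))" for i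
  have DL: "D (L i) = (f \<circ> k) (axis i 1)" for i
    unfolding L_def by (rule f_inv_into_f) (use f(2) in auto)
  have "D (L m) = D v" by (simp add: DL k a)
  then have "L m = v" using inj by (simp add: inj_eq)
  moreover have "D (L i) \<bullet> D (L j) = (if i = j then 1 else 0)" for i j
    unfolding DL ifk by (simp add: inner_axis_axis)
  ultimately show ?thesis by (auto simp: D_def)
qed

text \<open>A linear change makes the frame orthonormal with \<open>m\<close>-th vector
  \<open>v\<close>, and a quadratic correction removes the tangential second derivatives of
  \<open>F\<close>. The map does not depend on time, although the metric does: only the slice at
  \<open>t0\<close> has to be normalized.\<close>

lemma normal_coordinates:
  fixes m :: 'n
  assumes z0: "(x0, t0) \<in> S" and v: "gg v (x0, t0) = 1"
  shows "\<exists>S' \<Psi> (P :: (real^'n) \<times> real \<Rightarrow> real^'n^'n).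
    normal_coordinate_flow S' (\<lambda>z. F (\<Psi> z)) (\<lambda>z. \<nu> (\<Psi> z)) (\<lambda>z. H (\<Psi> z)) (0, t0) \<and>
    \<Psi> (0, t0) = (x0, t0) \<and> (\<forall>z. snd (\<Psi> z) = snd z) \<and> smooth_on S' \<Psi> \<and> \<Psi> ` S' \<subseteq> S \<and>
    (\<forall>i. \<forall>z\<in>S'. pd i \<Psi> z = (P z $ i, 0)) \<and> P (0, t0) $ m = v"
proof -
  obtain L where L: "L m = v"
    "\<And>i j. dd (L i, 0) F (x0, t0) \<bullet> dd (L j, 0) F (x0, t0) = (if i = j then 1 else 0)"
    using orthonormal_frame[OF z0 v, of m] by blast
  define DD where "DD i j = dd (L j, 0) (dd (L i, 0) F) (x0, t0)" for i j
  have DD_sym: "DD i j = DD j i" for i j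
    unfolding DD_def by (rule dd_commute[OF S smF z0])
  \<comment> \<open>Minus the tangential part of the second derivative \<open>DD i j\<close>,
    written in coordinates: the negative Christoffel symbols in the frame \<open>L\<close>.\<close>
  define q where "q i j = (\<Sum>k\<in>UNIV. - (DD i j \<bullet> dd (L k, 0) F (x0, t0)) *\<^sub>R L k)" for i j
  have q_sym: "q i j = q j i" for i j by (simp add: q_def DD_sym)
  have lF0: "linear (\<lambda>w. dd (w, 0) F (x0, t0))" by (rule dirF[OF z0])
  have q: "dd (q i j, 0) F (x0, t0) \<bullet> dd (L l, 0) F (x0, t0) = - (DD i j \<bullet> dd (L l, 0) F (x0, t0))" for i j l
  proof -
    have "dd (q i j, 0) F (x0, t0) = (\<Sum>k\<in>UNIV. - (DD i j \<bullet> dd (L k, 0) F (x0, t0)) *\<^sub>R dd (L k, 0) F (x0, t0))"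
      unfolding q_def linear_sum[OF lF0] by (simp add: linear_cmul[OF lF0] linear_neg[OF lF0])
    then show ?thesis
      by (simp add: inner_sum_left inner_sum_right L sum_negf if_distrib[of "\<lambda>x. _ * x"] cong: if_cong)
  qed
  \<comment> \<open>The factor \<open>1/2\<close> is undone by the symmetry of \<open>q\<close> when
    differentiating, which makes the Jacobian rows \<open>V\<close> affine in \<open>y\<close> with
    slope \<open>q\<close>.\<close>
  define \<Phi> where "\<Phi> y = x0 + (\<Sum>i\<in>UNIV. (y \<bullet> axis i 1) *\<^sub>R L i)
      + (\<Sum>i\<in>UNIV. \<Sum>j\<in>UNIV. ((y \<bullet> axis i 1) * (y \<bullet> axis j 1)) *\<^sub>R ((1/2) *\<^sub>R q i j))" for y :: "real^'n"
  define \<Psi> where "\<Psi> z = (\<Phi> (fst z), snd z)" for z :: "(real^'n) \<times> real"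
  define V where "V z i = L i + (\<Sum>j\<in>UNIV. fst z $ j *\<^sub>R q i j)" for z :: "(real^'n) \<times> real" and i
  define P :: "(real^'n) \<times> real \<Rightarrow> real^'n^'n" where "P z = (\<chi> i. V z i)" for z
  have sm\<Psi>: "smooth_on U \<Psi>" if "open U" for U
    unfolding \<Psi>_def[abs_def] \<Phi>_def
    by (intro smooth_on_Pair smooth_on_add smooth_on_sum smooth_on_scaleR smooth_on_mult smooth_on_inner
        smooth_on_const smooth_on_fst smooth_on_snd that)
  have d\<Psi>: "(\<Psi> has_derivative (\<lambda>w. ((\<Sum>i\<in>UNIV. fst w $ i *\<^sub>R V z i), snd w))) (at z)" for z
  proof -
    have eq: "(\<Sum>i\<in>UNIV. (fst w \<bullet> axis i 1) *\<^sub>R L i) +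
      (\<Sum>i\<in>UNIV. \<Sum>j\<in>UNIV. ((fst z \<bullet> axis i 1) * (fst w \<bullet> axis j 1) + (fst w \<bullet> axis i 1) * (fst z \<bullet> axis j 1)) *\<^sub>R ((1/2) *\<^sub>R q i j))
      = (\<Sum>i\<in>UNIV. fst w $ i *\<^sub>R V z i)" for w
    proof -
      let ?a = "\<lambda>i j. (fst w $ i * fst z $ j) *\<^sub>R ((1/2) *\<^sub>R q i j)"
      have "(\<Sum>i\<in>UNIV. \<Sum>j\<in>UNIV. (fst z $ i * fst w $ j) *\<^sub>R ((1/2) *\<^sub>R q i j)) = (\<Sum>i\<in>UNIV. \<Sum>j\<in>UNIV. ?a i j)"
        by (subst sum.swap) (simp add: q_sym mult.commute)
      then have "(\<Sum>i\<in>UNIV. \<Sum>j\<in>UNIV. (fst z $ i * fst w $ j + fst w $ i * fst z $ j) *\<^sub>R ((1/2) *\<^sub>R q i j))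
          = (\<Sum>i\<in>UNIV. \<Sum>j\<in>UNIV. ?a i j + ?a i j)"
        by (simp only: scaleR_left_distrib sum.distrib)
      moreover have "?a i j + ?a i j = fst w $ i *\<^sub>R fst z $ j *\<^sub>R q i j" for i j
        by (simp add: scaleR_left_distrib[symmetric] mult.commute)
      ultimately have "(\<Sum>i\<in>UNIV. \<Sum>j\<in>UNIV. (fst z $ i * fst w $ j + fst w $ i * fst z $ j) *\<^sub>R ((1/2) *\<^sub>R q i j))
          = (\<Sum>i\<in>UNIV. fst w $ i *\<^sub>R (\<Sum>j\<in>UNIV. fst z $ j *\<^sub>R q i j))"
        by (simp only: scaleR_sum_right)
      moreover have "x \<bullet> axis i 1 = x $ i" for x :: "real^'n" and i by (simp add: inner_axis)
      ultimately show ?thesis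
        unfolding V_def by (simp only: scaleR_right_distrib sum.distrib)
    qed
    show ?thesis unfolding \<Psi>_def[abs_def] \<Phi>_def
      by (rule has_derivative_eq_rhs, (rule derivative_intros)+) (simp add: eq[symmetric] fun_eq_iff)
  qed
  have x: "pd i \<Psi> z = (P z $ i, 0)" for i z
    unfolding dd_eqI[OF d\<Psi>] by (simp add: P_def axis_def if_distrib[of "\<lambda>x. x *\<^sub>R _"] cong: if_cong)
  have t: "dd tdir \<Psi> z = tdir" for z
    unfolding dd_eqI[OF d\<Psi>] by simp
  have \<Psi>0: "\<Psi> (0, t0) = (x0, t0)" by (simp add: \<Psi>_def \<Phi>_def)
  have P0: "P (0, t) $ i = L i" for t i by (simp add: P_def V_def)
  have smP: "smooth_on UNIV (\<lambda>z. P z $ i $ j)" for i j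
  proof -
    have "smooth_on UNIV (\<lambda>z. V z i \<bullet> axis j 1)"
      unfolding V_def
      by (intro smooth_on_inner smooth_on_add smooth_on_sum smooth_on_scaleR smooth_on_const open_UNIV
          smooth_on_linear[OF open_UNIV bounded_linear_vec_nth smooth_on_fst])
    then show ?thesis by (simp add: P_def inner_axis)
  qed
  \<comment> \<open>The quadratic map may leave \<open>S\<close> or degenerate away from the centre,
    so both are excluded by restriction.\<close>
  define S' where "S' = \<Psi> -` S \<inter> (\<lambda>z. det (P z)) -` (- {0})"
  have oS': "open S'" unfolding S'_def
    by (intro open_Int open_vimage S open_Compl closed_singleton
        smooth_on_continuous sm\<Psi> open_UNIV smooth_on_det smP)
  interpret R: coordinate_flow S' "\<lambda>z. F (\<Psi> z)" "\<lambda>z. \<nu> (\<Psi> z)" "\<lambda>z. H (\<Psi> z)"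
    by (rule reparametrize[OF oS' sm\<Psi>[OF oS'] _ x t]) (auto simp: S'_def)
  have "det (P (0, t0)) \<noteq> 0"
  proof -
    have "w = 0" if "transpose (P (0, t0)) *v w = 0" for w
    proof -
      have "(\<Sum>i\<in>UNIV. w $ i *\<^sub>R L i) = 0"
        using that by (simp add: vec_eq_iff matrix_vector_mult_def transpose_def P0 mult.commute)
      then have "dd (\<Sum>i\<in>UNIV. w $ i *\<^sub>R L i, 0) F (x0, t0) = 0" using linear_0[OF lF0] by simp
      then have "(\<Sum>i\<in>UNIV. w $ i *\<^sub>R dd (L i, 0) F (x0, t0)) \<bullet> dd (L j, 0) F (x0, t0) = 0" for j
        by (simp add: linear_sum[OF lF0] linear_cmul[OF lF0])
      then have "w $ j = 0" for j
        by (simp add: inner_sum_left L if_distrib[of "\<lambda>x. _ * x"] cong: if_cong)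
      then show ?thesis by (simp add: vec_eq_iff)
    qed
    then show ?thesis
      by (metis matrix_left_invertible_ker invertible_left_inverse invertible_det_nz det_transpose)
  qed
  then have z0': "(0, t0) \<in> S'" using z0 by (simp add: S'_def \<Psi>0)
  have ch: "dd v (\<lambda>x. f (\<Psi> x)) z = dd (dd v \<Psi> z) f (\<Psi> z)" if "smooth_on S f" "z \<in> S'"
    for f :: "(real^'n) \<times> real \<Rightarrow> 'e" and v z
    by (rule dd_chain[OF smooth_differentiable[OF sm\<Psi>[OF oS'] that(2)] smooth_differentiable[OF that(1)]])
      (use that in \<open>simp add: S'_def\<close>)
  have F1: "pd i (\<lambda>z. F (\<Psi> z)) z =
      dd (L i, 0) F (\<Psi> z) + (\<Sum>j\<in>UNIV. (fst z \<bullet> axis j 1) *\<^sub>R dd (q i j, 0) F (\<Psi> z))" if "z \<in> S'" for i z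
  proof -
    have l: "linear (\<lambda>w. dd (w, 0) F (\<Psi> z))" using that by (intro dirF) (simp add: S'_def)
    show ?thesis
      by (simp add: ch[OF smF that] x P_def V_def linear_add[OF l] linear_sum[OF l] linear_cmul[OF l] inner_axis)
  qed
  have smD\<Psi>: "smooth_on S' (\<lambda>z. dd u F (\<Psi> z))" for u
    using smooth_on_compose[OF oS' S _ smooth_on_dd[OF smF] sm\<Psi>[OF oS']] by (simp add: S'_def)
  have smx: "smooth_on S' (\<lambda>z. fst z \<bullet> axis j 1)" for j :: 'n
    by (intro smooth_on_inner oS' smooth_on_fst smooth_on_const)
  have F2: "pd k (pd i (\<lambda>z. F (\<Psi> z))) (0, t0) = DD i k + dd (q i k, 0) F (x0, t0)" for i k
  proof -
    have dx: "pd k (\<lambda>z. fst z \<bullet> axis j 1) z = (if j = k then 1 else 0)" for j and z :: "(real^'n) \<times> real"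
    proof -
      have "((\<lambda>z. fst z \<bullet> axis j 1) has_derivative (\<lambda>z. fst z \<bullet> axis j 1)) (at z)"
        by (intro bounded_linear_imp_has_derivative bounded_linear_compose[OF bounded_linear_inner_left bounded_linear_fst])
      from dd_eqI[OF this] show ?thesis by (simp add: inner_axis_axis)
    qed
    have "pd k (pd i (\<lambda>z. F (\<Psi> z))) (0, t0) = pd k (\<lambda>z.
      dd (L i, 0) F (\<Psi> z) + (\<Sum>j\<in>UNIV. (fst z \<bullet> axis j 1) *\<^sub>R dd (q i j, 0) F (\<Psi> z))) (0, t0)"
      by (rule R.cong[OF z0']) (rule F1)
    also have "\<dots> = pd k (\<lambda>z. dd (L i, 0) F (\<Psi> z)) (0, t0)
        + (\<Sum>j\<in>UNIV. pd k (\<lambda>z. (fst z \<bullet> axis j 1) *\<^sub>R dd (q i j, 0) F (\<Psi> z)) (0, t0))"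
      by (subst dd_plus[OF smD\<Psi> _ z0'])
        (simp_all add: smooth_on_sum oS' smooth_on_scaleR smx smD\<Psi> dd_sum[OF oS' _ z0'])
    also have "pd k (\<lambda>z. dd (L i, 0) F (\<Psi> z)) (0, t0) = DD i k"
      by (simp add: ch[OF smooth_on_dd[OF smF] z0'] x P0 \<Psi>0 DD_def)
    also have "(\<Sum>j\<in>UNIV. pd k (\<lambda>z. (fst z \<bullet> axis j 1) *\<^sub>R dd (q i j, 0) F (\<Psi> z)) (0, t0)) = dd (q i k, 0) F (x0, t0)"
      by (simp add: dd_scaleR[OF smx smD\<Psi> z0'] dx \<Psi>0 if_distrib[of "\<lambda>x. x *\<^sub>R _"] cong: if_cong)
    finally show ?thesis .
  qed
  have F10: "pd i (\<lambda>z. F (\<Psi> z)) (0, t0) = dd (L i, 0) F (x0, t0)" for i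
    by (simp add: F1[OF z0'] \<Psi>0)
  have "normal_coordinate_flow S' (\<lambda>z. F (\<Psi> z)) (\<lambda>z. \<nu> (\<Psi> z)) (\<lambda>z. H (\<Psi> z)) (0, t0)"
    by unfold_locales (simp_all add: z0' F10 L F2 inner_add_left q)
  then show ?thesis
    by (intro exI[of _ S'] exI[of _ \<Psi>] exI[of _ P])
      (auto simp: \<Psi>0 x P0 L sm\<Psi>[OF oS'], auto simp: \<Psi>_def S'_def)
qed

lemma hh_two:
  assumes "z \<in> S" "i \<noteq> j"
  shows "hh (a *\<^sub>R axis i 1 + b *\<^sub>R axis j 1) z = a\<^sup>2 * h i i z + 2 * a * b * h i j z + b\<^sup>2 * h j j z"
    and "gg (a *\<^sub>R axis i 1 + b *\<^sub>R axis j 1) z = a\<^sup>2 * g i i z + 2 * a * b * g i j z + b\<^sup>2 * g j j z"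
  unfolding hh_def gg_def linear_add[OF dirF[OF assms(1)]] linear_add[OF dir\<nu>[OF assms(1)]]
    linear_cmul[OF dirF[OF assms(1)]] linear_cmul[OF dir\<nu>[OF assms(1)]]
  using h_sym[OF assms(1), of i j] g_sym[of i j z]
  by (simp_all add: inner_add_left inner_add_right h_def g_def power2_eq_square algebra_simps)

lemma hh_axis: "hh (axis i 1) z = h i i z" "gg (axis i 1) z = g i i z"
  by (simp_all add: hh_def gg_def h_def g_def)

end

section \<open>Nonnegative quadratic forms and the first contact point\<close>

lemma quadratic_nonneg_linear_coeff:
  fixes b c :: real
  assumes "\<And>s. 2 * s * b + s\<^sup>2 * c \<ge> 0"
  shows "b = 0"
proof (rule ccontr)
  assume "b \<noteq> 0"
  \<comment> \<open>Chosen so that \<open>s^2 * (\<bar>c\<bar> + 1) = - s * b\<close>; the quadratic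
    term can then undo at most half of the negative linear term.\<close>
  define s where "s = - b / (\<bar>c\<bar> + 1)"
  have p: "\<bar>c\<bar> + 1 > 0" by simp
  have "s\<^sup>2 * c \<le> s\<^sup>2 * (\<bar>c\<bar> + 1)" by (intro mult_left_mono) auto
  also have "\<dots> = - s * b" using p by (simp add: s_def power2_eq_square)
  finally have "s * b \<ge> 0" using assms[of s] by simp
  moreover have "s * b = - (b\<^sup>2 / (\<bar>c\<bar> + 1))" by (simp add: s_def power2_eq_square)
  moreover have "b\<^sup>2 / (\<bar>c\<bar> + 1) > 0" using \<open>b \<noteq> 0\<close> p by simp
  ultimately show False by simp
qed

lemma quadratic_nonneg_discriminant:
  fixes a b c :: real
  assumes "\<And>s t. s\<^sup>2 * a + 2 * s * t * b + t\<^sup>2 * c \<ge> 0"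
  shows "b\<^sup>2 \<le> a * c"
proof (cases "a = 0")
  case True
  have "b = 0" by (rule quadratic_nonneg_linear_coeff[of b c]) (use assms[of 1] True in simp)
  then show ?thesis using True by simp
next
  case False
  have "a \<ge> 0" using assms[of 1 0] by simp
  then have "a > 0" using False by simp
  have "b\<^sup>2 * a + 2 * (- b) * a * b + a\<^sup>2 * c \<ge> 0" using assms[of "- b" a] by simp
  then have "a * b\<^sup>2 \<le> a * (a * c)" by (simp add: power2_eq_square algebra_simps)
  then show ?thesis using \<open>a > 0\<close> by simp
qed

text \<open>The two-by-two minors of a nonnegative form give
  \<open>(h k l)^2 \<le> h k k * h l l\<close>, and the right-hand sides sum to the square of the
  trace.\<close>

lemma (in normal_coordinate_flow) A2_le:
  assumes "\<And>w. hh w z0 \<ge> 0"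
  shows "A2 \<le> (H z0)\<^sup>2"
proof -
  have "(h k l z0)\<^sup>2 \<le> h k k z0 * h l l z0" for k l
  proof (cases "k = l")
    case False
    show ?thesis
      by (rule quadratic_nonneg_discriminant) (use assms hh_two(1)[OF z0 False] in metis)
  qed (simp add: power2_eq_square)
  then have "A2 \<le> (\<Sum>k\<in>UNIV. \<Sum>l\<in>UNIV. h k k z0 * h l l z0)"
    unfolding A2_def by (intro sum_mono) auto
  also have "\<dots> = (H z0)\<^sup>2" by (simp add: trace_h power2_eq_square sum_product)
  finally show ?thesis .
qed

text \<open>At the first zero of the form \<open>hh - (\<alpha> H - \<beta>) gg\<close> the spatial Laplacian of its test function is
  nonnegative and its time derivative nonpositive.\<close>

lemma (in coordinate_flow) contact:
  fixes \<alpha> \<beta> :: "real \<Rightarrow> real"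
  assumes z0: "(x0, t0) \<in> S" and s0: "s0 < t0"
    and sm: "smooth_on UNIV \<alpha>" "smooth_on UNIV \<beta>"
    and d: "DERIV \<alpha> t0 :> \<alpha>'" "DERIV \<beta> t0 :> \<beta>'"
    and pos: "\<And>x t w. (x, t) \<in> S \<Longrightarrow> s0 \<le> t \<Longrightarrow> t \<le> t0 \<Longrightarrow>
      (\<alpha> t * H (x, t) - \<beta> t) * gg w (x, t) \<le> hh w (x, t)"
    and convex: "\<And>w. hh w (x0, t0) \<ge> 0"
    and eq: "gg v (x0, t0) = 1" "hh v (x0, t0) = \<alpha> t0 * H (x0, t0) - \<beta> t0"
  shows "\<exists>Q \<le> (H (x0, t0))\<^sup>2. (Q - CARD('n)) * (\<alpha> t0 * H (x0, t0) - \<beta> t0) + 2 * H (x0, t0)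
      - \<alpha>' * H (x0, t0) - \<alpha> t0 * (Q + CARD('n)) * H (x0, t0) + \<beta>' \<le> 0"
proof -
  \<comment> \<open>An arbitrary index, to which the contact direction \<open>v\<close> is assigned
    by the choice of coordinates.\<close>
  fix m :: 'n
  obtain S' \<Psi> and P :: "(real^'n) \<times> real \<Rightarrow> real^'n^'n" where
    N: "normal_coordinate_flow S' (\<lambda>z. F (\<Psi> z)) (\<lambda>z. \<nu> (\<Psi> z)) (\<lambda>z. H (\<Psi> z)) (0, t0)" and
    \<Psi>: "\<Psi> (0, t0) = (x0, t0)" "\<forall>z. snd (\<Psi> z) = snd z" "smooth_on S' \<Psi>" "\<Psi> ` S' \<subseteq> S"
    "\<forall>i. \<forall>z\<in>S'. pd i \<Psi> z = (P z $ i, 0)" "P (0, t0) $ m = v"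
    using normal_coordinates[OF z0 eq(1), of m] by blast
  interpret N: normal_coordinate_flow S' "\<lambda>z. F (\<Psi> z)" "\<lambda>z. \<nu> (\<Psi> z)" "\<lambda>z. H (\<Psi> z)" "(0, t0)"
    by (rule N)
  let ?z = "(0, t0) :: (real^'n) \<times> real"
  have ch: "dd v (\<lambda>x. f (\<Psi> x)) z = dd (dd v \<Psi> z) f (\<Psi> z)" if "smooth_on S f" "z \<in> S'"
    for f :: "(real^'n) \<times> real \<Rightarrow> 'e" and v z
    by (rule dd_chain[OF smooth_differentiable[OF \<Psi>(3) that(2)] smooth_differentiable[OF that(1)]])
      (use that \<Psi>(4) in auto)
  have \<Psi>dir: "dd (w, 0) \<Psi> z = (\<Sum>i\<in>UNIV. w $ i *\<^sub>R P z $ i, 0)" if "z \<in> S'" for w z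
  proof -
    from linear_expand[OF dd_dir_linear_fst[OF smooth_differentiable[OF \<Psi>(3) that]], of w] show ?thesis using \<Psi>(5) that
      by (simp add: prod_eq_iff fst_sum snd_sum)
  qed
  have hhN: "N.hh w z = hh (\<Sum>i\<in>UNIV. w $ i *\<^sub>R P z $ i) (\<Psi> z)"
    and ggN: "N.gg w z = gg (\<Sum>i\<in>UNIV. w $ i *\<^sub>R P z $ i) (\<Psi> z)" if "z \<in> S'" for w z
    using that by (simp_all add: N.hh_def N.gg_def hh_def gg_def ch smF sm\<nu> \<Psi>dir)
  define a where "a z = \<alpha> (snd z)" for z :: "(real^'n) \<times> real"
  define b where "b z = \<beta> (snd z)" for z :: "(real^'n) \<times> real"
  have smab: "smooth_on S' a" "smooth_on S' b"
    unfolding a_def[abs_def] b_def[abs_def]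
    by (rule smooth_on_compose[OF N.S open_UNIV _ _ smooth_on_snd[OF N.S]], use sm in auto)+
  have dsnd: "dd v snd z = snd v" for v z :: "(real^'n) \<times> real"
    by (rule dd_eqI[OF bounded_linear_imp_has_derivative[OF bounded_linear_snd]])
  have dab: "dd v (\<lambda>z. f (snd z)) z = dd (snd v) f (snd z)" if "smooth_on UNIV f" for v z :: "(real^'n) \<times> real" and f :: "real \<Rightarrow> real"
    using dd_chain[of snd z f v] smooth_differentiable[OF that] dsnd
    by (simp add: bounded_linear_imp_differentiable[OF bounded_linear_snd])
  have xab: "pd i a z = 0" "pd i b z = 0" for i z
    unfolding a_def[abs_def] b_def[abs_def] using dab[OF sm(1)] dab[OF sm(2)] linear_0[OF dd_dir_linear[OF smooth_differentiable[OF sm(1)]]]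
      linear_0[OF dd_dir_linear[OF smooth_differentiable[OF sm(2)]]] by simp_all
  have tab: "dd tdir a ?z = \<alpha>'" "dd tdir b ?z = \<beta>'"
    unfolding a_def[abs_def] b_def[abs_def] dab[OF sm(1)] dab[OF sm(2)]
    using dd_eqI[OF d(1)[unfolded has_field_derivative_def]] dd_eqI[OF d(2)[unfolded has_field_derivative_def]] by simp_all
  define \<theta> where "\<theta> = a ?z * H (\<Psi> ?z) - b ?z"
  have \<theta>: "\<theta> = \<alpha> t0 * H (x0, t0) - \<beta> t0" by (simp add: \<theta>_def a_def b_def \<Psi>(1))
  have posN: "(a z * H (\<Psi> z) - b z) * N.gg w z \<le> N.hh w z" if "z \<in> S'" "s0 \<le> snd z" "snd z \<le> t0" for w z
  proof -
    have e: "(fst (\<Psi> z), snd z) = \<Psi> z" using spec[OF \<Psi>(2), of z] by (simp add: prod_eq_iff)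
    have "\<Psi> z \<in> S" using that \<Psi>(4) by blast
    then show ?thesis
      using pos[of "fst (\<Psi> z)" "snd z" "\<Sum>i\<in>UNIV. w $ i *\<^sub>R P z $ i"] that(2,3)
      unfolding hhN[OF that(1)] ggN[OF that(1)] a_def b_def e by simp
  qed
  have Pm: "(\<Sum>i\<in>UNIV. axis m 1 $ i *\<^sub>R P ?z $ i) = v"
    using \<Psi>(6) by (simp add: axis_def if_distrib[of "\<lambda>x. x *\<^sub>R _"] cong: if_cong)
  have hmm: "N.h m m ?z = \<theta>"
    using hhN[OF N.z0, of "axis m 1"] unfolding N.hh_axis Pm by (simp add: \<Psi>(1) eq \<theta>)
  \<comment> \<open>A null vector of a nonnegative form lies in its kernel: along
    \<open>axis m 1 + s *\<^sub>R axis j 1\<close> the linear coefficient in \<open>s\<close> must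
    vanish. So \<open>m\<close> is a principal direction with curvature \<theta>, as
    \<open>evolution\<close> requires.\<close>
  have m: "N.h m j ?z = (if j = m then \<theta> else 0)" for j
  proof (cases "j = m")
    case False
    have "N.h m j ?z = 0"
    proof (rule quadratic_nonneg_linear_coeff)
      fix s
      show "2 * s * N.h m j ?z + s\<^sup>2 * (N.h j j ?z - \<theta>) \<ge> 0"
        using posN[OF N.z0, of "1 *\<^sub>R axis m 1 + s *\<^sub>R axis j 1"] False s0
        unfolding N.hh_two[OF N.z0 False[symmetric]] \<theta>_def[symmetric]
        by (simp add: N.g0 hmm algebra_simps)
    qed
    then show ?thesis using False by simp
  qed (simp add: hmm)
  define \<phi> where "\<phi> = (\<lambda>z. N.h m m z - (a z * H (\<Psi> z) - b z) * N.g m m z)"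
  have sm\<phi>: "smooth_on S' \<phi>"
    unfolding \<phi>_def by (intro smooth_on_diff smooth_on_mult N.S N.smh N.smg N.smH smab)
  have \<phi>0: "\<phi> ?z = 0" by (simp add: \<phi>_def hmm N.g0 \<theta>_def)
  have \<phi>pos: "\<phi> z \<ge> 0" if "z \<in> S'" "s0 \<le> snd z" "snd z \<le> t0" for z
    using posN[OF that, of "axis m 1"] by (simp add: \<phi>_def N.hh_axis)
  have "pd k (pd k \<phi>) ?z \<ge> 0" for k
    by (rule dd_second_derivative_test[OF N.S sm\<phi> N.z0]) (use \<phi>0 \<phi>pos s0 in auto)
  then have "(\<Sum>k\<in>UNIV. pd k (pd k \<phi>) ?z) \<ge> 0" by (intro sum_nonneg) auto
  moreover have "dd tdir \<phi> ?z \<le> 0"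
    by (rule dd_left_derivative_test[OF N.S sm\<phi> N.z0, of "t0 - s0"]) (use \<phi>0 \<phi>pos s0 in auto)
  ultimately have "(N.A2 - CARD('n)) * \<theta> + 2 * H (\<Psi> ?z) - \<alpha>' * H (\<Psi> ?z)
      - a ?z * (N.A2 + CARD('n)) * H (\<Psi> ?z) + \<beta>' \<le> 0"
    using N.evolution[OF smab xab m \<theta>_def] unfolding \<phi>_def[symmetric] tab by linarith
  moreover have "N.A2 \<le> (H (\<Psi> ?z))\<^sup>2"
    by (rule N.A2_le) (simp add: hhN[OF N.z0] \<Psi>(1) convex)
  ultimately show ?thesis unfolding \<Psi>(1) \<theta> a_def by auto
qed

section \<open>Charts\<close>

lemma is_chart_props:
  assumes "is_chart M c"
  shows "open (snd c ` fst c)" "fst c \<subseteq> topspace M" "inj_on (snd c) (fst c)"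
    "continuous_map (subtopology M (fst c)) (top_of_set (snd c ` fst c)) (snd c)"
    "\<And>V. openin M V \<Longrightarrow> V \<subseteq> fst c \<Longrightarrow> open (snd c ` V)"
proof -
  have o: "openin M (fst c)" and U: "open (snd c ` fst c)" and
    hm: "homeomorphic_map (subtopology M (fst c)) (top_of_set (snd c ` fst c)) (snd c)"
    using assms by (auto simp: is_chart_def)
  show "open (snd c ` fst c)" by (rule U)
  show sub: "fst c \<subseteq> topspace M" using o openin_subset by blast
  then show "inj_on (snd c) (fst c)"
    using homeomorphic_imp_injective_map[OF hm] by (simp add: Int_absorb1)
  show "continuous_map (subtopology M (fst c)) (top_of_set (snd c ` fst c)) (snd c)"
    by (rule homeomorphic_imp_continuous_map[OF hm])
  fix V assume V: "openin M V" "V \<subseteq> fst c"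
  then have "openin (subtopology M (fst c)) V" using openin_open_subtopology[OF o] by blast
  then have "openin (top_of_set (snd c ` fst c)) (snd c ` V)"
    using homeomorphic_imp_open_map[OF hm] unfolding open_map_def by blast
  then show "open (snd c ` V)" using U openin_open_trans by blast
qed

lemma chart_inv_left: "is_chart M c \<Longrightarrow> p \<in> fst c \<Longrightarrow> chart_inv c (snd c p) = p"
  unfolding chart_inv_def using is_chart_props(3) inv_into_f_f by metis

lemma chart_inv_right: "x \<in> snd c ` fst c \<Longrightarrow> snd c (chart_inv c x) = x"
  unfolding chart_inv_def by (rule f_inv_into_f)

lemma chart_inv_into: "x \<in> snd c ` fst c \<Longrightarrow> chart_inv c x \<in> fst c"
  unfolding chart_inv_def by (rule inv_into_into)

lemma chart_deriv_dd: "chart_deriv c f p v = dd v (f \<circ> chart_inv c) (snd c p)"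
  by (simp add: chart_deriv_def dd_def)

text \<open>\<open>J\<close> is the differential of the transition map. One \<open>J\<close> serves
  all \<open>f\<close>, so \<open>F\<close> and \<nu> can be moved to another chart
  together.\<close>

lemma chart_deriv_change:
  fixes \<A> :: "('p, 'n::finite) chart set"
  assumes at: "smooth_atlas M \<A>" "c \<in> \<A>" "d \<in> \<A>" "p \<in> fst c" "p \<in> fst d"
  shows "\<exists>J. \<forall>f :: 'p \<Rightarrow> 'e::real_normed_vector. f \<circ> chart_inv d differentiable at (snd d p) \<longrightarrow>
    (\<forall>v. chart_deriv c f p v = chart_deriv d f p (J v))"
proof -
  have c: "is_chart M c" and d: "is_chart M d" and
    sm: "smooth_on (snd c ` (fst c \<inter> fst d)) (snd d \<circ> chart_inv c)"
    using at by (auto simp: smooth_atlas_def)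
  let ?O = "snd c ` (fst c \<inter> fst d)"
  let ?g = "snd d \<circ> chart_inv c"
  have O: "open ?O"
    using is_chart_props(5)[OF c, of "fst c \<inter> fst d"] c d by (auto simp: is_chart_def)
  have p: "snd c p \<in> ?O" using at by blast
  have gp: "?g (snd c p) = snd d p" using chart_inv_left[OF c at(4)] by simp
  have "chart_deriv c f p v = chart_deriv d f p (dd v ?g (snd c p))"
    if "f \<circ> chart_inv d differentiable at (snd d p)" for f :: "'p \<Rightarrow> 'e" and v
  proof -
    have "chart_deriv c f p v = dd v (\<lambda>x. (f \<circ> chart_inv d) (?g x)) (snd c p)"
      unfolding chart_deriv_dd
    proof (rule dd_cong_open[OF O p])
      fix x assume "x \<in> ?O"
      then obtain q where "q \<in> fst c" "q \<in> fst d" "x = snd c q" by blast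
      then show "(f \<circ> chart_inv c) x = (f \<circ> chart_inv d) (?g x)"
        using chart_inv_left[OF c] chart_inv_left[OF d] by simp
    qed
    also have "\<dots> = dd (dd v ?g (snd c p)) (f \<circ> chart_inv d) (?g (snd c p))"
      by (rule dd_chain[OF smooth_differentiable[OF sm p]]) (use that gp in \<open>simp add: o_def\<close>)
    finally show ?thesis by (simp add: chart_deriv_dd chart_inv_left[OF c at(4)])
  qed
  then show ?thesis by (intro exI[of _ "\<lambda>v. dd v ?g (snd c p)"]) simp
qed

lemma matrix_inv_right:
  fixes A :: "real^'n^'n"
  assumes "invertible A"
  shows "A ** matrix_inv A = mat 1"
  using someI_ex[OF assms[unfolded invertible_def]] by (simp add: matrix_inv_def)

lemma smooth_on_exp: "smooth_on UNIV (\<lambda>t::real. exp (a * t))"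
  unfolding smooth_on_def
proof
  fix k
  show "Ck_on UNIV (\<lambda>t::real. exp (a * t)) k"
  proof (induction k)
    case 0
    then show ?case by (simp add: continuous_intros)
  next
    case (Suc k)
    have d: "((\<lambda>t::real. exp (a * t)) has_derivative (\<lambda>v. (a * v) * exp (a * t))) (at t)" for t
      by (auto intro!: derivative_eq_intros)
    have "dd v (\<lambda>t::real. exp (a * t)) = (\<lambda>t. (a * v) * exp (a * t))" for v
      using dd_eqI[OF d] by blast
    then show ?case
      using d Ck_on_linear[OF open_UNIV bounded_linear_mult_right Suc.IH]
      unfolding Ck_on_Suc_dd by (auto simp: differentiable_def)
  qed
qed

lemma not_in_span_orthogonal:
  assumes "x \<noteq> 0" "\<And>a. a \<in> A \<Longrightarrow> x \<bullet> a = 0"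
  shows "x \<notin> span A"
  using assms orthogonal_to_span[of x A x] by (auto simp: orthogonal_def)

text \<open>A nonzero part of \<open>u\<close> orthogonal to the range of \<open>D\<close> would,
  together with \<nu>, \<open>y\<close> and that range, span \<open>n + 3\<close> dimensions. It is
  used to recognize tangent vectors by their vanishing components along the two normals.\<close>

lemma mem_range_of_orthogonal_pair:
  fixes D :: "real^'n::finite \<Rightarrow> 'e::euclidean_space"
  assumes D: "linear D" "inj D" and dim: "DIM('e) = CARD('n) + 2"
    and \<nu>: "\<And>v. \<nu> \<bullet> D v = 0" "\<And>v. y \<bullet> D v = 0" "\<nu> \<bullet> \<nu> = 1" "y \<bullet> y = 1" "\<nu> \<bullet> y = 0"
    and u: "u \<bullet> \<nu> = 0" "u \<bullet> y = 0"
  shows "\<exists>v. u = D v"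
proof -
  obtain a b where ab: "a \<in> span (range D)" "\<And>w. w \<in> span (range D) \<Longrightarrow> orthogonal b w" "u = a + b"
    using orthogonal_subspace_decomp_exists[of "range D" u] by metis
  have sp: "span (range D) = range D"
    by (simp add: D linear_subspace_image[OF D(1) subspace_UNIV])
  then obtain v where v: "a = D v" using ab by blast
  have "b = 0"
  proof (rule ccontr)
    assume "b \<noteq> 0"
    have bD: "b \<bullet> D w = 0" for w using ab(2)[of "D w"] sp by (auto simp: orthogonal_def)
    have "b = u - D v" using ab v by simp
    then have b\<nu>: "\<nu> \<bullet> b = 0" "y \<bullet> b = 0"
      using u \<nu> by (auto simp: inner_diff_right inner_commute)
    have 1: "b \<notin> span (range D)"
      by (rule not_in_span_orthogonal) (use \<open>b \<noteq> 0\<close> bD in auto)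
    have 2: "\<nu> \<notin> span (insert b (range D))"
      by (rule not_in_span_orthogonal) (use \<nu> b\<nu> in auto)
    have 3: "y \<notin> span (insert \<nu> (insert b (range D)))"
      by (rule not_in_span_orthogonal) (use \<nu> b\<nu> in \<open>auto simp: inner_commute\<close>)
    have "dim (range D) = CARD('n)"
      using dim_image_eq[OF D(1), of UNIV] D(2) by simp
    then have "dim (insert y (insert \<nu> (insert b (range D)))) = CARD('n) + 3"
      using 1 2 3 by (simp add: dim_insert)
    then show False using dim_subset_UNIV[of "insert y (insert \<nu> (insert b (range D)))"] dim by simp
  qed
  then show ?thesis using v ab by auto
qed

lemma open_ancient_interval: "open (ancient_interval T)"
proof (cases T)
  case (real r)
  then have "ancient_interval T = {..<r}" by (auto simp: ancient_interval_def)
  then show ?thesis by simp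
qed (auto simp: ancient_interval_def)

lemma ancient_interval_downward: "t \<in> ancient_interval T \<Longrightarrow> s \<le> t \<Longrightarrow> s \<in> ancient_interval T"
  unfolding ancient_interval_def using le_less_trans[of "ereal s" "ereal t" T] by simp

section \<open>The flow on the closed manifold, read in charts\<close>

locale mcf =
  fixes M :: "'p topology" and \<A> :: "('p, 'n::finite) chart set" and T :: ereal
    and F \<nu> :: "'p \<Rightarrow> real \<Rightarrow> 'e::euclidean_space"
  assumes manifold: "closed_connected_manifold M \<A>"
    and flow: "ancient_embedded_mcf M \<A> T F \<nu>"
    and dimE: "DIM('e) = CARD('n) + 2"
begin

abbreviation "I \<equiv> ancient_interval T"
definition "U c = snd c ` fst c" for c :: "('p, 'n) chart"
definition "G c z = F (chart_inv c (fst z)) (snd z)" for c :: "('p, 'n) chart"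
definition "N c z = \<nu> (chart_inv c (fst z)) (snd z)" for c :: "('p, 'n) chart"
text \<open>The mean curvature taken from the velocity, which refers to no chart; \<open>mc\<close>
  identifies it with \<open>mean_curvature c\<close> in every chart.\<close>

definition "Hs p t = - (vector_derivative (F p) (at t) \<bullet> \<nu> p t)"
definition "HG c z = Hs (chart_inv c (fst z)) (snd z)" for c :: "('p, 'n) chart"

lemma atlas: "smooth_atlas M \<A>" using manifold by (simp add: closed_connected_manifold_def)
lemma chart: "c \<in> \<A> \<Longrightarrow> is_chart M c" using atlas by (simp add: smooth_atlas_def)
lemma cover: "p \<in> topspace M \<Longrightarrow> \<exists>c\<in>\<A>. p \<in> fst c" using atlas by (auto simp: smooth_atlas_def)
lemma chart_sub: "c \<in> \<A> \<Longrightarrow> p \<in> fst c \<Longrightarrow> p \<in> topspace M" using is_chart_props(2)[OF chart] by blast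
lemma openU: "c \<in> \<A> \<Longrightarrow> open (U c)" unfolding U_def using is_chart_props(1)[OF chart] .
lemma openS: "c \<in> \<A> \<Longrightarrow> open (U c \<times> I)" by (intro open_Times openU open_ancient_interval)
lemma inU: "p \<in> fst c \<Longrightarrow> snd c p \<in> U c" by (simp add: U_def)
lemma Uinv: "x \<in> U c \<Longrightarrow> chart_inv c x \<in> fst c" unfolding U_def by (rule chart_inv_into)
lemma Uright: "x \<in> U c \<Longrightarrow> snd c (chart_inv c x) = x" unfolding U_def by (rule chart_inv_right)
lemma Uleft: "c \<in> \<A> \<Longrightarrow> p \<in> fst c \<Longrightarrow> chart_inv c (snd c p) = p" by (rule chart_inv_left[OF chart])

lemma smG: "c \<in> \<A> \<Longrightarrow> smooth_on (U c \<times> I) (G c)"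
  and smN: "c \<in> \<A> \<Longrightarrow> smooth_on (U c \<times> I) (N c)"
  using flow unfolding ancient_embedded_mcf_def smooth_family_def U_def G_def[abs_def] N_def[abs_def]
  by (simp_all add: case_prod_beta')

lemma dd_slice_x:
  assumes "f differentiable at (x, t)"
  shows "dd v (\<lambda>x. f (x, t)) x = dd (v, 0) f (x, t)" "(\<lambda>x. f (x, t)) differentiable at x"
proof -
  have d: "((\<lambda>x. (x, t)) has_derivative (\<lambda>v. (v, 0))) (at x)"
    by (auto intro!: derivative_eq_intros)
  show "dd v (\<lambda>x. f (x, t)) x = dd (v, 0) f (x, t)"
    using dd_chain[of "\<lambda>x. (x, t)" x f v] assms dd_eqI[OF d] d by (auto simp: differentiable_def)
  show "(\<lambda>x. f (x, t)) differentiable at x"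
    using differentiable_chain_at[of "\<lambda>x. (x, t)" x f] d assms by (auto simp: differentiable_def o_def)
qed

lemma slice_G: "(\<lambda>p. F p t) \<circ> chart_inv c = (\<lambda>x. G c (x, t))"
  and slice_N: "(\<lambda>p. \<nu> p t) \<circ> chart_inv c = (\<lambda>x. N c (x, t))"
  by (simp_all add: G_def N_def fun_eq_iff)

context
  fixes c p t assumes c: "c \<in> \<A>" "p \<in> fst c" and t: "t \<in> I"
begin

lemma inS: "(snd c p, t) \<in> U c \<times> I" using c t inU by blast

lemma cd_F: "chart_deriv c (\<lambda>p. F p t) p v = dd (v, 0) (G c) (snd c p, t)"
  unfolding chart_deriv_dd slice_G by (rule dd_slice_x(1)[OF smooth_differentiable[OF smG[OF c(1)] inS]])

lemma cd_\<nu>: "chart_deriv c (\<lambda>p. \<nu> p t) p v = dd (v, 0) (N c) (snd c p, t)"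
  unfolding chart_deriv_dd slice_N by (rule dd_slice_x(1)[OF smooth_differentiable[OF smN[OF c(1)] inS]])

lemma embed: "smooth_embedding_into_sphere M \<A> (\<lambda>p. F p t)"
  and outer: "outer_unit_normal M \<A> (\<lambda>p. F p t) (\<lambda>p. \<nu> p t)"
  and vel: "(F p has_vector_derivative - (mean_curvature c (\<lambda>q. F q t) (\<lambda>q. \<nu> q t) p *\<^sub>R \<nu> p t)) (at t)"
  using flow t c unfolding ancient_embedded_mcf_def by auto

lemma pF: "F p t \<bullet> F p t = 1"
  using embed chart_sub[OF c] by (auto simp: smooth_embedding_into_sphere_def norm_eq_1)

lemma p\<nu>: "\<nu> p t \<bullet> \<nu> p t = 1" "\<nu> p t \<bullet> F p t = 0" "\<nu> p t \<bullet> dd (v, 0) (G c) (snd c p, t) = 0"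
  using outer c unfolding outer_unit_normal_def cd_F[symmetric] by (auto simp: norm_eq_1)

lemma inj_dF: "inj (\<lambda>v. dd (v, 0) (G c) (snd c p, t))"
  using embed c unfolding smooth_embedding_into_sphere_def cd_F[symmetric, abs_def]
  by (auto simp: cd_F[symmetric, abs_def])

lemma mc: "mean_curvature c (\<lambda>q. F q t) (\<lambda>q. \<nu> q t) p = Hs p t"
  unfolding Hs_def vector_derivative_at[OF vel] by (simp add: p\<nu>(1))

lemma F_t: "(F p has_vector_derivative - (Hs p t *\<^sub>R \<nu> p t)) (at t)"
  using vel unfolding mc .

end

text \<open>The spatial derivatives of \<nu> are orthogonal to \<nu> and \<open>F\<close>, hence
  tangent, which yields the Weingarten matrix \<open>A\<close>. Then
  \<open>H = tr (g^-1 (A g)) = tr A\<close>.\<close>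

lemma chart_flow:
  assumes c: "c \<in> \<A>"
  shows "coordinate_flow (U c \<times> I) (G c) (N c) (HG c)"
proof
  show "open (U c \<times> I)" by (rule openS[OF c])
  show "smooth_on (U c \<times> I) (G c)" "smooth_on (U c \<times> I) (N c)" by (rule smG[OF c] smN[OF c])+
  show "DIM('e) = CARD('n) + 2" by (rule dimE)
  fix z assume "z \<in> U c \<times> I"
  then obtain x t where z: "z = (x, t)" and xt: "x \<in> U c" "t \<in> I" by blast
  define p where "p = chart_inv c x"
  have p: "p \<in> fst c" "snd c p = x" using Uinv Uright xt p_def by auto
  have zS: "z \<in> U c \<times> I" using z xt by simp
  note b = c p(1) xt(2)
  have vals: "G c z = F p t" "N c z = \<nu> p t" "HG c z = Hs p t" by (simp_all add: G_def N_def HG_def z p_def)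
  show "G c z \<bullet> G c z = 1" "N c z \<bullet> N c z = 1" "N c z \<bullet> G c z = 0"
    unfolding vals using pF[OF b] p\<nu>[OF b] by auto
  show \<nu>0: "N c z \<bullet> pd i (G c) z = 0" for i
    unfolding vals using p\<nu>(3)[OF b] p z by simp
  have "((\<lambda>s. G c ((x, 0) + s *\<^sub>R tdir)) has_vector_derivative dd tdir (G c) ((x, 0) + t *\<^sub>R tdir)) (at t)"
    by (rule dd_line) (use smooth_differentiable[OF smG[OF c] zS] z in simp)
  then have "(F p has_vector_derivative dd tdir (G c) z) (at t)"
    by (simp add: G_def p_def z)
  then show "dd tdir (G c) z = - (HG c z *\<^sub>R N c z)"
    unfolding vals using F_t[OF b] vector_derivative_unique_at by blast
  let ?D = "\<lambda>v. dd (v, 0) (G c) z"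
  have inj: "inj ?D" using inj_dF[OF b] p z by simp
  have lin: "linear ?D" by (rule dd_dir_linear_fst[OF smooth_differentiable[OF smG[OF c] zS]])
  let ?g = "\<chi> i j. pd i (G c) z \<bullet> pd j (G c) z"
  have "w = 0" if "?g *v w = 0" for w
  proof -
    have "(?g *v w) $ i = pd i (G c) z \<bullet> ?D w" for i
      unfolding linear_expand[OF lin, of w] by (simp add: matrix_vector_mult_def inner_sum_right mult.commute)
    then have "pd i (G c) z \<bullet> ?D w = 0" for i using that by (simp add: vec_eq_iff)
    then have "?D w \<bullet> ?D w = 0"
      by (subst (1) linear_expand[OF lin]) (simp add: inner_sum_left)
    then show "w = 0" using inj linear_injective_0[OF lin] by simp
  qed
  then show dg: "det ?g \<noteq> 0"
    by (metis matrix_left_invertible_ker invertible_left_inverse invertible_det_nz)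
  have "\<exists>v. pd i (N c) z = ?D v" for i
  proof (rule mem_range_of_orthogonal_pair[OF lin inj dimE, of "\<nu> p t" "F p t"])
    show "\<nu> p t \<bullet> dd (v, 0) (G c) z = 0" for v using p\<nu>(3)[OF b] p z by simp
    show "F p t \<bullet> dd (v, 0) (G c) z = 0" for v
      using dd_inner_const[OF openS[OF c] smG[OF c] smG[OF c] zS, of 1 "(v, 0)"] pF[OF c _ ] vals
      by (auto simp: G_def inner_commute Uinv c)
    show "\<nu> p t \<bullet> \<nu> p t = 1" "F p t \<bullet> F p t = 1" "\<nu> p t \<bullet> F p t = 0" using pF[OF b] p\<nu>[OF b] by auto
    show "pd i (N c) z \<bullet> \<nu> p t = 0"
      using dd_inner_const[OF openS[OF c] smN[OF c] smN[OF c] zS, of 1 "xdir i"] p\<nu>(1)[OF c] vals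
      by (auto simp: N_def inner_commute Uinv c)
    show "pd i (N c) z \<bullet> F p t = 0"
      using dd_inner_const[OF openS[OF c] smN[OF c] smG[OF c] zS, of 0 "xdir i"] p\<nu>(2)[OF c] vals \<nu>0[of i]
      by (auto simp: N_def G_def inner_commute Uinv c)
  qed
  then obtain B where B: "\<And>i. pd i (N c) z = ?D (B i)" by metis
  define A :: "real^'n^'n" where "A = (\<chi> i. B i)"
  have A: "pd i (N c) z = (\<Sum>j\<in>UNIV. A $ i $ j *\<^sub>R pd j (G c) z)" for i
    unfolding B A_def using linear_expand[OF lin, of "B i"] by simp
  have gm: "form_matrix (induced_metric c (\<lambda>q. F q t) p) = ?g"
    by (simp add: form_matrix_def induced_metric_def cd_F[OF b] p z)
  have "F p t \<bullet> pd j (G c) z = 0" for j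
    using dd_inner_const[OF openS[OF c] smG[OF c] smG[OF c] zS, of 1 "xdir j"] pF[OF c _ ] vals
    by (auto simp: G_def inner_commute Uinv c)
  \<comment> \<open>The correction in \<open>sphere_cov_deriv\<close> is a multiple of
    \<open>F\<close> and thus orthogonal to all tangent vectors.\<close>
  then have "form_matrix (second_fundamental_form c (\<lambda>q. F q t) (\<lambda>q. \<nu> q t) p) = A ** ?g"
    by (simp add: form_matrix_def second_fundamental_form_def sphere_cov_deriv_def cd_F[OF b] cd_\<nu>[OF b] p z[symmetric]
        inner_diff_left vec_eq_iff matrix_matrix_mult_def A inner_sum_left)
  then have "HG c z = trace (matrix_inv ?g ** (A ** ?g))"
    unfolding vals using mc[OF b] gm by (simp add: mean_curvature_def)
  also have "\<dots> = trace (A ** (?g ** matrix_inv ?g))"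
    by (subst trace_mul_sym) (simp add: matrix_mul_assoc)
  also have "?g ** matrix_inv ?g = mat 1"
    using dg by (simp add: invertible_det_nz[symmetric] matrix_inv_right)
  finally show "\<exists>A::real^'n^'n. (\<forall>i. pd i (N c) z = (\<Sum>j\<in>UNIV. A $ i $ j *\<^sub>R pd j (G c) z)) \<and> HG c z = trace A"
    using A by auto
qed

definition "hc c v z = dd (v, 0) (N c) z \<bullet> dd (v, 0) (G c) z" for c :: "('p, 'n) chart"
definition "gc c v z = dd (v, 0) (G c) z \<bullet> dd (v, 0) (G c) z" for c :: "('p, 'n) chart"

lemma hh_hc:
  assumes "c \<in> \<A>"
  shows "coordinate_flow.hh (G c) (N c) v z = hc c v z" "coordinate_flow.gg (G c) v z = gc c v z"
proof -
  interpret C: coordinate_flow "U c \<times> I" "G c" "N c" "HG c" by (rule chart_flow[OF assms])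
  show "C.hh v z = hc c v z" "C.gg v z = gc c v z" by (simp_all add: C.hh_def C.gg_def hc_def gc_def)
qed

lemma F_dG:
  assumes c: "c \<in> \<A>" "p \<in> fst c" and t: "t \<in> I"
  shows "F p t \<bullet> dd (v, 0) (G c) (snd c p, t) = 0"
proof -
  interpret C: coordinate_flow "U c \<times> I" "G c" "N c" "HG c" by (rule chart_flow[OF c(1)])
  show ?thesis using C.F_dF[OF inS[OF c t], of "(v, 0)"] by (simp add: G_def Uleft[OF c])
qed

lemma sff:
  assumes c: "c \<in> \<A>" "p \<in> fst c" and t: "t \<in> I"
  shows "second_fundamental_form c (\<lambda>q. F q t) (\<lambda>q. \<nu> q t) p v v = hc c v (snd c p, t)"
  by (simp add: second_fundamental_form_def sphere_cov_deriv_def cd_F[OF assms] cd_\<nu>[OF assms]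
      inner_diff_left F_dG[OF assms] hc_def)

lemma gc_pos:
  assumes c: "c \<in> \<A>" and z: "z \<in> U c \<times> I" and v: "v \<noteq> 0"
  shows "gc c v z > 0"
proof -
  interpret C: coordinate_flow "U c \<times> I" "G c" "N c" "HG c" by (rule chart_flow[OF c])
  show ?thesis using C.dirF_inj[OF z] v by (auto simp: gc_def)
qed

lemma hc_scale:
  assumes c: "c \<in> \<A>" and z: "z \<in> U c \<times> I"
  shows "hc c (a *\<^sub>R v) z = a\<^sup>2 * hc c v z" "gc c (a *\<^sub>R v) z = a\<^sup>2 * gc c v z"
proof -
  interpret C: coordinate_flow "U c \<times> I" "G c" "N c" "HG c" by (rule chart_flow[OF c])
  show "hc c (a *\<^sub>R v) z = a\<^sup>2 * hc c v z" "gc c (a *\<^sub>R v) z = a\<^sup>2 * gc c v z"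
    using linear_cmul[OF C.dirF[OF z], of a v] linear_cmul[OF C.dir\<nu>[OF z], of a v]
    by (simp_all add: hc_def gc_def power2_eq_square)
qed

text \<open>An inequality between the two forms is independent of the chart. It is needed because
  \<open>minimum_attained\<close> controls a point in one chart of its own choice only.\<close>

lemma form_le_change:
  assumes c: "c \<in> \<A>" "p \<in> fst c" and d: "d \<in> \<A>" "p \<in> fst d" and t: "t \<in> I"
    and le: "\<And>v. k * gc d v (snd d p, t) \<le> hc d v (snd d p, t)"
  shows "k * gc c v (snd c p, t) \<le> hc c v (snd c p, t)"
proof -
  obtain J where J: "\<forall>f :: 'p \<Rightarrow> 'e. f \<circ> chart_inv d differentiable at (snd d p) \<longrightarrow>
    (\<forall>v. chart_deriv c f p v = chart_deriv d f p (J v))"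
    using chart_deriv_change[OF atlas c(1) d(1) c(2) d(2)] by blast
  have "(\<lambda>p. F p t) \<circ> chart_inv d differentiable at (snd d p)"
    "(\<lambda>p. \<nu> p t) \<circ> chart_inv d differentiable at (snd d p)"
    unfolding slice_G slice_N
    by (intro dd_slice_x(2) smooth_differentiable[OF smG[OF d(1)]] smooth_differentiable[OF smN[OF d(1)]]
        inS[OF d t])+
  then have "chart_deriv c (\<lambda>p. F p t) p v = chart_deriv d (\<lambda>p. F p t) p (J v)"
    "chart_deriv c (\<lambda>p. \<nu> p t) p v = chart_deriv d (\<lambda>p. \<nu> p t) p (J v)" using J by blast+
  then show ?thesis using le[of "J v"]
    by (simp add: cd_F[OF c t] cd_F[OF d t] cd_\<nu>[OF c t] cd_\<nu>[OF d t] hc_def gc_def)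
qed

lemma openin_chart_preimage:
  assumes c: "c \<in> \<A>" and V: "open V" "V \<subseteq> U c"
  shows "openin M {q \<in> fst c. snd c q \<in> V}"
proof -
  have "openin (top_of_set (U c)) V" using V by (simp add: open_subset)
  from openin_continuous_map_preimage[OF is_chart_props(4)[OF chart[OF c]] this[unfolded U_def]]
  have "openin (subtopology M (fst c)) {q \<in> fst c. snd c q \<in> V}"
    using chart_sub[OF c] by (simp add: Int_absorb1 subsetI)
  then show ?thesis using openin_trans_full chart[OF c] unfolding is_chart_def by blast
qed

text \<open>Open coordinate balls cover the manifold, and the closed balls of the same radius are
  the compact sets.\<close>

lemma compact_chart_cover:
  "\<exists>Q. finite Q \<and> (\<forall>(c, K)\<in>Q. c \<in> \<A> \<and> compact K \<and> K \<subseteq> U c) \<and>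
    (\<forall>p\<in>topspace M. \<exists>(c, K)\<in>Q. p \<in> fst c \<and> snd c p \<in> K)"
proof -
  define D where "D = {(c, x, r). c \<in> \<A> \<and> 0 < r \<and> cball x r \<subseteq> U c}"
  define O' where "O' = (\<lambda>(c :: ('p, 'n) chart, x, r). {q \<in> fst c. snd c q \<in> ball x r})"
  have op: "openin M V" if V: "V \<in> O' ` D" for V
  proof -
    obtain d where d: "d \<in> D" "V = O' d" using V by blast
    obtain c x r where "d = (c, x, r)" by (rule prod_cases3)
    then have cx: "c \<in> \<A>" "cball x r \<subseteq> U c" "V = {q \<in> fst c. snd c q \<in> ball x r}"
      using d by (simp_all add: D_def O'_def)
    have "ball x r \<subseteq> U c" using cx(2) ball_subset_cball by blast
    then show ?thesis unfolding cx(3) by (intro openin_chart_preimage cx open_ball)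
  qed
  have cov: "topspace M \<subseteq> \<Union>(O' ` D)"
  proof
    fix p assume "p \<in> topspace M"
    then obtain c where c: "c \<in> \<A>" "p \<in> fst c" using cover by blast
    obtain r where "r > 0" "cball (snd c p) r \<subseteq> U c"
      using openU[OF c(1)] inU[OF c(2)] open_contains_cball by blast
    then show "p \<in> \<Union>(O' ` D)"
      using c by (intro UnionI[of "O' (c, snd c p, r)"] imageI) (auto simp: D_def O'_def)
  qed
  have "compact_space M" using manifold by (simp add: closed_connected_manifold_def)
  then obtain \<F> where \<F>: "finite \<F>" "\<F> \<subseteq> O' ` D" "topspace M \<subseteq> \<Union>\<F>"
    using op cov unfolding compact_space_alt by meson
  then obtain D' where D': "D' \<subseteq> D" "finite D'" "\<F> = O' ` D'" by (meson finite_subset_image)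
  define Q where "Q = (\<lambda>(c, x, r). (c, cball x r)) ` D'"
  have "\<exists>(c, K)\<in>Q. p \<in> fst c \<and> snd c p \<in> K" if p: "p \<in> topspace M" for p
  proof -
    obtain c x r where "(c, x, r) \<in> D'" "p \<in> O' (c, x, r)" using \<F>(3) p D'(3) by auto
    then show ?thesis unfolding Q_def O'_def by force
  qed
  moreover have "\<forall>(c, K)\<in>Q. c \<in> \<A> \<and> compact K \<and> K \<subseteq> U c" using D' by (auto simp: Q_def D_def)
  moreover have "finite Q" using D' by (simp add: Q_def)
  ultimately show ?thesis by blast
qed

text \<open>The functions \<open>f c\<close> need not agree on overlaps, since unit coordinate
  vectors depend on the chart. The minimum is therefore taken over a finite union of compact
  coordinate pieces, and each point is compared in some chart of the cover.\<close>

lemma minimum_attained: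
  fixes f :: "('p, 'n) chart \<Rightarrow> ((real^'n) \<times> real) \<times> (real^'n) \<Rightarrow> real"
  assumes t: "t0 \<le> t1" "t1 \<in> I"
    and cont: "\<And>c. c \<in> \<A> \<Longrightarrow> continuous_on ((U c \<times> I) \<times> sphere 0 1) (f c)"
  shows "\<exists>c\<in>\<A>. \<exists>x\<in>U c. \<exists>t\<in>{t0..t1}. \<exists>w\<in>sphere 0 1. \<forall>p\<in>topspace M. \<exists>d\<in>\<A>. p \<in> fst d \<and>
    (\<forall>t'\<in>{t0..t1}. \<forall>w'\<in>sphere 0 1. f c ((x, t), w) \<le> f d ((snd d p, t'), w'))"
proof -
  obtain Q where Q: "finite Q" "\<And>c K. (c, K) \<in> Q \<Longrightarrow> c \<in> \<A> \<and> compact K \<and> K \<subseteq> U c"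
    "\<And>p. p \<in> topspace M \<Longrightarrow> \<exists>c K. (c, K) \<in> Q \<and> p \<in> fst c \<and> snd c p \<in> K"
    using compact_chart_cover by fastforce
  have tI: "{t0..t1} \<subseteq> I" using ancient_interval_downward[OF t(2)] by auto
  define X where "X = (\<Union>(c, K)\<in>Q. f c ` ((K \<times> {t0..t1}) \<times> sphere 0 1))"
  have "compact X"
  proof -
    have "compact (f c ` ((K \<times> {t0..t1}) \<times> sphere 0 1))" if "(c, K) \<in> Q" for c K
    proof (rule compact_continuous_image)
      show "continuous_on ((K \<times> {t0..t1}) \<times> sphere 0 1) (f c)"
        by (rule continuous_on_subset[OF cont]) (use Q(2)[OF that] tI in auto)
      show "compact ((K \<times> {t0..t1}) \<times> (sphere 0 1 :: (real^'n) set))"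
        by (intro compact_Times compact_sphere) (use Q(2)[OF that] in auto)
    qed
    then show ?thesis unfolding X_def by (intro compact_UN Q(1)) auto
  qed
  moreover have "X \<noteq> {}"
  proof -
    have "topspace M \<noteq> {}" using manifold unfolding closed_connected_manifold_def by blast
    then obtain p where "p \<in> topspace M" by blast
    then obtain c K where "(c, K) \<in> Q" "snd c p \<in> K" using Q(3) by blast
    moreover have "axis undefined 1 \<in> sphere (0 :: real^'n) 1" by simp
    ultimately show ?thesis unfolding X_def using t(1) by fastforce
  qed
  ultimately obtain m where m: "m \<in> X" "\<And>y. y \<in> X \<Longrightarrow> m \<le> y"
    using compact_attains_inf[of X] by blast
  then obtain c K x t w where c: "(c, K) \<in> Q" "x \<in> K" "t \<in> {t0..t1}" "w \<in> sphere 0 1" "m = f c ((x, t), w)"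
    unfolding X_def by auto
  have "\<exists>d\<in>\<A>. p \<in> fst d \<and> (\<forall>t'\<in>{t0..t1}. \<forall>w'\<in>sphere 0 1. f c ((x, t), w) \<le> f d ((snd d p, t'), w'))"
    if p: "p \<in> topspace M" for p
  proof -
    obtain d L where d: "(d, L) \<in> Q" "p \<in> fst d" "snd d p \<in> L" using Q(3)[OF p] by blast
    have "f c ((x, t), w) \<le> f d ((snd d p, t'), w')" if "t' \<in> {t0..t1}" "w' \<in> sphere 0 1" for t' w'
      unfolding c(5)[symmetric] 
      by (rule m(2), unfold X_def, rule UN_I[OF d(1)]) (use d that in auto)
    then show ?thesis using d Q(2) by blast
  qed
  moreover have "c \<in> \<A>" "x \<in> U c" using Q(2)[OF c(1)] c(2) by auto
  ultimately show ?thesis using c(3,4) by blast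
qed

lemma continuous_form:
  assumes c: "c \<in> \<A>"
  shows "continuous_on ((U c \<times> I) \<times> X) (\<lambda>y. hc c (snd y) (fst y))"
    "continuous_on ((U c \<times> I) \<times> X) (\<lambda>y. gc c (snd y) (fst y))"
proof -
  interpret C: coordinate_flow "U c \<times> I" "G c" "N c" "HG c" by (rule chart_flow[OF c])
  have "continuous_on ((U c \<times> I) \<times> X) (\<lambda>y. \<Sum>i\<in>UNIV. snd y $ i *\<^sub>R pd i f (fst y))"
    if "smooth_on (U c \<times> I) f" for f :: "(real^'n) \<times> real \<Rightarrow> 'e"
    by (intro continuous_intros continuous_on_compose2[OF smooth_on_continuous[OF smooth_on_dd[OF that]]]) auto
  note cont = this[OF C.smF] this[OF C.sm\<nu>]
  have "(\<Sum>i\<in>UNIV. snd y $ i *\<^sub>R pd i (G c) (fst y)) = dd (snd y, 0) (G c) (fst y)"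
    "(\<Sum>i\<in>UNIV. snd y $ i *\<^sub>R pd i (N c) (fst y)) = dd (snd y, 0) (N c) (fst y)"
    if "y \<in> (U c \<times> I) \<times> X" for y
    by (rule linear_expand[OF C.dirF, symmetric] linear_expand[OF C.dir\<nu>, symmetric], use that in auto)+
  note eq = this
  have "continuous_on ((U c \<times> I) \<times> X) (\<lambda>y. dd (snd y, 0) (G c) (fst y))"
    "continuous_on ((U c \<times> I) \<times> X) (\<lambda>y. dd (snd y, 0) (N c) (fst y))"
    using continuous_on_eq[OF cont(1) eq(1)] continuous_on_eq[OF cont(2) eq(2)] by simp_all
  then show "continuous_on ((U c \<times> I) \<times> X) (\<lambda>y. hc c (snd y) (fst y))"
    "continuous_on ((U c \<times> I) \<times> X) (\<lambda>y. gc c (snd y) (fst y))"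
    unfolding hc_def gc_def by (simp_all add: continuous_on_inner)
qed

end

section \<open>The pinching estimate\<close>

locale convex_mcf = mcf M \<A> T F \<nu>
  for M :: "'p topology" and \<A> :: "('p, 'n::finite) chart set" and T :: ereal
    and F \<nu> :: "'p \<Rightarrow> real \<Rightarrow> 'e::euclidean_space" +
  assumes convex: "weakly_convex \<A> T F \<nu>"
begin

lemma hc_nonneg:
  assumes "c \<in> \<A>" "z \<in> U c \<times> I"
  shows "hc c v z \<ge> 0"
proof -
  obtain x t where z: "z = (x, t)" "x \<in> U c" "t \<in> I" using assms(2) by blast
  have "second_fundamental_form c (\<lambda>q. F q t) (\<lambda>q. \<nu> q t) (chart_inv c x) v v \<ge> 0"
    using convex assms(1) z(3) Uinv[OF z(2)] unfolding weakly_convex_def by blast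
  then show ?thesis
    using sff[OF assms(1) Uinv[OF z(2)] z(3)] Uright[OF z(2)] z(1) by simp
qed

text \<open>Minimizing the defect times \<open>exp (- K t)\<close>, where \<open>K\<close> bounds \<open>H\<^sup>2 \<ge> |h|\<^sup>2\<close>, makes the zeroth-order
  term of its evolution equation negative, so a negative minimum contradicts \<open>contact\<close>.\<close>

lemma pinching:
  fixes t0 t1 :: real
  assumes t1: "t0 \<le> t1" "t1 \<in> I" and c: "c \<in> \<A>" "p \<in> fst c"
  shows "(1 - exp (- 2 * CARD('n) * (t1 - t0))) / CARD('n) * Hs p t1 * gc c v (snd c p, t1) \<le> hc c v (snd c p, t1)"
proof -
  define n where "n = real CARD('n)"
  have n: "n > 0" by (simp add: n_def)
  have tI: "t \<in> I" if "t \<le> t1" for t using ancient_interval_downward[OF t1(2) that] .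
  have HG: "HG c (snd c p, t) = Hs p t" if "c \<in> \<A>" "p \<in> fst c" for c p t
    by (simp add: HG_def Uleft[OF that])
  have contH: "continuous_on ((U c \<times> I) \<times> X) (\<lambda>y. HG c (fst y))" if "c \<in> \<A>" for c and X :: "(real^'n) set"
  proof -
    interpret C: coordinate_flow "U c \<times> I" "G c" "N c" "HG c" by (rule chart_flow[OF that])
    show ?thesis
      by (intro continuous_on_compose2[OF smooth_on_continuous[OF C.smH]] continuous_intros) auto
  qed
  \<comment> \<open>Minimizing \<open>- H^2\<close> bounds \<open>H^2\<close> from above on the
    compact time interval; the vector argument is a dummy.\<close>
  define f where "f c y = - (HG c (fst y))\<^sup>2" for c and y :: "((real^'n) \<times> real) \<times> (real^'n)"
  have "continuous_on ((U c \<times> I) \<times> sphere 0 1) (f c)" if "c \<in> \<A>" for c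
    unfolding f_def[abs_def] by (intro continuous_intros contH that)
  from minimum_attained[OF t1 this] obtain K where
    "\<forall>p\<in>topspace M. \<exists>d\<in>\<A>. p \<in> fst d \<and> (\<forall>t'\<in>{t0..t1}. \<forall>w'\<in>sphere 0 1. - K \<le> f d ((snd d p, t'), w'))"
    by (metis minus_minus)
  moreover have "axis undefined 1 \<in> sphere (0 :: real^'n) 1" by simp
  ultimately have K: "(Hs p t)\<^sup>2 \<le> K" if "p \<in> topspace M" "t \<in> {t0..t1}" for p t
    using that HG unfolding f_def by fastforce
  \<comment> \<open>The exponential is split into a constant and \<open>exp (a * t)\<close>, the
    shape of \<open>smooth_on_exp\<close>.\<close>
  define \<eta> where "\<eta> t = (1 - exp (2 * n * t0) * exp ((- 2 * n) * t)) / n" for t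
  \<comment> \<open>Division by \<open>gc\<close> makes the quotient homogeneous of degree 0 in the
    vector, so the unit sphere of coordinate vectors represents all directions.\<close>
  define R where "R c y = exp ((- K) * snd (fst y)) *
      ((hc c (snd y) (fst y) - \<eta> (snd (fst y)) * HG c (fst y) * gc c (snd y) (fst y)) / gc c (snd y) (fst y))"
    for c and y :: "((real^'n) \<times> real) \<times> (real^'n)"
  have "continuous_on ((U c \<times> I) \<times> sphere 0 1) (R c)" if c: "c \<in> \<A>" for c
  proof -
    have "gc c (snd y) (fst y) \<noteq> 0" if "y \<in> (U c \<times> I) \<times> sphere 0 1" for y
      using gc_pos[OF c, of "fst y" "snd y"] that by force
    then show ?thesis
      unfolding R_def[abs_def] \<eta>_def using n
      by (intro continuous_intros contH continuous_form c) auto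
  qed
  from minimum_attained[OF t1 this] obtain c' x t w where
    min: "c' \<in> \<A>" "x \<in> U c'" "t \<in> {t0..t1}" "w \<in> sphere 0 1" and
    le: "\<And>p. p \<in> topspace M \<Longrightarrow> \<exists>d\<in>\<A>. p \<in> fst d \<and>
      (\<forall>t'\<in>{t0..t1}. \<forall>w'\<in>sphere 0 1. R c' ((x, t), w) \<le> R d ((snd d p, t'), w'))"
    by blast
  define \<mu> where "\<mu> = R c' ((x, t), w)"
  \<comment> \<open>Minimality of \<mu> restated as an inequality of forms, in every chart and for
    vectors of every length.\<close>
  have bound: "(\<eta> s * Hs q s + \<mu> * exp (K * s)) * gc d v (snd d q, s) \<le> hc d v (snd d q, s)"
    if d: "d \<in> \<A>" "q \<in> fst d" and s: "s \<in> {t0..t1}" for d q s v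
  proof -
    have sI: "s \<in> I" using s tI by simp
    obtain e where e: "e \<in> \<A>" "q \<in> fst e" "\<And>w'. w' \<in> sphere 0 1 \<Longrightarrow> \<mu> \<le> R e ((snd e q, s), w')"
      using le[OF chart_sub[OF d]] s unfolding \<mu>_def by blast
    show ?thesis
    proof (rule form_le_change[OF d e(1,2) sI])
      fix v :: "real^'n"
      have zS: "(snd e q, s) \<in> U e \<times> I" using inS[OF e(1,2) sI] .
      \<comment> \<open>For \<open>v = 0\<close> any unit vector serves, because the inequality is
        afterwards scaled by \<open>(norm v)^2\<close>.\<close>
      define w' where "w' = (if v = 0 then axis undefined 1 else v /\<^sub>R norm v)"
      have w': "w' \<in> sphere 0 1" "v = norm v *\<^sub>R w'" by (auto simp: w'_def norm_axis_1)
      then have g: "gc e w' (snd e q, s) > 0" by (intro gc_pos[OF e(1) zS]) auto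
      define X where "X = (hc e w' (snd e q, s) - \<eta> s * Hs q s * gc e w' (snd e q, s)) / gc e w' (snd e q, s)"
      have "\<mu> \<le> exp (- K * s) * X"
        using e(3)[OF w'(1)] by (simp add: R_def HG[OF e(1,2)] X_def)
      then have "\<mu> * exp (K * s) \<le> exp (- K * s) * X * exp (K * s)" by (intro mult_right_mono) auto
      also have "\<dots> = X" by (simp add: exp_minus)
      finally have "\<mu> * exp (K * s) \<le> X" .
      then have "\<mu> * exp (K * s) \<le> (hc e w' (snd e q, s) - \<eta> s * Hs q s * gc e w' (snd e q, s)) / gc e w' (snd e q, s)"
        by (simp add: X_def)
      then have "(\<eta> s * Hs q s + \<mu> * exp (K * s)) * gc e w' (snd e q, s) \<le> hc e w' (snd e q, s)"
        using g by (simp add: pos_le_divide_eq algebra_simps)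
      from mult_left_mono[OF this, of "(norm v)\<^sup>2"]
      have "(\<eta> s * Hs q s + \<mu> * exp (K * s)) * gc e (norm v *\<^sub>R w') (snd e q, s) \<le> hc e (norm v *\<^sub>R w') (snd e q, s)"
        unfolding hc_scale[OF e(1) zS] by (simp add: mult.commute mult.left_commute)
      then show "(\<eta> s * Hs q s + \<mu> * exp (K * s)) * gc e v (snd e q, s) \<le> hc e v (snd e q, s)"
        using w'(2) by simp
    qed
  qed
  have "\<mu> \<ge> 0"
  proof (rule ccontr)
    assume "\<not> \<mu> \<ge> 0"
    then have neg: "\<mu> < 0" by simp
    have t: "t \<in> I" using tI min(3) by simp
    have zS: "(x, t) \<in> U c' \<times> I" using min t by simp
    interpret C: coordinate_flow "U c' \<times> I" "G c'" "N c'" "HG c'" by (rule chart_flow[OF min(1)])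
    note hh = hh_hc[OF min(1)]
    have gw: "gc c' w (x, t) > 0" by (rule gc_pos[OF min(1) zS]) (use min(4) in auto)
    have "\<mu> * exp (K * t) = (hc c' w (x, t) - \<eta> t * HG c' (x, t) * gc c' w (x, t)) / gc c' w (x, t)"
      by (simp add: \<mu>_def R_def exp_minus)
    then have "\<mu> * exp (K * t) * gc c' w (x, t) = hc c' w (x, t) - \<eta> t * HG c' (x, t) * gc c' w (x, t)"
      using gw by simp
    then have hw: "hc c' w (x, t) = (\<eta> t * HG c' (x, t) + \<mu> * exp (K * t)) * gc c' w (x, t)"
      by (simp add: distrib_right)
    \<comment> \<open>At \<open>t0\<close> the factor \<eta> vanishes and a negative minimum
      contradicts weak convexity. A strictly later time leaves room for the left derivative
      test.\<close>
    have "t0 < t"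
    proof (rule ccontr)
      assume "\<not> t0 < t"
      then have "t = t0" using min(3) by simp
      then have "\<eta> t = 0" by (simp add: \<eta>_def flip: exp_add)
      then have "hc c' w (x, t) < 0" using hw gw neg by (simp add: mult_neg_pos)
      then show False using hc_nonneg[OF min(1) zS, of w] by simp
    qed
    define v where "v = (1 / sqrt (gc c' w (x, t))) *\<^sub>R w"
    have v: "gc c' v (x, t) = 1" "hc c' v (x, t) = \<eta> t * HG c' (x, t) - (- \<mu>) * exp (K * t)"
      unfolding v_def hc_scale[OF min(1) zS] hw using gw by (simp_all add: power_divide)
    \<comment> \<open>The barrier is \<open>\<beta> s = - \<mu> * exp (K * s)\<close>, positive
      under the assumption; \<open>bound\<close> then says that the form has not become negative up
      to time \<open>t\<close>.\<close>
    have "\<exists>Q \<le> (HG c' (x, t))\<^sup>2. (Q - CARD('n)) * (\<eta> t * HG c' (x, t) - (- \<mu>) * exp (K * t)) + 2 * HG c' (x, t)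
      - (2 - 2 * n * \<eta> t) * HG c' (x, t) - \<eta> t * (Q + CARD('n)) * HG c' (x, t) + (- \<mu>) * (K * exp (K * t)) \<le> 0"
    proof (rule C.contact[OF zS \<open>t0 < t\<close>])
      show "smooth_on UNIV \<eta>"
        unfolding \<eta>_def[abs_def] divide_inverse
        by (intro smooth_on_mult smooth_on_diff smooth_on_const smooth_on_exp open_UNIV)
      show "smooth_on UNIV (\<lambda>t. (- \<mu>) * exp (K * t))"
        by (intro smooth_on_mult smooth_on_const smooth_on_exp open_UNIV)
      show "DERIV \<eta> t :> 2 - 2 * n * \<eta> t"
        unfolding \<eta>_def[abs_def] using n by (auto intro!: derivative_eq_intros simp: field_simps)
      show "DERIV (\<lambda>t. (- \<mu>) * exp (K * t)) t :> (- \<mu>) * (K * exp (K * t))"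
        by (auto intro!: derivative_eq_intros)
      show "(\<eta> s * HG c' (y, s) - (- \<mu>) * exp (K * s)) * C.gg u (y, s) \<le> C.hh u (y, s)"
        if "(y, s) \<in> U c' \<times> I" "t0 \<le> s" "s \<le> t" for y s u
        using bound[OF min(1) Uinv, of y s u] that min(3) unfolding hh by (simp add: Uright HG_def)
      show "0 \<le> C.hh u (x, t)" for u unfolding hh by (rule hc_nonneg[OF min(1) zS])
      show "C.gg v (x, t) = 1" "C.hh v (x, t) = \<eta> t * HG c' (x, t) - (- \<mu>) * exp (K * t)"
        unfolding hh by (rule v)+
    qed
    then obtain Q where Q: "Q \<le> (HG c' (x, t))\<^sup>2"
      "(Q - n) * (\<eta> t * HG c' (x, t) - (- \<mu>) * exp (K * t)) + 2 * HG c' (x, t)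
      - (2 - 2 * n * \<eta> t) * HG c' (x, t) - \<eta> t * (Q + n) * HG c' (x, t) + (- \<mu>) * (K * exp (K * t)) \<le> 0"
      unfolding n_def by blast
    \<comment> \<open>The equation for \<eta> removes every term in \<open>H\<close>. As
      \<open>Q \<le> K\<close> and \<open>n > 0\<close>, the product that remains is in fact
      positive.\<close>
    have "(- \<mu>) * exp (K * t) * (K + n - Q) \<le> 0" using Q(2) by (simp add: algebra_simps)
    moreover have "Q \<le> K"
      using Q(1) K[OF chart_sub[OF min(1) Uinv[OF min(2)]] min(3)] by (simp add: HG_def)
    ultimately show False using neg n by (simp add: mult_le_0_iff zero_le_mult_iff)
  qed
  then have "\<eta> t1 * Hs p t1 * gc c v (snd c p, t1) \<le> (\<eta> t1 * Hs p t1 + \<mu> * exp (K * t1)) * gc c v (snd c p, t1)"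
    by (intro mult_right_mono) (auto simp: gc_def)
  also have "\<dots> \<le> hc c v (snd c p, t1)" by (rule bound[OF c]) (use t1 in simp)
  also have "\<eta> t1 = (1 - exp (- 2 * CARD('n) * (t1 - t0))) / CARD('n)"
    by (simp add: \<eta>_def n_def algebra_simps flip: exp_add)
  finally show ?thesis .
qed

end

section \<open>Umbilic hypersurfaces\<close>

context coordinate_flow
begin

text \<open>Completes a unit vector to an orthonormal frame over which \<open>hh\<close> sums to
  \<open>H\<close>; equality in the pinching estimate is deduced from this one direction at a
  time.\<close>

lemma trace_frame:
  fixes m :: 'n
  assumes z: "z \<in> S" and v: "gg v z = 1"
  shows "\<exists>L. L m = v \<and> (\<forall>k. gg (L k) z = 1) \<and> H z = (\<Sum>k\<in>UNIV. hh (L k) z)"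
proof -
  obtain x0 t0 where z0: "z = (x0, t0)" by (cases z)
  obtain S' \<Psi> and P :: "(real^'n) \<times> real \<Rightarrow> real^'n^'n" where
    N: "normal_coordinate_flow S' (\<lambda>z. F (\<Psi> z)) (\<lambda>z. \<nu> (\<Psi> z)) (\<lambda>z. H (\<Psi> z)) (0, t0)" and
    \<Psi>: "\<Psi> (0, t0) = (x0, t0)" "smooth_on S' \<Psi>"
    "\<forall>i. \<forall>z\<in>S'. pd i \<Psi> z = (P z $ i, 0)" "P (0, t0) $ m = v"
    using normal_coordinates[OF z[unfolded z0] v[unfolded z0], of m] by blast
  interpret N: normal_coordinate_flow S' "\<lambda>z. F (\<Psi> z)" "\<lambda>z. \<nu> (\<Psi> z)" "\<lambda>z. H (\<Psi> z)" "(0, t0)"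
    by (rule N)
  have ch: "pd k (\<lambda>x. f (\<Psi> x)) (0, t0) = dd (P (0, t0) $ k, 0) f z" if "smooth_on S f"
    for f :: "(real^'n) \<times> real \<Rightarrow> 'e" and k
    using dd_chain[OF smooth_differentiable[OF \<Psi>(2) N.z0], of f "xdir k"] smooth_differentiable[OF that z]
      \<Psi>(1,3) N.z0 z0 by simp
  have "gg (P (0, t0) $ k) z = 1" "hh (P (0, t0) $ k) z = N.h k k (0, t0)" for k
    using N.g0[of k k] by (simp_all add: gg_def hh_def N.g_def N.h_def ch[OF smF] ch[OF sm\<nu>])
  moreover have "H z = (\<Sum>k\<in>UNIV. N.h k k (0, t0))" using N.trace_h \<Psi>(1) z0 by simp
  ultimately show ?thesis using \<Psi>(4) by (intro exI[of _ "\<lambda>k. P (0, t0) $ k"]) simp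
qed

lemma \<nu>_dirF: "z \<in> S \<Longrightarrow> \<nu> z \<bullet> dd (w, 0) F z = 0"
  by (subst linear_expand[OF dirF]) (simp_all add: inner_sum_right \<nu>dF)

lemma hh_eq: "z \<in> S \<Longrightarrow> dd (v, 0) \<nu> z \<bullet> dd (w, 0) F z = - (\<nu> z \<bullet> dd (v, 0) (dd (w, 0) F) z)"
  by (rule dd_inner_const[OF S sm\<nu> smD(1)]) (auto intro: \<nu>_dirF)

lemma hh_sym: "z \<in> S \<Longrightarrow> dd (v, 0) \<nu> z \<bullet> dd (w, 0) F z = dd (w, 0) \<nu> z \<bullet> dd (v, 0) F z"
  by (simp add: hh_eq dd_commute[OF S smF])

end

section \<open>Umbilic flows in coordinates\<close>

locale umbilic_flow = coordinate_flow S F \<nu> H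
  for S :: "((real^'n::finite) \<times> real) set"
    and F \<nu> :: "(real^'n) \<times> real \<Rightarrow> 'e::euclidean_space"
    and H :: "(real^'n) \<times> real \<Rightarrow> real" +
  fixes \<kappa> :: "(real^'n) \<times> real \<Rightarrow> real"
  assumes H\<kappa>: "\<And>z. H z = CARD('n) * \<kappa> z"
    and umb: "\<And>z w. z \<in> S \<Longrightarrow> hh w z = \<kappa> z * gg w z"
    and dim2: "CARD('n) \<ge> 2"
begin

lemma sm\<kappa>: "smooth_on S \<kappa>"
proof -
  have "smooth_on S (\<lambda>z. inverse (CARD('n)) * H z)"
    by (intro smooth_on_mult S smooth_on_const smH)
  then show ?thesis by (rule smooth_on_cong[OF S, rotated]) (simp add: H\<kappa>)
qed

text \<open>Polarizing \<open>umb\<close> shows that the difference of the two sides is orthogonal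
  to the tangent space; by \<open>weingarten\<close> it is also tangent.\<close>

lemma d\<nu>: assumes z: "z \<in> S" shows "pd i \<nu> z = \<kappa> z *\<^sub>R pd i F z"
proof -
  have pol: "dd (v, 0) \<nu> z \<bullet> dd (w, 0) F z = \<kappa> z * (dd (v, 0) F z \<bullet> dd (w, 0) F z)" for v w
  proof -
    have 1: "hh (v + w) z = hh v z + 2 * (dd (v, 0) \<nu> z \<bullet> dd (w, 0) F z) + hh w z"
      unfolding hh_def linear_add[OF dirF[OF z]] linear_add[OF dir\<nu>[OF z]] inner_add_left inner_add_right
      using hh_sym[OF z, of v w] by linarith
    have 2: "gg (v + w) z = gg v z + 2 * (dd (v, 0) F z \<bullet> dd (w, 0) F z) + gg w z"
      unfolding gg_def linear_add[OF dirF[OF z]] inner_add_left inner_add_right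
      using inner_commute[of "dd (v, 0) F z" "dd (w, 0) F z"] by linarith
    show ?thesis
      using umb[OF z, of "v + w", unfolded 1 2] umb[OF z, of v] umb[OF z, of w] by (simp add: distrib_left)
  qed
  obtain A :: "real^'n^'n" where "\<forall>i. pd i \<nu> z = (\<Sum>j\<in>UNIV. A $ i $ j *\<^sub>R pd j F z)"
    using weingarten[OF z] by blast
  then have A: "pd i \<nu> z = dd (A $ i, 0) F z"
    using linear_expand[OF dirF[OF z], of "A $ i"] by simp
  define u where "u = A $ i - \<kappa> z *\<^sub>R axis i 1"
  have u: "pd i \<nu> z - \<kappa> z *\<^sub>R pd i F z = dd (u, 0) F z"
    unfolding A u_def linear_diff[OF dirF[OF z]] linear_cmul[OF dirF[OF z]] ..
  have "(pd i \<nu> z - \<kappa> z *\<^sub>R pd i F z) \<bullet> dd (u, 0) F z = 0"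
    by (simp add: inner_diff_left pol)
  then show ?thesis unfolding u[symmetric] by simp
qed

text \<open>The Codazzi equation gives \<open>\<kappa>_j F_i = \<kappa>_i F_j\<close>; a second direction \<open>j \<noteq> i\<close> needs \<open>n \<ge> 2\<close>.\<close>

lemma d\<kappa>: assumes z: "z \<in> S" shows "pd i \<kappa> z = 0"
proof -
  obtain j :: 'n where j: "j \<noteq> i"
    using dim2 card_le_Suc0_iff_eq[of "UNIV :: 'n set"] by (metis UNIV_I finite_class.finite_UNIV not_less_eq_eq numeral_2_eq_2)
  have d2: "pd a (pd b \<nu>) z = \<kappa> z *\<^sub>R pd a (pd b F) z + pd a \<kappa> z *\<^sub>R pd b F z" for a b
    unfolding dd_scaleR[OF sm\<kappa> smD(1) z, symmetric] by (rule cong[OF z]) (rule d\<nu>)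
  have "pd j \<kappa> z *\<^sub>R pd i F z = pd i \<kappa> z *\<^sub>R pd j F z"
    using d2[of i j] d2[of j i] dd_commute[OF S sm\<nu> z, of "xdir i" "xdir j"]
      dd_commute[OF S smF z, of "xdir i" "xdir j"] by simp
  then have "dd (pd j \<kappa> z *\<^sub>R axis i 1 - pd i \<kappa> z *\<^sub>R axis j 1, 0) F z = 0"
    unfolding linear_diff[OF dirF[OF z]] linear_cmul[OF dirF[OF z]] by simp
  then have "pd j \<kappa> z *\<^sub>R axis i 1 - pd i \<kappa> z *\<^sub>R axis j 1 = (0 :: real^'n)"
    by (rule dirF_inj[OF z])
  then have "(pd j \<kappa> z *\<^sub>R axis i 1 - pd i \<kappa> z *\<^sub>R axis j 1) $ j = (0 :: real^'n) $ j"
    by (rule arg_cong)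
  then show ?thesis using j by (simp add: axis_def)
qed

lemma dH: assumes z: "z \<in> S" shows "pd i H z = 0"
proof -
  have "pd i H z = pd i (\<lambda>z. CARD('n) * \<kappa> z) z" by (rule cong[OF z]) (rule H\<kappa>)
  then show ?thesis by (simp add: dd_mult[OF smooth_on_const sm\<kappa> z] dd_const d\<kappa>[OF z])
qed

text \<open>The tangential part of the left-hand side is the gradient of \<open>H\<close>, which
  vanishes, and it has no part along \<nu>. Only the \<open>F\<close>-component survives.\<close>

lemma \<nu>t: assumes z: "z \<in> S" shows "dd tdir \<nu> z = H z *\<^sub>R F z"
proof -
  let ?u = "dd tdir \<nu> z - H z *\<^sub>R F z"
  have inj: "inj (\<lambda>v. dd (v, 0) F z)"
    by (rule linear_injective_0[OF dirF[OF z], THEN iffD2]) (use dirF_inj[OF z] in auto)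
  have "\<exists>v. ?u = dd (v, 0) F z"
    by (rule mem_range_of_orthogonal_pair[OF dirF[OF z] inj dim, of "\<nu> z" "F z"])
      (use \<nu>_dirF[OF z] F_dF[OF z] FF[OF z] \<nu>\<nu>[OF z] \<nu>F[OF z] \<nu>_d\<nu>[OF z, of tdir] F_d\<nu>t[OF z] in
        \<open>simp_all add: inner_diff_left inner_diff_right inner_commute\<close>)
  then obtain v where v: "?u = dd (v, 0) F z" by blast
  have "?u \<bullet> pd j F z = 0" for j
    by (simp add: inner_diff_left \<nu>t_dF[OF z] dH[OF z] F_dF[OF z])
  then have "?u \<bullet> dd (v, 0) F z = 0"
    by (subst linear_expand[OF dirF[OF z]]) (simp add: inner_sum_right)
  then show ?thesis unfolding v[symmetric] by simp
qed

text \<open>Compares the coefficients of \<open>pd i F\<close> in the two orders of differentiating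
  \<nu>, once in time and once in space.\<close>

lemma \<kappa>t: assumes z: "z \<in> S" shows "dd tdir \<kappa> z = H z * (1 + (\<kappa> z)\<^sup>2)"
proof -
  fix i :: 'n
  have "dd tdir (pd i \<nu>) z = dd tdir (\<lambda>z. \<kappa> z *\<^sub>R pd i F z) z"
    by (rule cong[OF z]) (rule d\<nu>)
  moreover have "dd tdir (pd i F) z = - (H z * \<kappa> z) *\<^sub>R pd i F z"
    by (simp add: F_xt[OF z] dH[OF z] d\<nu>[OF z])
  moreover have "pd i (dd tdir \<nu>) z = pd i (\<lambda>z. H z *\<^sub>R F z) z"
    by (rule cong[OF z]) (rule \<nu>t)
  ultimately have "H z *\<^sub>R pd i F z = (dd tdir \<kappa> z - H z * (\<kappa> z)\<^sup>2) *\<^sub>R pd i F z"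
    using dd_commute[OF S sm\<nu> z, of tdir "xdir i"]
    by (simp add: dd_scaleR[OF sm\<kappa> smD(1) z] dd_scaleR[OF smH smF z] dH[OF z] power2_eq_square
        scaleR_diff_left mult_ac)
  moreover have "pd i F z \<noteq> 0" using dirF_inj[OF z, of "axis i 1"] by auto
  ultimately have "H z = dd tdir \<kappa> z - H z * (\<kappa> z)\<^sup>2" by simp
  then show ?thesis by (simp add: algebra_simps)
qed

end

section \<open>Connectedness, and images that fill a whole slice of the sphere\<close>

lemma connected_space_locally_constant:
  assumes "connected_space X" "\<And>p. p \<in> topspace X \<Longrightarrow> \<exists>W. openin X W \<and> p \<in> W \<and> (\<forall>q\<in>W. f q = f p)"
    and "p \<in> topspace X" "q \<in> topspace X"
  shows "f p = f q"
proof (rule ccontr)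
  assume ne: "f p \<noteq> f q"
  let ?A = "{x \<in> topspace X. f x = f p}" and ?B = "{x \<in> topspace X. f x \<noteq> f p}"
  have op: "openin X {x \<in> topspace X. P (f x)}" for P
  proof (subst openin_subopen, intro ballI)
    fix x assume x: "x \<in> {x \<in> topspace X. P (f x)}"
    then obtain W where W: "openin X W" "x \<in> W" "\<forall>q\<in>W. f q = f x" using assms(2)[of x] by blast
    have "q \<in> {x \<in> topspace X. P (f x)}" if "q \<in> W" for q
    proof -
      have "f q = f x" using W(3) that by blast
      then show ?thesis using x openin_subset[OF W(1)] that by auto
    qed
    then show "\<exists>W. openin X W \<and> x \<in> W \<and> W \<subseteq> {x \<in> topspace X. P (f x)}"
      using W by blast
  qed
  note AB = op[of "\<lambda>y. y = f p"] op[of "\<lambda>y. y \<noteq> f p"]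
  have "topspace X \<subseteq> ?A \<union> ?B" "?A \<inter> ?B = {}" "?A \<noteq> {}" "?B \<noteq> {}"
    using assms(3,4) ne by auto
  then show False
    using assms(1) AB unfolding connected_space_def by blast
qed


text \<open>If a point were missed, stereographic projection from it would make the image a compact subset of
  \<open>n\<close>-space that is open by invariance of domain.\<close>

lemma (in mcf) image_full:
  fixes e :: 'e
  assumes t: "t \<in> I" and e: "norm e = 1" and a: "\<bar>a\<bar> < 1"
    and sub: "\<And>p. p \<in> topspace M \<Longrightarrow> F p t \<bullet> e = a"
  shows "(\<lambda>p. F p t) ` topspace M = {x \<in> sphere 0 1. x \<bullet> e = a}"
proof (rule ccontr)
  let ?f = "\<lambda>p. F p t"
  let ?\<Gamma> = "{x \<in> sphere 0 1. x \<bullet> e = a}"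
  assume ne: "?f ` topspace M \<noteq> ?\<Gamma>"
  have "topspace M \<noteq> {}" using manifold unfolding closed_connected_manifold_def by blast
  then obtain p0 where p0: "p0 \<in> topspace M" by blast
  have emb: "smooth_embedding_into_sphere M \<A> ?f"
    using flow t unfolding ancient_embedded_mcf_def by auto
  have im: "?f ` topspace M \<subseteq> ?\<Gamma>"
    using emb sub unfolding smooth_embedding_into_sphere_def by auto
  then obtain b where b: "b \<in> ?\<Gamma>" "b \<notin> ?f ` topspace M" using ne by blast
  define r where "r = sqrt (1 - a\<^sup>2)"
  have a2: "a\<^sup>2 < 1" using a by (simp add: abs_square_less_1)
  have r: "r > 0" "r\<^sup>2 = 1 - a\<^sup>2" using a2 by (simp_all add: r_def)
  have ee: "e \<bullet> e = 1" using e by (simp add: norm_eq_1)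
  let ?T = "{x. e \<bullet> x = a}"
  \<comment> \<open>Presents the slice as a round sphere of radius \<open>r\<close> inside a
    hyperplane, the form to which the homeomorphism of a punctured sphere with an affine space
    applies.\<close>
  have "x \<in> sphere 0 1 \<longleftrightarrow> x \<in> sphere (a *\<^sub>R e) r" if "e \<bullet> x = a" for x
  proof -
    have "(dist (a *\<^sub>R e) x)\<^sup>2 = (norm x)\<^sup>2 - a\<^sup>2"
      unfolding dist_norm power2_norm_eq_inner
      using that ee by (simp add: inner_diff_left inner_diff_right inner_commute power2_eq_square)
    then have "dist (a *\<^sub>R e) x = r \<longleftrightarrow> (norm x)\<^sup>2 = 1"
      using r by (metis add.commute diff_add_cancel less_eq_real_def power2_eq_imp_eq zero_le_dist)
    also have "\<dots> \<longleftrightarrow> norm x = 1" by (simp add: power2_eq_1_iff) (smt (verit) norm_ge_zero)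
    finally show ?thesis by simp
  qed
  then have \<Gamma>: "?\<Gamma> = sphere (a *\<^sub>R e) r \<inter> ?T" by (auto simp: inner_commute)
  have "e \<noteq> 0" using e by auto
  have "(sphere (a *\<^sub>R e) r \<inter> ?T) - {b} homeomorphic (UNIV :: (real^'n) set)"
  proof (rule homeomorphic_punctured_affine_sphere_affine[OF r(1) _ affine_hyperplane])
    show "b \<in> sphere (a *\<^sub>R e) r" "b \<in> ?T" using b(1) unfolding \<Gamma> by auto
    show "aff_dim ?T = aff_dim (UNIV :: (real^'n) set) + 1"
      using aff_dim_hyperplane[OF \<open>e \<noteq> 0\<close>, of a] dimE by simp
  qed (simp_all add: ee)
  then obtain \<phi> \<psi> where \<phi>: "homeomorphism (?\<Gamma> - {b}) (UNIV :: (real^'n) set) \<phi> \<psi>"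
    unfolding homeomorphic_def \<Gamma> by blast
  have \<phi>c: "continuous_on (?\<Gamma> - {b}) \<phi>" and \<phi>i: "inj_on \<phi> (?\<Gamma> - {b})"
    using \<phi> by (auto simp: homeomorphism_def intro: inj_on_inverseI)
  have im': "?f ` topspace M \<subseteq> ?\<Gamma> - {b}" using im b by blast
  have hm: "homeomorphic_map M (top_of_set (?f ` topspace M)) ?f"
    using emb unfolding smooth_embedding_into_sphere_def embedding_map_def by simp
  then have finj: "inj_on ?f (topspace M)" by (rule homeomorphic_imp_injective_map)
  have "continuous_map M euclidean ?f"
    using homeomorphic_imp_continuous_map[OF hm] continuous_map_into_fulltopology by blast
  moreover have "compactin M (topspace M)"
    using manifold by (simp add: closed_connected_manifold_def compact_space_def)
  ultimately have "compactin euclidean (?f ` topspace M)" by (rule image_compactin[rotated])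
  then have "compact (?f ` topspace M)" by simp
  then have comp: "compact (\<phi> ` ?f ` topspace M)"
    by (intro compact_continuous_image continuous_on_subset[OF \<phi>c im'])
  have "open (\<phi> ` ?f ` topspace M)"
  proof -
    have "open (\<phi> ` ?f ` fst c)" if c: "c \<in> \<A>" for c
    proof -
      let ?k = "\<lambda>x. G c (x, t)"
      have k: "?k x = ?f (chart_inv c x)" for x by (simp add: G_def)
      have kin: "?k x \<in> ?\<Gamma> - {b}" if "x \<in> U c" for x
        unfolding k using im' chart_sub[OF c Uinv[OF that]] by blast
      have kc: "continuous_on (U c) ?k"
        by (rule continuous_on_compose2[OF smooth_on_continuous[OF smG[OF c]]])
          (use t in \<open>auto intro!: continuous_intros\<close>)
      have "continuous_on (U c) (\<lambda>x. \<phi> (?k x))"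
        by (rule continuous_on_compose2[OF \<phi>c kc]) (use kin in blast)
      moreover have "inj_on (\<lambda>x. \<phi> (?k x)) (U c)"
      proof (rule inj_onI)
        fix x y assume xy: "x \<in> U c" "y \<in> U c" "\<phi> (?k x) = \<phi> (?k y)"
        then have "?k x = ?k y" using inj_onD[OF \<phi>i] kin by blast
        then have "chart_inv c x = chart_inv c y"
          unfolding k using inj_onD[OF finj] chart_sub[OF c Uinv] xy by blast
        then show "x = y" using Uright xy by metis
      qed
      ultimately have "open ((\<lambda>x. \<phi> (?k x)) ` U c)" by (intro invariance_of_domain openU c)
      moreover have "(\<lambda>x. \<phi> (?k x)) ` U c = \<phi> ` ?f ` fst c"
        unfolding U_def image_image by (rule image_cong[OF refl]) (simp add: G_def Uleft[OF c])
      ultimately show ?thesis by simp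
    qed
    then have "open (\<Union>c\<in>\<A>. \<phi> ` ?f ` fst c)" by blast
    moreover have "(\<Union>c\<in>\<A>. \<phi> ` ?f ` fst c) = \<phi> ` ?f ` topspace M"
      using atlas unfolding smooth_atlas_def by blast
    ultimately show ?thesis by simp
  qed
  then have "\<phi> ` ?f ` topspace M = UNIV"
    using clopen[of "\<phi> ` ?f ` topspace M"] compact_imp_closed[OF comp] p0 by blast
  then show False using comp not_compact_UNIV by metis
qed

section \<open>Ancient convex solutions are umbilic\<close>

context convex_mcf
begin

lemma umbilic_pinching:
  assumes c: "c \<in> \<A>" "p \<in> fst c" and t: "t \<in> I"
  shows "Hs p t / CARD('n) * gc c v (snd c p, t) \<le> hc c v (snd c p, t)"
proof (rule LIMSEQ_le_const2)
  let ?n = "real CARD('n)"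
  have "(\<lambda>k. (1 - exp (- 2 * ?n) ^ k) / ?n * Hs p t * gc c v (snd c p, t)) \<longlonglongrightarrow>
      (1 - 0) / ?n * Hs p t * gc c v (snd c p, t)"
    by (intro tendsto_intros LIMSEQ_realpow_zero) auto
  then show "(\<lambda>k. (1 - exp (- 2 * ?n) ^ k) / ?n * Hs p t * gc c v (snd c p, t)) \<longlonglongrightarrow>
      Hs p t / ?n * gc c v (snd c p, t)" by simp
  have "(1 - exp (- 2 * ?n) ^ k) / ?n * Hs p t * gc c v (snd c p, t) \<le> hc c v (snd c p, t)" for k
  proof -
    \<comment> \<open>The starting times \<open>t - real k\<close> turn the exponential into a
      geometric sequence.\<close>
    have "exp (- 2 * ?n) ^ k = exp (- 2 * ?n * (t - (t - real k)))"
      by (simp add: exp_of_nat_mult[symmetric] mult_ac)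
    then show ?thesis using pinching[OF _ t c, of "t - real k" v] by simp
  qed
  then show "\<exists>N. \<forall>k\<ge>N. (1 - exp (- 2 * ?n) ^ k) / ?n * Hs p t * gc c v (snd c p, t) \<le> hc c v (snd c p, t)"
    by blast
qed

definition "\<kappa> p t = Hs p t / CARD('n)"
definition "\<kappa>G c z = HG c z / CARD('n)" for c :: "('p, 'n) chart"

lemma umbilic_chart_flow:
  assumes c: "c \<in> \<A>" and n2: "CARD('n) \<ge> 2"
  shows "umbilic_flow (U c \<times> I) (G c) (N c) (HG c) (\<kappa>G c)"
proof -
  interpret C: coordinate_flow "U c \<times> I" "G c" "N c" "HG c" by (rule chart_flow[OF c])
  note hh = hh_hc[OF c]
  have le: "\<kappa>G c z * C.gg v z \<le> C.hh v z" if z: "z \<in> U c \<times> I" for z v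
  proof -
    obtain x t where xt: "z = (x, t)" "x \<in> U c" "t \<in> I" using z by blast
    show ?thesis
      using umbilic_pinching[OF c Uinv[OF xt(2)] xt(3), of v] unfolding hh
      by (simp add: Uright[OF xt(2)] \<kappa>G_def HG_def xt(1))
  qed
  have eq1: "C.hh v z = \<kappa>G c z" if z: "z \<in> U c \<times> I" and v: "C.gg v z = 1" for z v
  proof -
    fix m :: 'n
    obtain L where L: "L m = v" "\<forall>k. C.gg (L k) z = 1" "HG c z = (\<Sum>k\<in>UNIV. C.hh (L k) z)"
      using C.trace_frame[OF z v, of m] by blast
    \<comment> \<open>The pinching defects along the frame are nonnegative and add up to zero, so
      each vanishes, in particular the one along \<open>v = L m\<close>.\<close>
    have "(\<Sum>k\<in>UNIV. C.hh (L k) z - \<kappa>G c z) = 0"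
      by (simp add: sum_subtractf L(3)[symmetric] \<kappa>G_def)
    moreover have "\<forall>k\<in>UNIV. C.hh (L k) z - \<kappa>G c z \<ge> 0"
      using le[OF z] L(2) by (metis diff_ge_0_iff_ge mult.right_neutral)
    ultimately have "C.hh (L m) z - \<kappa>G c z = 0"
      by (subst (asm) sum_nonneg_eq_0_iff) auto
    then show ?thesis using L(1) by simp
  qed
  show ?thesis
  proof
    show "HG c z = CARD('n) * \<kappa>G c z" for z by (simp add: \<kappa>G_def)
    show "CARD('n) \<ge> 2" by (rule n2)
    fix z w assume z: "z \<in> U c \<times> I"
    show "C.hh w z = \<kappa>G c z * C.gg w z"
    proof (cases "w = 0")
      case True
      then show ?thesis using hc_scale[OF c z, of 0 w] unfolding hh by simp
    next
      case False
      then have g: "gc c w z > 0" by (rule gc_pos[OF c z])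
      then have "gc c ((1 / sqrt (gc c w z)) *\<^sub>R w) z = 1"
        unfolding hc_scale[OF c z] by (simp add: power_divide)
      from eq1[OF z, unfolded hh, OF this] show ?thesis
        using g unfolding hc_scale[OF c z] hh by (simp add: power_divide field_simps)
    qed
  qed
qed

end

section \<open>Classification\<close>

context mcf
begin

lemma chart_locally_constant:
  fixes g :: "(real^'n) \<times> real \<Rightarrow> 'v::euclidean_space"
  assumes c: "c \<in> \<A>" "p \<in> fst c" and t: "t \<in> I" and sm: "smooth_on (U c \<times> I) g"
    and z: "\<And>z i. z \<in> U c \<times> I \<Longrightarrow> pd i g z = 0"
  shows "\<exists>W. openin M W \<and> p \<in> W \<and> (\<forall>q\<in>W. q \<in> fst c \<and> g (snd c q, t) = g (snd c p, t))"
proof -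
  obtain r where r: "r > 0" "ball (snd c p) r \<subseteq> U c"
    using openU[OF c(1)] inU[OF c(2)] open_contains_ball by blast
  have "((\<lambda>x. g (x, t)) has_derivative (\<lambda>v. 0)) (at x within ball (snd c p) r)" if "x \<in> ball (snd c p) r" for x
  proof -
    have xS: "(x, t) \<in> U c \<times> I" using that r t by blast
    note df = smooth_differentiable[OF sm xS]
    from linear_expand[OF dd_dir_linear_fst[OF df]] have "dd (v, 0) g (x, t) = 0" for v using z[OF xS] by simp
    then have "dd v (\<lambda>x. g (x, t)) x = 0" for v using dd_slice_x(1)[OF df] by metis
    then have "frechet_derivative (\<lambda>x. g (x, t)) (at x) = (\<lambda>v. 0)" by (simp add: dd_def fun_eq_iff)
    then show ?thesis
      using dd_slice_x(2)[OF df] unfolding frechet_derivative_works by (metis has_derivative_at_withinI)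
  qed
  from has_derivative_zero_constant[OF convex_ball this]
  obtain k where k: "\<And>x. x \<in> ball (snd c p) r \<Longrightarrow> g (x, t) = k" by blast
  show ?thesis
    by (intro exI[of _ "{q \<in> fst c. snd c q \<in> ball (snd c p) r}"] conjI openin_chart_preimage[OF c(1)])
      (use r c k in auto)
qed

lemma chart_time_derivative:
  assumes c: "c \<in> \<A>" "p \<in> fst c" and t: "t \<in> I" and sm: "smooth_on (U c \<times> I) g"
  shows "((\<lambda>s. g (snd c p, s)) has_vector_derivative dd tdir g (snd c p, t)) (at t)"
  using dd_line[of g "(snd c p, 0)" t tdir] smooth_differentiable[OF sm inS[OF c t]] by simp

end

lemma convex_ancient_interval: "convex (ancient_interval T)"
  by (rule is_interval_convex) (use ancient_interval_downward in \<open>auto simp: is_interval_1\<close>)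

section \<open>The conserved centre and the growth of the height\<close>

context convex_mcf
begin

text \<open>With \<open>\<kappa> = cot \<rho>\<close> this is \<open>sin \<rho>\<close>, and
  \<open>\<kappa> p t * r p t\<close> is \<open>cos \<rho>\<close>.\<close>

definition "r p t = inverse (sqrt (1 + (\<kappa> p t)\<^sup>2))"
definition "V p t = \<nu> p t - \<kappa> p t *\<^sub>R F p t"

lemma chart_vals:
  assumes c: "c \<in> \<A>" "p \<in> fst c"
  shows "\<kappa>G c (snd c p, t) = \<kappa> p t" "G c (snd c p, t) = F p t" "N c (snd c p, t) = \<nu> p t"
    "HG c (snd c p, t) = Hs p t"
  by (simp_all add: \<kappa>G_def \<kappa>_def HG_def G_def N_def Uleft[OF c])

lemma connM: "connected_space M"
  using manifold by (simp add: closed_connected_manifold_def)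

lemma space_constant:
  assumes n2: "CARD('n) \<ge> 2" and t: "t \<in> I" and pq: "p \<in> topspace M" "q \<in> topspace M"
  shows "\<kappa> p t = \<kappa> q t" "V p t = V q t"
proof -
  have loc: "\<exists>W. openin M W \<and> p \<in> W \<and> (\<forall>q\<in>W. \<kappa> q t = \<kappa> p t)"
    "\<exists>W. openin M W \<and> p \<in> W \<and> (\<forall>q\<in>W. V q t = V p t)" if pM: "p \<in> topspace M" for p
  proof -
    obtain c where c: "c \<in> \<A>" "p \<in> fst c" using cover[OF pM] by blast
    interpret C: umbilic_flow "U c \<times> I" "G c" "N c" "HG c" "\<kappa>G c" by (rule umbilic_chart_flow[OF c(1) n2])
    obtain W where "openin M W" "p \<in> W" "\<forall>q\<in>W. q \<in> fst c \<and> \<kappa>G c (snd c q, t) = \<kappa>G c (snd c p, t)"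
      using chart_locally_constant[OF c t C.sm\<kappa> C.d\<kappa>] by blast
    then show "\<exists>W. openin M W \<and> p \<in> W \<and> (\<forall>q\<in>W. \<kappa> q t = \<kappa> p t)"
      using chart_vals(1)[OF c(1)] c(2) by metis
    have smkF: "smooth_on (U c \<times> I) (\<lambda>z. \<kappa>G c z *\<^sub>R G c z)" by (intro smooth_on_scaleR C.S C.sm\<kappa> C.smF)
    let ?V = "\<lambda>z. N c z - \<kappa>G c z *\<^sub>R G c z"
    have smV: "smooth_on (U c \<times> I) ?V" by (intro smooth_on_diff C.S C.sm\<nu> smkF)
    have "pd i ?V z = 0" if "z \<in> U c \<times> I" for z i
      by (simp add: dd_diff[OF C.sm\<nu> smkF that] dd_scaleR[OF C.sm\<kappa> C.smF that] C.d\<nu>[OF that] C.d\<kappa>[OF that])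
    then obtain W where "openin M W" "p \<in> W" "\<forall>q\<in>W. q \<in> fst c \<and> ?V (snd c q, t) = ?V (snd c p, t)"
      using chart_locally_constant[OF c t smV] by blast
    then show "\<exists>W. openin M W \<and> p \<in> W \<and> (\<forall>q\<in>W. V q t = V p t)"
      using chart_vals[OF c(1)] c(2) unfolding V_def by metis
  qed
  show "\<kappa> p t = \<kappa> q t"
    by (rule connected_space_locally_constant[OF connM, of "\<lambda>p. \<kappa> p t"]) (use loc(1) pq in auto)
  show "V p t = V q t"
    by (rule connected_space_locally_constant[OF connM, of "\<lambda>p. V p t"]) (use loc(2) pq in auto)
qed

lemma time_derivatives:
  assumes n2: "CARD('n) \<ge> 2" and p: "p \<in> topspace M" and t: "t \<in> I"
  shows "DERIV (\<kappa> p) t :> Hs p t * (1 + (\<kappa> p t)\<^sup>2)"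
    "(\<nu> p has_vector_derivative Hs p t *\<^sub>R F p t) (at t)"
    "(F p has_vector_derivative - (Hs p t *\<^sub>R \<nu> p t)) (at t)"
proof -
  obtain c where c: "c \<in> \<A>" "p \<in> fst c" using cover[OF p] by blast
  interpret C: umbilic_flow "U c \<times> I" "G c" "N c" "HG c" "\<kappa>G c" by (rule umbilic_chart_flow[OF c(1) n2])
  note z = inS[OF c t] and v = chart_vals[OF c]
  show "(F p has_vector_derivative - (Hs p t *\<^sub>R \<nu> p t)) (at t)" by (rule F_t[OF c t])
  show "DERIV (\<kappa> p) t :> Hs p t * (1 + (\<kappa> p t)\<^sup>2)"
    using chart_time_derivative[OF c t C.sm\<kappa>]
    unfolding C.\<kappa>t[OF z] v has_real_derivative_iff_has_vector_derivative .
  show "(\<nu> p has_vector_derivative Hs p t *\<^sub>R F p t) (at t)"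
    using chart_time_derivative[OF c t C.sm\<nu>] unfolding C.\<nu>t[OF z] v .
qed

lemma r_deriv:
  assumes n2: "CARD('n) \<ge> 2" and p: "p \<in> topspace M" and t: "t \<in> I"
  shows "DERIV (r p) t :> - \<kappa> p t * Hs p t * r p t"
proof -
  note k = time_derivatives(1)[OF assms]
  have pos: "1 + (\<kappa> p t)\<^sup>2 > 0" by (simp add: add_pos_nonneg)
  define s where "s = sqrt (1 + (\<kappa> p t)\<^sup>2)"
  have s: "s > 0" "1 + (\<kappa> p t)\<^sup>2 = s * s" using pos by (auto simp: s_def)
  have "DERIV (\<lambda>s. 1 + (\<kappa> p s)\<^sup>2) t :> 2 * \<kappa> p t * (Hs p t * (1 + (\<kappa> p t)\<^sup>2))"
    by (auto intro!: derivative_eq_intros k)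
  from DERIV_chain2[OF DERIV_real_sqrt[OF pos] this, folded s_def]
  have "DERIV (\<lambda>s. sqrt (1 + (\<kappa> p s)\<^sup>2)) t :> inverse s / 2 * (2 * \<kappa> p t * (Hs p t * (s * s)))"
    unfolding s(2) .
  moreover have "inverse s / 2 * (2 * \<kappa> p t * (Hs p t * (s * s))) = \<kappa> p t * Hs p t * s"
    using s(1) by simp
  ultimately have "DERIV (\<lambda>s. sqrt (1 + (\<kappa> p s)\<^sup>2)) t :> \<kappa> p t * Hs p t * s" by (simp only:)
  from DERIV_inverse'[OF this, folded s_def]
  have "DERIV (r p) t :> - (inverse s * (\<kappa> p t * Hs p t * s) * inverse s)"
    using s(1) unfolding r_def[abs_def] by simp
  moreover have "- (inverse s * (\<kappa> p t * Hs p t * s) * inverse s) = - \<kappa> p t * Hs p t * r p t"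
    using s(1) by (simp add: r_def s_def[symmetric])
  ultimately show ?thesis by simp
qed

text \<open>The time derivatives are \<open>V' = \<kappa> H V\<close> and
  \<open>r' = - \<kappa> H r\<close>, so the product is conserved.\<close>

lemma rV_deriv:
  assumes n2: "CARD('n) \<ge> 2" and p: "p \<in> topspace M" and t: "t \<in> I"
  shows "((\<lambda>t. r p t *\<^sub>R V p t) has_vector_derivative 0) (at t)"
proof -
  note d = time_derivatives[OF assms]
  let ?k = "\<kappa> p t" and ?H = "Hs p t" and ?r = "r p t"
  have "(V p has_vector_derivative ?H *\<^sub>R F p t
      - (?k *\<^sub>R (- (?H *\<^sub>R \<nu> p t)) + (?H * (1 + ?k\<^sup>2)) *\<^sub>R F p t)) (at t)"
    unfolding V_def[abs_def]
    by (intro has_vector_derivative_diff has_vector_derivative_scaleR d)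
  then have "((\<lambda>t. r p t *\<^sub>R V p t) has_vector_derivative
      ?r *\<^sub>R (?H *\<^sub>R F p t - (?k *\<^sub>R (- (?H *\<^sub>R \<nu> p t)) + (?H * (1 + ?k\<^sup>2)) *\<^sub>R F p t))
      + (- ?k * ?H * ?r) *\<^sub>R V p t) (at t)"
    by (intro has_vector_derivative_scaleR r_deriv assms)
  moreover have "?r *\<^sub>R (?H *\<^sub>R F p t - (?k *\<^sub>R (- (?H *\<^sub>R \<nu> p t)) + (?H * (1 + ?k\<^sup>2)) *\<^sub>R F p t))
      + (- ?k * ?H * ?r) *\<^sub>R V p t = 0"
    by (simp add: V_def algebra_simps power2_eq_square)
  ultimately show ?thesis by simp
qed

text \<open>Since \<open>(\<kappa> r)' = H (1 + \<kappa>^2) r - \<kappa>^2 H r = H r = n \<kappa>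
  r\<close>, the exponential factor compensates the growth exactly.\<close>

lemma \<kappa>r_deriv:
  assumes n2: "CARD('n) \<ge> 2" and p: "p \<in> topspace M" and t: "t \<in> I"
  shows "((\<lambda>t. \<kappa> p t * r p t * exp (- (real CARD('n) * t))) has_vector_derivative 0) (at t)"
proof -
  have H: "Hs p t = CARD('n) * \<kappa> p t" by (simp add: \<kappa>_def)
  have "DERIV (\<lambda>t. \<kappa> p t * r p t * exp (- (real CARD('n) * t))) t :> 0"
    by (rule derivative_eq_intros time_derivatives[OF assms] r_deriv[OF assms] refl)+
      (simp add: H algebra_simps power2_eq_square)
  then show ?thesis by (simp add: has_real_derivative_iff_has_vector_derivative)
qed

lemma height:
  assumes n2: "CARD('n) \<ge> 2" and ne: "I \<noteq> {}"
  shows "\<exists>e C. norm e = 1 \<and> C \<ge> 0 \<and> (\<forall>t\<in>I. C * exp (real CARD('n) * t) < 1 \<and>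
    (\<forall>p\<in>topspace M. F p t \<bullet> e = - (C * exp (real CARD('n) * t))))"
proof -
  have "topspace M \<noteq> {}" using manifold unfolding closed_connected_manifold_def by blast
  then obtain p0 where p0: "p0 \<in> topspace M" by blast
  obtain t0 where t0: "t0 \<in> I" using ne by blast
  obtain c where c: "c \<in> \<A>" "p0 \<in> fst c" using cover[OF p0] by blast
  obtain e where e: "\<And>t. t \<in> I \<Longrightarrow> r p0 t *\<^sub>R V p0 t = e"
    by (rule has_vector_derivative_zero_constant[OF convex_ancient_interval has_vector_derivative_at_within[OF rV_deriv[OF n2 p0]]]) blast+
  have "\<exists>C. \<forall>t\<in>I. \<kappa> p0 t * r p0 t * exp (- (real CARD('n) * t)) = C"
  proof (rule has_vector_derivative_zero_constant[OF convex_ancient_interval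
        has_vector_derivative_at_within[OF \<kappa>r_deriv[OF n2 p0]]])
    fix C assume "\<And>t. t \<in> I \<Longrightarrow> \<kappa> p0 t * r p0 t * exp (- (real CARD('n) * t)) = C"
    then show ?thesis by (intro exI[of _ C] ballI)
  qed
  then obtain C where C: "\<And>t. t \<in> I \<Longrightarrow> \<kappa> p0 t * r p0 t * exp (- (real CARD('n) * t)) = C" by blast
  have y: "\<kappa> p0 t * r p0 t = C * exp (real CARD('n) * t)" if "t \<in> I" for t
    by (simp add: C[OF that, symmetric] exp_minus)
  have r: "(r p t)\<^sup>2 * (1 + (\<kappa> p t)\<^sup>2) = 1" "r p t > 0" for p t
  proof -
    have pos: "1 + (\<kappa> p t)\<^sup>2 > 0" by (simp add: add_pos_nonneg)
    then show "(r p t)\<^sup>2 * (1 + (\<kappa> p t)\<^sup>2) = 1" "r p t > 0"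
      by (simp_all add: r_def power_inverse)
  qed
  \<comment> \<open>Weak convexity at one point and one time fixes the sign of \<open>C\<close>, and
    with it that of \<kappa> at all times.\<close>
  have "\<kappa> p0 t0 \<ge> 0"
  proof -
    interpret C: umbilic_flow "U c \<times> I" "G c" "N c" "HG c" "\<kappa>G c" by (rule umbilic_chart_flow[OF c(1) n2])
    note z = inS[OF c t0]
    fix v :: 'n
    have "hc c (axis v 1) (snd c p0, t0) = \<kappa> p0 t0 * gc c (axis v 1) (snd c p0, t0)"
      using C.umb[OF z, of "axis v 1"] unfolding hh_hc[OF c(1)] chart_vals[OF c] .
    moreover have "hc c (axis v 1) (snd c p0, t0) \<ge> 0" by (rule hc_nonneg[OF c(1) z])
    moreover have "gc c (axis v 1) (snd c p0, t0) > 0" by (rule gc_pos[OF c(1) z]) simp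
    ultimately show ?thesis by (simp add: zero_le_mult_iff)
  qed
  then have "C \<ge> 0"
    unfolding C[OF t0, symmetric] using r(2)[of p0 t0] by (intro mult_nonneg_nonneg) auto
  moreover have "norm e = 1"
  proof -
    have "V p0 t0 \<bullet> V p0 t0 = 1 + (\<kappa> p0 t0)\<^sup>2"
      using pF[OF c t0] p\<nu>[OF c t0]
      by (simp add: V_def inner_diff_left inner_diff_right power2_eq_square inner_commute[of "F p0 t0" "\<nu> p0 t0"])
    then have "e \<bullet> e = (r p0 t0)\<^sup>2 * (1 + (\<kappa> p0 t0)\<^sup>2)"
      by (simp add: e[OF t0, symmetric] power2_eq_square)
    then show ?thesis using r by (simp add: norm_eq_1)
  qed
  \<comment> \<open>The left-hand side is \<open>\<kappa> / sqrt (1 + \<kappa>^2)\<close>, whose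
    square is less than 1.\<close>
  moreover have "C * exp (real CARD('n) * t) < 1" if t: "t \<in> I" for t
  proof (rule ccontr)
    assume "\<not> C * exp (real CARD('n) * t) < 1"
    then have "1 \<le> (\<kappa> p0 t * r p0 t)\<^sup>2" unfolding y[OF t] by (simp add: one_le_power)
    then have "1 \<le> (r p0 t)\<^sup>2 * (\<kappa> p0 t)\<^sup>2" by (simp only: power_mult_distrib mult.commute)
    moreover have "(r p0 t)\<^sup>2 + (r p0 t)\<^sup>2 * (\<kappa> p0 t)\<^sup>2 = 1" using r(1)[of p0 t] by (simp only: distrib_left mult_1_right)
    moreover have "(r p0 t)\<^sup>2 > 0" using r(2)[of p0 t] by (simp only: zero_less_power)
    ultimately show False by linarith
  qed
  moreover have "F p t \<bullet> e = - (C * exp (real CARD('n) * t))" if t: "t \<in> I" and p: "p \<in> topspace M" for t p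
  proof -
    obtain d where d: "d \<in> \<A>" "p \<in> fst d" using cover[OF p] by blast
    have "e = r p0 t *\<^sub>R V p t" using e[OF t] space_constant(2)[OF n2 t p0 p] by simp
    moreover have "F p t \<bullet> V p t = - \<kappa> p0 t"
      using pF[OF d t] p\<nu>(2)[OF d t] space_constant(1)[OF n2 t p0 p]
      by (simp add: V_def inner_diff_right inner_commute)
    ultimately show ?thesis using y[OF t] by (simp add: mult.commute)
  qed
  ultimately show ?thesis by blast
qed

end

section \<open>The converse: choosing the normal of a family of spheres\<close>

context mcf
begin

text \<open>Since \<open>a\<close> is orthogonal to the tangent spaces, \<open>a = y F + (a \<bullet> \<nu>) \<nu>\<close>.\<close>

lemma constant_height:
  assumes a: "norm a = 1" and height: "\<And>t p. t \<in> I \<Longrightarrow> p \<in> topspace M \<Longrightarrow> F p t \<bullet> a = y t"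
  shows "t \<in> I \<Longrightarrow> p \<in> topspace M \<Longrightarrow> (a \<bullet> \<nu> p t)\<^sup>2 = 1 - (y t)\<^sup>2"
    and "c \<in> \<A> \<Longrightarrow> p \<in> fst c \<Longrightarrow> t \<in> I \<Longrightarrow>
      (a \<bullet> \<nu> p t) * hc c v (snd c p, t) = - y t * gc c v (snd c p, t)"
proof -
  have 1: "a = y t *\<^sub>R F p t + (a \<bullet> \<nu> p t) *\<^sub>R \<nu> p t"
    and 2: "\<And>v. (a \<bullet> \<nu> p t) * hc c v (snd c p, t) = - y t * gc c v (snd c p, t)"
    if c: "c \<in> \<A>" "p \<in> fst c" and t: "t \<in> I" for c p t
  proof -
    interpret C: coordinate_flow "U c \<times> I" "G c" "N c" "HG c" by (rule chart_flow[OF c(1)])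
    have dG: "a \<bullet> dd (v, 0) (G c) z = 0" if z: "z \<in> U c \<times> I" for z v
    proof -
      obtain x s where xs: "z = (x, s)" "x \<in> U c" "s \<in> I" using z by blast
      note df = smooth_differentiable[OF C.smF z]
      have "dd (v, 0) (\<lambda>z. a \<bullet> G c z) z = dd v (\<lambda>x. a \<bullet> G c (x, s)) x"
        unfolding xs(1)
        by (rule dd_slice_x(1)[symmetric, OF differentiable_bounded_linear[OF bounded_linear_inner_right df[unfolded xs(1)]]])
      also have "\<dots> = dd v (\<lambda>x. y s) x"
        by (rule dd_cong_open[OF openU[OF c(1)] xs(2)])
          (use height[OF xs(3) chart_sub[OF c(1) Uinv]] in \<open>simp add: G_def inner_commute\<close>)
      finally show ?thesis
        using dd_bounded_linear[OF bounded_linear_inner_right df, of "(v, 0)" a] by (simp add: dd_const)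
    qed
    note z = inS[OF c t]
    have vals: "G c (snd c p, t) = F p t" "N c (snd c p, t) = \<nu> p t"
      by (simp_all add: G_def N_def Uleft[OF c])
    note Fa = height[OF t chart_sub[OF c]]
    let ?D = "\<lambda>v. dd (v, 0) (G c) (snd c p, t)"
    define u where "u = a - y t *\<^sub>R F p t - (a \<bullet> \<nu> p t) *\<^sub>R \<nu> p t"
    have uD: "u \<bullet> ?D v = 0" for v
      by (simp add: u_def inner_diff_left dG[OF z] F_dG[OF c t] p\<nu>(3)[OF c t])
    have "\<exists>v. u = ?D v"
      by (rule mem_range_of_orthogonal_pair[OF C.dirF[OF z] inj_dF[OF c t] dimE, of "\<nu> p t" "F p t"])
        (use pF[OF c t] p\<nu>[OF c t] F_dG[OF c t] Fa in
          \<open>simp_all add: u_def inner_diff_left inner_commute[of "F p t" "\<nu> p t"] inner_commute[of a "F p t"]\<close>)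
    then obtain v where v: "u = ?D v" by blast
    have "u \<bullet> u = 0" by (subst (2) v) (rule uD)
    then have "u = 0" by simp
    then show a: "a = y t *\<^sub>R F p t + (a \<bullet> \<nu> p t) *\<^sub>R \<nu> p t"
      by (simp add: u_def algebra_simps)
    fix v
    let ?X = "dd (v, 0) (dd (v, 0) (G c)) (snd c p, t)"
    \<comment> \<open>Differentiating \<open>dG\<close> once more shows that \<open>a\<close>
      annihilates the second derivative \<open>?X\<close>. Pairing the decomposition of
      \<open>a\<close> with \<open>?X\<close> then relates \<open>h\<close> and
      \<open>g\<close>.\<close>
    have "dd (v, 0) (\<lambda>z. a \<bullet> dd (v, 0) (G c) z) (snd c p, t) = dd (v, 0) (\<lambda>z. 0) (snd c p, t)"
      by (rule C.cong[OF z]) (rule dG)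
    then have aX: "a \<bullet> ?X = 0"
      using dd_bounded_linear[OF bounded_linear_inner_right smooth_differentiable[OF C.smD(1) z]]
      by (simp add: dd_const)
    have "F p t \<bullet> ?X = - gc c v (snd c p, t)"
      using dd_inner_const[OF C.S C.smF C.smD(1) z, of "(v, 0)" 0 "(v, 0)"] C.F_dF
      by (simp add: vals gc_def)
    moreover have "\<nu> p t \<bullet> ?X = - hc c v (snd c p, t)"
      using C.hh_eq[OF z, of v v] by (simp add: vals hc_def)
    moreover have "a \<bullet> ?X = y t * (F p t \<bullet> ?X) + (a \<bullet> \<nu> p t) * (\<nu> p t \<bullet> ?X)"
      by (subst a) (simp add: inner_add_left)
    ultimately show "(a \<bullet> \<nu> p t) * hc c v (snd c p, t) = - y t * gc c v (snd c p, t)"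
      using aX by simp
  qed
  show "c \<in> \<A> \<Longrightarrow> p \<in> fst c \<Longrightarrow> t \<in> I \<Longrightarrow> (a \<bullet> \<nu> p t) * hc c v (snd c p, t) = - y t * gc c v (snd c p, t)"
    by (rule 2)
  assume t: "t \<in> I" and "p \<in> topspace M"
  then obtain c where c: "c \<in> \<A>" "p \<in> fst c" using cover by blast
  have "a \<bullet> a = y t * (F p t \<bullet> a) + (a \<bullet> \<nu> p t) * (\<nu> p t \<bullet> a)"
    by (subst (1) 1[OF c t]) (simp only: inner_add_left inner_scaleR_left)
  then show "(a \<bullet> \<nu> p t)\<^sup>2 = 1 - (y t)\<^sup>2"
    using a height[OF t chart_sub[OF c]] by (simp add: norm_eq_1 power2_eq_square inner_commute)
qed

text \<open>Needed so that the normal can be reversed as a whole. The sign is constant on each slice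
  because \<open>M\<close> is connected, and along each point because the time interval is.\<close>

lemma normal_sign_constant:
  assumes ne: "\<And>t p. t \<in> I \<Longrightarrow> p \<in> topspace M \<Longrightarrow> a \<bullet> \<nu> p t \<noteq> 0"
  shows "(\<forall>t\<in>I. \<forall>p\<in>topspace M. a \<bullet> \<nu> p t < 0) \<or> (\<forall>t\<in>I. \<forall>p\<in>topspace M. a \<bullet> \<nu> p t > 0)"
proof -
  have connM: "connected_space M" using manifold by (simp add: closed_connected_manifold_def)
  have space: "(a \<bullet> \<nu> p t > 0) = (a \<bullet> \<nu> q t > 0)" if t: "t \<in> I" and pq: "p \<in> topspace M" "q \<in> topspace M" for p q t
  proof (rule connected_space_locally_constant[OF connM _ pq, of "\<lambda>p. a \<bullet> \<nu> p t > 0"])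
    fix p assume pM: "p \<in> topspace M"
    then obtain c where c: "c \<in> \<A>" "p \<in> fst c" using cover by blast
    have "continuous_on (U c) (\<lambda>x. a \<bullet> N c (x, t))"
      by (intro continuous_intros continuous_on_compose2[OF smooth_on_continuous[OF smN[OF c(1)]]]) (use t in auto)
    then have op: "open (U c \<inter> (\<lambda>x. a \<bullet> N c (x, t)) -` B)" if "open B" for B
      using continuous_on_open_vimage[OF openU[OF c(1)]] that by (metis Int_commute)
    define B where "B = (if a \<bullet> \<nu> p t > 0 then {0<..} else {..<0 :: real})"
    let ?V = "U c \<inter> (\<lambda>x. a \<bullet> N c (x, t)) -` B"
    have N: "N c (snd c q, t) = \<nu> q t" if "q \<in> fst c" for q by (simp add: N_def Uleft[OF c(1) that])
    show "\<exists>W. openin M W \<and> p \<in> W \<and> (\<forall>q\<in>W. (a \<bullet> \<nu> q t > 0) = (a \<bullet> \<nu> p t > 0))"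
    proof (intro exI[of _ "{q \<in> fst c. snd c q \<in> ?V}"] conjI)
      show "openin M {q \<in> fst c. snd c q \<in> ?V}"
        by (intro openin_chart_preimage[OF c(1)] op) (auto simp: B_def)
      show "p \<in> {q \<in> fst c. snd c q \<in> ?V}"
        using c(2) inU[OF c(2)] N[OF c(2)] ne[OF t pM] by (auto simp: B_def)
      show "\<forall>q\<in>{q \<in> fst c. snd c q \<in> ?V}. (a \<bullet> \<nu> q t > 0) = (a \<bullet> \<nu> p t > 0)"
        using N by (auto simp: B_def split: if_splits)
    qed
  qed
  have time: "(a \<bullet> \<nu> p t > 0) = (a \<bullet> \<nu> p s > 0)" if p: "p \<in> topspace M" and t: "t \<in> I" "s \<in> I" for p t s
  proof -
    obtain c where c: "c \<in> \<A>" "p \<in> fst c" using cover[OF p] by blast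
    have "continuous_on I (\<lambda>t. a \<bullet> N c (snd c p, t))"
      by (intro continuous_intros continuous_on_compose2[OF smooth_on_continuous[OF smN[OF c(1)]]])
        (use inU[OF c(2)] in auto)
    then have "connected ((\<lambda>t. a \<bullet> N c (snd c p, t)) ` I)"
      by (rule connected_continuous_image) (rule convex_connected[OF convex_ancient_interval])
    then have conn: "connected ((\<lambda>t. a \<bullet> \<nu> p t) ` I)" by (simp add: N_def Uleft[OF c])
    have "0 \<notin> (\<lambda>t. a \<bullet> \<nu> p t) ` I" using ne[OF _ p] by force
    then have "\<not> (a \<bullet> \<nu> p t1 < 0 \<and> 0 < a \<bullet> \<nu> p t2)" if "t1 \<in> I" "t2 \<in> I" for t1 t2
      using connected_contains_Icc[OF conn imageI[OF that(1)] imageI[OF that(2)]]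
      by (auto simp: subset_iff)
    then show ?thesis using ne[OF t(1) p] ne[OF t(2) p] t by (meson not_less_iff_gr_or_eq)
  qed
  have "(a \<bullet> \<nu> p t > 0) = (a \<bullet> \<nu> q s > 0)"
    if "p \<in> topspace M" "q \<in> topspace M" "t \<in> I" "s \<in> I" for p q t s
    using space[OF that(3,1,2)] time[OF that(2,3,4)] by simp
  then show ?thesis using ne by (meson not_less_iff_gr_or_eq)
qed

end

text \<open>The cap is the radial projection of a convex cone. \<open>y \<ge> 0\<close> makes
  \<open>y * norm x\<close> a convex function, and the strict inequality keeps the origin out of the
  cone.\<close>

lemma connected_spherical_cap:
  fixes a :: "'e::euclidean_space"
  assumes "y \<ge> 0"
  shows "connected {x \<in> sphere 0 1. x \<bullet> a > y}"
proof -
  let ?K = "{x. x \<bullet> a > y * norm x}"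
  have "convex ?K"
  proof (rule convexI)
    fix u v :: 'e and s t :: real
    assume uv: "u \<in> ?K" "v \<in> ?K" and st: "0 \<le> s" "0 \<le> t" "s + t = 1"
    have "norm (s *\<^sub>R u + t *\<^sub>R v) \<le> s * norm u + t * norm v"
      using norm_triangle_ineq[of "s *\<^sub>R u" "t *\<^sub>R v"] st by simp
    then have "y * norm (s *\<^sub>R u + t *\<^sub>R v) \<le> s * (y * norm u) + t * (y * norm v)"
      using mult_left_mono[OF _ assms] by (fastforce simp: algebra_simps)
    also have "\<dots> < s * (u \<bullet> a) + t * (v \<bullet> a)"
    proof (cases "s = 0")
      case True
      then show ?thesis using st uv by simp
    next
      case False
      then show ?thesis using st uv by (intro add_less_le_mono mult_strict_left_mono mult_left_mono) auto
    qed
    finally show "s *\<^sub>R u + t *\<^sub>R v \<in> ?K" by (simp add: inner_add_left)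
  qed
  moreover have "continuous_on ?K (\<lambda>x. x /\<^sub>R norm x)"
    by (intro continuous_intros) auto
  ultimately have "connected ((\<lambda>x. x /\<^sub>R norm x) ` ?K)"
    by (intro connected_continuous_image convex_connected)
  moreover have "(\<lambda>x. x /\<^sub>R norm x) ` ?K = {x \<in> sphere 0 1. x \<bullet> a > y}"
  proof (intro equalityI subsetI)
    fix z assume "z \<in> (\<lambda>x. x /\<^sub>R norm x) ` ?K"
    then obtain x where x: "x \<bullet> a > y * norm x" "z = x /\<^sub>R norm x" by blast
    then have "norm x > 0" by (cases "x = 0") auto
    then show "z \<in> {x \<in> sphere 0 1. x \<bullet> a > y}"
      using x by (simp add: field_simps)
  next
    fix z assume "z \<in> {x \<in> sphere 0 1. x \<bullet> a > y}"
    then show "z \<in> (\<lambda>x. x /\<^sub>R norm x) ` ?K" by (intro image_eqI[of _ _ z]) auto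
  qed
  ultimately show ?thesis by simp
qed

text \<open>A larger connected set avoiding height \<open>y\<close> would be split by the two open
  half-spaces.\<close>

lemma spherical_cap_component:
  fixes a :: "'e::euclidean_space"
  assumes "norm a = 1" "0 \<le> y" "y < 1"
  shows "{x \<in> sphere 0 1. x \<bullet> a > y} \<in> components (sphere 0 1 - {x \<in> sphere 0 1. x \<bullet> a = y})"
proof -
  let ?C = "{x \<in> sphere 0 1. x \<bullet> a > y}"
  have "a \<in> ?C" using assms by (simp add: norm_eq_1)
  moreover have "d = ?C" if d: "?C \<subseteq> d" "d \<subseteq> sphere 0 1 - {x \<in> sphere 0 1. x \<bullet> a = y}" "connected d" for d
  proof (rule ccontr)
    assume "d \<noteq> ?C"
    then obtain x where x: "x \<in> d" "x \<bullet> a < y" using d by force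
    have "{x. x \<bullet> a < y} \<inter> {x. x \<bullet> a > y} \<inter> d = {}" by auto
    moreover have "d \<subseteq> {x. x \<bullet> a < y} \<union> {x. x \<bullet> a > y}" using d(2) by force
    moreover have "open {x. x \<bullet> a < y}" "open {x. x \<bullet> a > y}"
      by (auto intro!: open_Collect_less continuous_intros)
    ultimately have "{x. x \<bullet> a < y} \<inter> d = {} \<or> {x. x \<bullet> a > y} \<inter> d = {}"
      using d(3) unfolding connected_def by blast
    then show False using x \<open>a \<in> ?C\<close> d(1) by blast
  qed
  ultimately show ?thesis
    unfolding in_components_maximal using connected_spherical_cap[OF assms(2), of a] by blast
qed

text \<open>The mean curvature and the normal change sign together, so the velocity and hence the
  flow are unaffected by reversing the normal.\<close>

lemma mean_curvature_uminus:
  fixes f \<nu> :: "'p \<Rightarrow> 'e::euclidean_space"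
  assumes "\<And>v. chart_deriv c (\<lambda>p. - \<nu> p) p v = - chart_deriv c \<nu> p v"
  shows "second_fundamental_form c f (\<lambda>p. - \<nu> p) p v w = - second_fundamental_form c f \<nu> p v w"
    and "mean_curvature c f (\<lambda>p. - \<nu> p) p = - mean_curvature c f \<nu> p"
proof -
  show sff: "second_fundamental_form c f (\<lambda>p. - \<nu> p) p v w = - second_fundamental_form c f \<nu> p v w" for v w
    by (simp add: second_fundamental_form_def sphere_cov_deriv_def assms inner_diff_left)
  show "mean_curvature c f (\<lambda>p. - \<nu> p) p = - mean_curvature c f \<nu> p"
    by (simp add: mean_curvature_def form_matrix_def sff trace_def matrix_matrix_mult_def sum_negf)
qed

context mcf
begin

text \<open>If \<nu> points towards \<open>a\<close>, the opposite normal is outer with respect to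
  the cap around \<open>a\<close>, which is then taken as the enclosed region.\<close>

lemma flip_normal:
  assumes a: "norm a = 1"
    and y: "\<And>t. t \<in> I \<Longrightarrow> 0 \<le> y t \<and> y t < 1"
    and im: "\<And>t. t \<in> I \<Longrightarrow> (\<lambda>p. F p t) ` topspace M = {x \<in> sphere 0 1. x \<bullet> a = y t}"
    and pos: "\<And>t p. t \<in> I \<Longrightarrow> p \<in> topspace M \<Longrightarrow> a \<bullet> \<nu> p t > 0"
  shows "mcf M \<A> T F (\<lambda>p t. - \<nu> p t)"
proof
  show "closed_connected_manifold M \<A>" by (rule manifold)
  show "DIM('e) = CARD('n) + 2" by (rule dimE)
  have height: "F p t \<bullet> a = y t" if "t \<in> I" "p \<in> topspace M" for p t
    using im[OF that(1)] that(2) by blast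
  have cd: "chart_deriv c (\<lambda>p. - \<nu> p t) p v = - chart_deriv c (\<lambda>p. \<nu> p t) p v"
    if c: "c \<in> \<A>" "p \<in> fst c" and t: "t \<in> I" for c p t v
  proof -
    have "(\<lambda>p. - \<nu> p t) \<circ> chart_inv c = (\<lambda>x. - N c (x, t))" by (simp add: N_def fun_eq_iff)
    moreover have "dd v (\<lambda>x. - N c (x, t)) (snd c p) = - dd v (\<lambda>x. N c (x, t)) (snd c p)"
      by (rule dd_bounded_linear[OF bounded_linear_minus[OF bounded_linear_ident]
            dd_slice_x(2)[OF smooth_differentiable[OF smN[OF c(1)] inS[OF c t]]]])
    ultimately show ?thesis by (simp add: chart_deriv_dd slice_N)
  qed
  have "smooth_family \<A> I (\<lambda>p t. - \<nu> p t)"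
    unfolding smooth_family_def
  proof
    fix c assume c: "c \<in> \<A>"
    have "smooth_on (U c \<times> I) (\<lambda>z. - N c z)" by (rule smooth_on_minus[OF openS[OF c] smN[OF c]])
    then show "smooth_on (snd c ` fst c \<times> I) (\<lambda>(x, t). - \<nu> (chart_inv c x) t)"
      by (simp add: U_def N_def case_prod_beta')
  qed
  moreover have "outer_unit_normal M \<A> (\<lambda>p. F p t) (\<lambda>p. - \<nu> p t)" if t: "t \<in> I" for t
    unfolding outer_unit_normal_def
  proof (intro conjI ballI bexI[of _ "{x \<in> sphere 0 1. x \<bullet> a > y t}"])
    show "{x \<in> sphere 0 1. x \<bullet> a > y t} \<in> components (sphere 0 1 - (\<lambda>p. F p t) ` topspace M)"
      unfolding im[OF t] using y[OF t] by (intro spherical_cap_component a) auto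
    show "norm (- \<nu> p t) = 1" "- \<nu> p t \<bullet> F p t = 0" "\<forall>v. - \<nu> p t \<bullet> chart_deriv c (\<lambda>p. F p t) p v = 0"
      if "c \<in> \<A>" "p \<in> fst c" for c p
      using p\<nu>[OF that t] by (simp_all add: norm_eq_1 cd_F[OF that t])
    fix p assume p: "p \<in> topspace M"
    obtain c where c: "c \<in> \<A>" "p \<in> fst c" using cover[OF p] by blast
    define \<sigma> where "\<sigma> = a \<bullet> \<nu> p t"
    have \<sigma>: "\<sigma> > 0" using pos[OF t p] by (simp add: \<sigma>_def)
    have unit: "cos s *\<^sub>R F p t + k *\<^sub>R \<nu> p t \<in> sphere 0 1" if "k\<^sup>2 = (sin s)\<^sup>2" for s k
    proof -
      have "(cos s *\<^sub>R F p t + k *\<^sub>R \<nu> p t) \<bullet> (cos s *\<^sub>R F p t + k *\<^sub>R \<nu> p t) = (cos s)\<^sup>2 + k\<^sup>2"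
        using pF[OF c t] p\<nu>[OF c t]
        by (simp add: inner_add_left inner_add_right power2_eq_square inner_commute[of "F p t" "\<nu> p t"])
      then show ?thesis using that by (simp add: norm_eq_1)
    qed
    have ip: "(cos s *\<^sub>R F p t + k *\<^sub>R \<nu> p t) \<bullet> a = y t * cos s + k * \<sigma>" for s k
      using height[OF t p] by (simp add: inner_add_left \<sigma>_def inner_commute[of "\<nu> p t"])
    \<comment> \<open>Heights along the two normal geodesics: their slopes at 0 are \<sigma> and its
      negative, so for small positive \<open>s\<close> one geodesic enters the cap and the other
      leaves it.\<close>
    have "DERIV (\<lambda>s. y t * cos s + sin s * \<sigma>) 0 :> \<sigma>" "DERIV (\<lambda>s. y t * cos s + - sin s * \<sigma>) 0 :> - \<sigma>"
      by (auto intro!: derivative_eq_intros)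
    from has_real_derivative_pos_inc_right[OF this(1)] has_real_derivative_neg_dec_right[OF this(2)] \<sigma>
    obtain d1 d2 where d: "d1 > 0" "\<And>h. 0 < h \<Longrightarrow> h < d1 \<Longrightarrow> y t < y t * cos h + sin h * \<sigma>"
      "d2 > 0" "\<And>h. 0 < h \<Longrightarrow> h < d2 \<Longrightarrow> y t * cos h + - sin h * \<sigma> < y t"
      by auto
    show "\<forall>\<^sub>F s in at_right 0. cos s *\<^sub>R F p t - sin s *\<^sub>R - \<nu> p t \<in> {x \<in> sphere 0 1. x \<bullet> a > y t} \<and>
        cos s *\<^sub>R F p t + sin s *\<^sub>R - \<nu> p t \<notin> {x \<in> sphere 0 1. x \<bullet> a > y t}"
      unfolding eventually_at_right_field
    proof (intro exI[of _ "min d1 d2"] conjI allI impI)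
      show "0 < min d1 d2" using d by simp
      fix s :: real assume s: "0 < s" "s < min d1 d2"
      have "cos s *\<^sub>R F p t + sin s *\<^sub>R \<nu> p t \<in> {x \<in> sphere 0 1. x \<bullet> a > y t}"
        using unit[of "sin s" s] ip[of s "sin s"] d(2)[of s] s by simp
      then show "cos s *\<^sub>R F p t - sin s *\<^sub>R - \<nu> p t \<in> {x \<in> sphere 0 1. x \<bullet> a > y t}" by simp
      show "cos s *\<^sub>R F p t + sin s *\<^sub>R - \<nu> p t \<notin> {x \<in> sphere 0 1. x \<bullet> a > y t}"
        using ip[of s "- sin s"] d(4)[of s] s by simp
    qed
  qed
  moreover have "(F p has_vector_derivative
      - (mean_curvature c (\<lambda>q. F q t) (\<lambda>q. - \<nu> q t) p *\<^sub>R - \<nu> p t)) (at t)"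
    if "c \<in> \<A>" "p \<in> fst c" "t \<in> I" for c p t
    using vel[OF that] by (simp add: mean_curvature_uminus(2)[OF cd[OF that]])
  ultimately show "ancient_embedded_mcf M \<A> T F (\<lambda>p t. - \<nu> p t)"
    using flow unfolding ancient_embedded_mcf_def by simp
qed

text \<open>By \<open>constant_height\<close>, \<open>(a \<bullet> \<nu>) h = - y g\<close>;
  dividing by the negative factor gives \<open>h\<close> the sign of \<open>y\<close>.\<close>

lemma weakly_convex_of_height:
  assumes a: "norm a = 1"
    and height: "\<And>t p. t \<in> I \<Longrightarrow> p \<in> topspace M \<Longrightarrow> F p t \<bullet> a = y t"
    and y: "\<And>t. t \<in> I \<Longrightarrow> 0 \<le> y t \<and> y t < 1"
    and neg: "\<And>t p. t \<in> I \<Longrightarrow> p \<in> topspace M \<Longrightarrow> a \<bullet> \<nu> p t < 0"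
  shows "weakly_convex \<A> T F \<nu>"
  unfolding weakly_convex_def
proof (intro ballI allI)
  fix t c p v assume c: "t \<in> I" "c \<in> \<A>" "p \<in> fst c"
  have "(a \<bullet> \<nu> p t) * hc c v (snd c p, t) = - y t * gc c v (snd c p, t)"
    by (rule constant_height(2)[OF a height c(2,3,1)])
  moreover have "y t * gc c v (snd c p, t) \<ge> 0" using y[OF c(1)] by (simp add: gc_def)
  ultimately have "(a \<bullet> \<nu> p t) * hc c v (snd c p, t) \<le> 0" by simp
  then show "second_fundamental_form c (\<lambda>q. F q t) (\<lambda>q. \<nu> q t) p v v \<ge> 0"
    using neg[OF c(1) chart_sub[OF c(2,3)]] unfolding sff[OF c(2,3,1)] by (simp add: mult_le_0_iff)
qed

lemma convex_of_height:
  assumes a: "norm a = 1"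
    and y: "\<And>t. t \<in> I \<Longrightarrow> 0 \<le> y t \<and> y t < 1"
    and im: "\<And>t. t \<in> I \<Longrightarrow> (\<lambda>p. F p t) ` topspace M = {x \<in> sphere 0 1. x \<bullet> a = y t}"
  shows "ancient_weakly_convex_embedded_solution M \<A> T F"
proof -
  have height: "F p t \<bullet> a = y t" if "t \<in> I" "p \<in> topspace M" for p t
    using im[OF that(1)] that(2) by blast
  have "a \<bullet> \<nu> p t \<noteq> 0" if t: "t \<in> I" and p: "p \<in> topspace M" for t p
  proof
    assume "a \<bullet> \<nu> p t = 0"
    then have "(y t)\<^sup>2 = 1" using constant_height(1)[OF a height t p] by simp
    then show False using y[OF t] by (auto simp: power2_eq_1_iff)
  qed
  from normal_sign_constant[OF this] consider
    "\<forall>t\<in>I. \<forall>p\<in>topspace M. a \<bullet> \<nu> p t < 0" | "\<forall>t\<in>I. \<forall>p\<in>topspace M. a \<bullet> \<nu> p t > 0" by blast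
  then show ?thesis
  proof cases
    case 1
    then have "weakly_convex \<A> T F \<nu>" by (intro weakly_convex_of_height[OF a height y]) auto
    then show ?thesis using flow unfolding ancient_weakly_convex_embedded_solution_def by blast
  next
    case 2
    \<comment> \<open>Re-entering the locale with the opposite normal reduces this case to the first
      one.\<close>
    interpret R: mcf M \<A> T F "\<lambda>p t. - \<nu> p t" by (rule flip_normal[OF a y im]) (use 2 in auto)
    have "weakly_convex \<A> T F (\<lambda>p t. - \<nu> p t)"
      by (rule R.weakly_convex_of_height[OF a height y]) (use 2 in auto)
    then show ?thesis using R.flow unfolding ancient_weakly_convex_embedded_solution_def by blast
  qed
qed

end

section \<open>Assembling the classification\<close>

lemma geodesic_sphere_eq:
  assumes a: "norm a = 1" and y: "\<bar>y\<bar> \<le> 1"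
  shows "geodesic_sphere a (arccos y) = {x \<in> sphere 0 1. x \<bullet> a = y}"
proof -
  have "\<bar>x \<bullet> a\<bar> \<le> 1" if "norm x = 1" for x
    using Cauchy_Schwarz_ineq2[of x a] that a by simp
  then show ?thesis
    using y by (auto simp: geodesic_sphere_def spherical_dist_def arccos_eq_iff)
qed

theorem mainTheorem2:
  fixes n :: nat
    and M :: "'p topology"
    and \<A> :: "('p, 'n::finite) chart set"
    and T :: ereal
    and F :: "'p \<Rightarrow> real \<Rightarrow> real ^ 'm::finite"
  assumes "n \<ge> 2" and "CARD('n) = n" and "CARD('m) = n + 2"
    and "closed_connected_manifold M \<A>"
    and "T > -\<infinity>"
  shows "ancient_weakly_convex_embedded_solution M \<A> T F \<longleftrightarrow>
           stationary_equator_solution M \<A> T F \<or> shrinking_geodesic_spheres M \<A> T F"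
proof
  have mcfI: "mcf M \<A> T F \<nu>" if "ancient_embedded_mcf M \<A> T F \<nu>" for \<nu>
    by unfold_locales (use that assms in auto)
  \<comment> \<open>A time in the interval is needed for \<open>height\<close> to determine the sign
    of \<open>C\<close>.\<close>
  have ne: "ancient_interval T \<noteq> {}"
    using ereal_dense2[OF assms(5)] by (auto simp: ancient_interval_def)
  assume "ancient_weakly_convex_embedded_solution M \<A> T F"
  then obtain \<nu> where \<nu>: "ancient_embedded_mcf M \<A> T F \<nu>" "weakly_convex \<A> T F \<nu>"
    unfolding ancient_weakly_convex_embedded_solution_def by blast
  interpret convex_mcf M \<A> T F \<nu>
    using mcfI[OF \<nu>(1)] \<nu>(2) by (simp add: convex_mcf_def convex_mcf_axioms_def)
  have n2: "CARD('n) \<ge> 2" using assms by simp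
  obtain e C where e: "norm e = 1" "C \<ge> 0" "\<forall>t\<in>ancient_interval T. C * exp (real CARD('n) * t) < 1 \<and>
    (\<forall>p\<in>topspace M. F p t \<bullet> e = - (C * exp (real CARD('n) * t)))"
    using height[OF n2 ne] by blast
  show "stationary_equator_solution M \<A> T F \<or> shrinking_geodesic_spheres M \<A> T F"
  proof (cases "C = 0")
    case True
    have "(\<lambda>p. F p t) ` topspace M = equator e" if "t \<in> ancient_interval T" for t
      unfolding equator_def by (rule image_full[OF that e(1)]) (use e(3) True that in auto)
    then have "stationary_equator_solution M \<A> T F"
      unfolding stationary_equator_solution_def using \<nu>(1) e(1) by blast
    then show ?thesis ..
  next
    case False
    define y where "y t = C * exp (real CARD('n) * t)" for t
    define \<rho> where "\<rho> t = arccos (y t)" for t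
    have y: "0 < y t" "y t < 1" if "t \<in> ancient_interval T" for t
      using e(2,3) False that by (auto simp: y_def)
    \<comment> \<open>The height over \<open>e\<close> is \<open>- y t\<close>, so the centre is
      \<open>- e\<close>.\<close>
    have "(\<lambda>p. F p t) ` topspace M = geodesic_sphere (- e) (\<rho> t)" if t: "t \<in> ancient_interval T" for t
    proof -
      have "(\<lambda>p. F p t) ` topspace M = {x \<in> sphere 0 1. x \<bullet> (- e) = y t}"
        by (rule image_full[OF t]) (use e(1,3) y[OF t] t in \<open>auto simp: y_def\<close>)
      then show ?thesis
        using geodesic_sphere_eq[of "- e" "y t"] e(1) y[OF t] by (simp add: \<rho>_def)
    qed
    moreover have "0 < \<rho> t \<and> \<rho> t < pi / 2" if "t \<in> ancient_interval T" for t
      using arccos_less_arccos[of "y t" 1] arccos_less_arccos[of 0 "y t"] y[OF that] by (simp add: \<rho>_def)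
    moreover have "monotone_on (ancient_interval T) (<) (>) \<rho>"
    proof (rule monotone_onI)
      fix s t assume st: "s \<in> ancient_interval T" "t \<in> ancient_interval T" "s < t"
      have "y s < y t" using st(3) e(2) False by (simp add: y_def)
      then show "\<rho> s > \<rho> t"
        unfolding \<rho>_def using y[OF st(1)] y[OF st(2)] by (intro arccos_less_arccos) auto
    qed
    moreover have "- e \<in> sphere 0 1" using e(1) by simp
    ultimately have "shrinking_geodesic_spheres M \<A> T F"
      unfolding shrinking_geodesic_spheres_def using \<nu>(1) by blast
    then show ?thesis ..
  qed
next
  have mcfI: "mcf M \<A> T F \<nu>" if "ancient_embedded_mcf M \<A> T F \<nu>" for \<nu>
    by unfold_locales (use that assms in auto)
  assume "stationary_equator_solution M \<A> T F \<or> shrinking_geodesic_spheres M \<A> T F"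
  then show "ancient_weakly_convex_embedded_solution M \<A> T F"
  proof
    assume "stationary_equator_solution M \<A> T F"
    then obtain \<nu> e where \<nu>: "ancient_embedded_mcf M \<A> T F \<nu>" and e: "norm e = 1"
      "\<forall>t\<in>ancient_interval T. (\<lambda>p. F p t) ` topspace M = equator e"
      unfolding stationary_equator_solution_def by blast
    interpret mcf M \<A> T F \<nu> by (rule mcfI[OF \<nu>])
    show ?thesis
      by (rule convex_of_height[OF e(1), of "\<lambda>t. 0"]) (use e(2) in \<open>auto simp: equator_def\<close>)
  next
    assume "shrinking_geodesic_spheres M \<A> T F"
    then obtain \<nu> a \<rho> where \<nu>: "ancient_embedded_mcf M \<A> T F \<nu>" and a: "a \<in> sphere 0 1" and
      \<rho>: "\<forall>t\<in>ancient_interval T. 0 < \<rho> t \<and> \<rho> t < pi / 2 \<and>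
           (\<lambda>p. F p t) ` topspace M = geodesic_sphere a (\<rho> t)"
      unfolding shrinking_geodesic_spheres_def by blast
    interpret mcf M \<A> T F \<nu> by (rule mcfI[OF \<nu>])
    \<comment> \<open>A geodesic sphere of radius \<rho> is the slice at height
      \<open>cos \<rho>\<close>, and the bounds on \<rho> place that height in the range that
      \<open>convex_of_height\<close> requires.\<close>
    have y: "0 \<le> cos (\<rho> t) \<and> cos (\<rho> t) < 1" if "t \<in> ancient_interval T" for t
      using \<rho> that cos_monotone_0_pi[of 0 "\<rho> t"] cos_gt_zero[of "\<rho> t"] by fastforce
    show ?thesis
    proof (rule convex_of_height[of a "\<lambda>t. cos (\<rho> t)"])
      show "norm a = 1" using a by simp
      fix t assume t: "t \<in> ancient_interval T"
      show "0 \<le> cos (\<rho> t) \<and> cos (\<rho> t) < 1" by (rule y[OF t])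
      have "arccos (cos (\<rho> t)) = \<rho> t" using \<rho> t by (intro arccos_cos) force+
      then show "(\<lambda>p. F p t) ` topspace M = {x \<in> sphere 0 1. x \<bullet> a = cos (\<rho> t)}"
        using \<rho> t geodesic_sphere_eq[of a "cos (\<rho> t)"] a by simp
    qed
  qed
qed

end
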